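(* Let $k,n\in\mathbb{N}$, $r\in\mathbb{N}_0$, $A>0$, $0<p\le\infty$, let $\alpha,\beta$ be real numbers with $\alpha+r/2,\ \beta+r/2\in J_p$, and put $q:=\min\{1,p\}$. There is a positive constant $\varrho$ that depends only on $\alpha,\beta,k$ and $q$ such that, if $0<t\le \varrho\, n^{-1}$, then for any polynomial $P_n\in\mathbb{P}_n$, $$\omega_{k,r}^{\varphi}(P_n^{(r)},t)_{\alpha,\beta,p}\ \sim\ \Psi_{k,r}^{\varphi}(P_n^{(r)},t)_{\alpha,\beta,p}\ \sim\ \Omega_{k,r}^{\varphi}(P_n^{(r)},A,t)_{\alpha,\beta,p}\ \sim\ t^{k}\left\|w_{\alpha,\beta}\,\varphi^{k+r}P_n^{(k+r)}\right\|_p ,$$ where the equivalence constants depend only on $k,r,\alpha,\beta,A$ and $q$.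
   Context: $\mathbb{P}_n$ is the set of algebraic polynomials of degree $\le n-1$; $\|\cdot\|_p$ is the $L_p[-1,1]$ (quasi-)norm. $J_p:=(-1/p,\infty)$ if $0<p<\infty$ and $J_\infty:=[0,\infty)$. $w_{\alpha,\beta}(x):=(1-x)^\alpha(1+x)^\beta$ and $\varphi(x):=\sqrt{1-x^2}$. For an interval $S$, the $k$th symmetric difference is $\Delta_h^k(g,x;S):=\sum_{i=0}^k\binom{k}{i}(-1)^{k-i}g(x-\tfrac{kh}{2}+ih)$ if $[x-\tfrac{kh}{2},x+\tfrac{kh}{2}]\subseteq S$, and $\Delta_h^k(g,x;S):=0$ otherwise; $\Delta_h^k(g,x):=\Delta_h^k(g,x;[-1,1])$. Below the step at the point $x$ is $h\varphi(x)$. Put $\mathcal{W}_\delta^{\xi,\zeta}(x):=(1-x-\delta\varphi(x)/2)^\xi(1+x-\delta\varphi(x)/2)^\zeta$. The moduli are $$\omega_{k,r}^{\varphi}(f^{(r)},t)_{\alpha,\beta,p}:=\sup_{0\le h\le t}\left\|\mathcal{W}_{kh}^{r/2+\alpha,r/2+\beta}(\cdot)\,\Delta_{h\varphi(\cdot)}^k(f^{(r)},\cdot)\right\|_p$$ (the function inside the norm is understood as $0$ wherever $[x-kh\varphi(x)/2,x+kh\varphi(x)/2]\not\subseteq[-1,1]$), $$\Psi_{k,r}^{\varphi}(f^{(r)},t)_{\alpha,\beta,p}:=\sup_{0\le h\le t}\left\|w_{\alpha,\beta}(\cdot)\varphi^r(\cdot)\,\Delta_{h\varphi(\cdot)}^k(f^{(r)},\cdot)\right\|_p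 ,$$ $$\Omega_{k,r}^{\varphi}(f^{(r)},A,t)_{\alpha,\beta,p}:=\sup_{0\le h\le t}\left\|w_{\alpha,\beta}(\cdot)\varphi^r(\cdot)\,\Delta_{h\varphi(\cdot)}^k(f^{(r)},\cdot;\mathcal{I}_{A,h})\right\|_{L_p(\mathcal{I}_{A,h})},\quad \mathcal{I}_{A,h}:=[-1+Ah^2,1-Ah^2].$$ $X\sim Y$ means $c^{-1}Y\le X\le cY$ for some constant $c\ge1$ (the equivalence constant).
   Formalization: The constant in the upper estimate of ω by Ψ may also depend on p when α+r/2<0 or β+r/2<0, since with dependence on q alone the claim fails (k=1, r=0, α=−1/2, β=0, P=x, p→2 from below); all other constants are as stated. *)

theory Defs
  imports "HOL-Probability.Essential_Supremum" "HOL-Computational_Algebra.Polynomial"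
begin

text \<open>The exponent \<open>p\<close> ranges over \<open>0 < p \<le> \<infinity>\<close> and has type \<^typ>\<open>ennreal\<close>. Norms, hence moduli,
  are \<^typ>\<open>ennreal\<close>-valued, so that suprema and integrals of unbounded functions are meaningful.\<close>

definition Lp_norm :: "ennreal \<Rightarrow> real set \<Rightarrow> (real \<Rightarrow> real) \<Rightarrow> ennreal" where
  "Lp_norm p S g =
     (if p = \<infinity> then esssup (lebesgue_on S) (\<lambda>x. ennreal \<bar>g x\<bar>)
      else let I = (\<integral>\<^sup>+ x. ennreal (\<bar>g x\<bar> powr enn2real p) \<partial>lebesgue_on S)
           in if I = \<infinity> then \<infinity> else ennreal (enn2real I powr (1 / enn2real p)))"

definition J_set :: "ennreal \<Rightarrow> real set" where
  "J_set p = (if p = \<infinity> then {0..} else {- 1 / enn2real p <..})"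

definition jacobi_w :: "real \<Rightarrow> real \<Rightarrow> real \<Rightarrow> real" where
  "jacobi_w \<alpha> \<beta> x = (1 - x) powr \<alpha> * (1 + x) powr \<beta>"

definition \<phi> :: "real \<Rightarrow> real" where
  "\<phi> x = sqrt (1 - x\<^sup>2)"

definition sym_diff :: "nat \<Rightarrow> real \<Rightarrow> (real \<Rightarrow> real) \<Rightarrow> real \<Rightarrow> real set \<Rightarrow> real" where
  "sym_diff k h g x S =
     (if {x - real k * h / 2 .. x + real k * h / 2} \<subseteq> S
      then \<Sum>i=0..k. real (k choose i) * (-1) ^ (k - i) * g (x - real k * h / 2 + real i * h)
      else 0)"

text \<open>Where one of the two bases is negative, \<open>\<W>\<close> is meaningless, but it is only ever multiplied by
  a difference which is \<open>0\<close> there. The convention \<open>0 powr 0 = 0\<close> affects \<open>jacobi_w\<close> and \<open>\<W>\<close> only on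
  null sets.\<close>

definition \<W> :: "real \<Rightarrow> real \<Rightarrow> real \<Rightarrow> real \<Rightarrow> real" where
  "\<W> \<delta> \<xi> \<zeta> x = (1 - x - \<delta> * \<phi> x / 2) powr \<xi> * (1 + x - \<delta> * \<phi> x / 2) powr \<zeta>"

text \<open>In the three moduli, the argument \<open>g\<close> stands for \<open>f\<^sup>(\<^sup>r\<^sup>)\<close>.\<close>

definition \<omega>_modulus ::
  "nat \<Rightarrow> nat \<Rightarrow> (real \<Rightarrow> real) \<Rightarrow> real \<Rightarrow> real \<Rightarrow> real \<Rightarrow> ennreal \<Rightarrow> ennreal" where
  "\<omega>_modulus k r g t \<alpha> \<beta> p =
     (SUP h\<in>{0..t}. Lp_norm p {-1..1}
        (\<lambda>x. \<W> (real k * h) (real r / 2 + \<alpha>) (real r / 2 + \<beta>) x * sym_diff k (h * \<phi> x) g x {-1..1}))"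

definition \<Psi>_modulus ::
  "nat \<Rightarrow> nat \<Rightarrow> (real \<Rightarrow> real) \<Rightarrow> real \<Rightarrow> real \<Rightarrow> real \<Rightarrow> ennreal \<Rightarrow> ennreal" where
  "\<Psi>_modulus k r g t \<alpha> \<beta> p =
     (SUP h\<in>{0..t}. Lp_norm p {-1..1}
        (\<lambda>x. jacobi_w \<alpha> \<beta> x * \<phi> x ^ r * sym_diff k (h * \<phi> x) g x {-1..1}))"

definition \<I> :: "real \<Rightarrow> real \<Rightarrow> real set" where
  "\<I> A h = {-1 + A * h\<^sup>2 .. 1 - A * h\<^sup>2}"

definition \<Omega>_modulus ::
  "nat \<Rightarrow> nat \<Rightarrow> (real \<Rightarrow> real) \<Rightarrow> real \<Rightarrow> real \<Rightarrow> real \<Rightarrow> real \<Rightarrow> ennreal \<Rightarrow> ennreal" where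
  "\<Omega>_modulus k r g A t \<alpha> \<beta> p =
     (SUP h\<in>{0..t}. Lp_norm p (\<I> A h)
        (\<lambda>x. jacobi_w \<alpha> \<beta> x * \<phi> x ^ r * sym_diff k (h * \<phi> x) g x (\<I> A h)))"

abbreviation poly_deriv :: "nat \<Rightarrow> real poly \<Rightarrow> real \<Rightarrow> real" where
  "poly_deriv m P \<equiv> poly ((pderiv ^^ m) P)"

text \<open>\<open>X \<sim> Y\<close> with equivalence constant \<open>c\<close> is \<open>sim c c X Y\<close>. The two sides carry separate constants
  because the upper estimate of \<open>\<omega>_modulus\<close> cannot be uniform in all \<open>p\<close> with the same
  \<open>min 1 p\<close>: for \<open>k = 1\<close>, \<open>r = 0\<close>, \<open>\<alpha> = -1/2\<close>, \<open>\<beta> = 0\<close>, \<open>P = x\<close> and fixed \<open>t\<close>, its weight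
  behaves like \<open>(x\<^sub>h - x) powr (-1/2)\<close> at the end \<open>x\<^sub>h\<close> of the domain of the difference, so
  \<open>\<omega>_modulus\<close> tends to \<open>\<infinity>\<close> as \<open>p\<close> increases to \<open>2\<close>, whereas
  \<open>t * Lp_norm p {-1..1} (\<lambda>x. jacobi_w \<alpha> \<beta> x * \<phi> x)\<close> stays bounded.\<close>

definition sim :: "real \<Rightarrow> real \<Rightarrow> ennreal \<Rightarrow> ennreal \<Rightarrow> bool" where
  "sim c C X Y \<longleftrightarrow> ennreal (1 / c) * Y \<le> X \<and> X \<le> ennreal C * Y"

end

theory Submission
  imports Defs
begin

text \<open>
  Write \<open>Q\<close> for the derivative of \<open>P\<close> of order \<open>k + r\<close>, and put \<open>a = \<alpha> + (k + r) / 2\<close>,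
  \<open>b = \<beta> + (k + r) / 2\<close>. Then \<open>jacobi_w \<alpha> \<beta> * \<phi> ^ (k + r)\<close> is \<open>jacobi_w a b\<close>, and the quantity with which
  the three moduli are compared is \<open>t ^ k\<close> times the norm of \<open>jacobi_w a b * Q\<close>. By the mean value theorem,
  the difference of order \<open>k\<close> with step \<open>h * \<phi> x\<close> of the derivative of order \<open>r\<close> equals \<open>(h * \<phi> x) ^ k\<close> times
  a value of \<open>Q\<close> at distance at most \<open>k * h * \<phi> x / 2\<close> from \<open>x\<close>. After the substitution \<open>x = - cos \<theta>\<close>
  this is a distance of order \<open>k * h\<close>, hence at most \<open>1 / n\<close>, in the angle \<open>\<theta>\<close>. So the theorem reduces to one statement
  about polynomials of degree at most \<open>n\<close>, which takes the place of the inequalities of Bernstein, Markov and Remez: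
  there is a function \<open>B\<close> of the angle that dominates \<open>\<bar>Q\<bar>\<close> and its increments on the scale \<open>1 / n\<close>, changes
  by at most a constant factor on that scale, and has a weighted norm bounded by that of \<open>Q\<close>, even if \<open>Q\<close>
  is only integrated over angles at distance \<open>\<epsilon> / n\<close> or more from \<open>0\<close> and \<open>\<pi>\<close>
  (\<open>slow_majorant_exists\<close>, and \<open>jacobi_majorant\<close> for norms on the interval).

  Construction of \<open>B\<close>. The function \<open>T \<theta> = Q (- cos \<theta>)\<close> is a trigonometric polynomial of degree at most \<open>n\<close>. Its
  product with a power of a Fejer kernel centred at \<open>\<tau>\<close> has degree of order \<open>n\<close>, takes the value
  \<open>T \<tau>\<close> at \<open>\<tau>\<close>, and is small away from \<open>\<tau>\<close>. The elementary bound of a trigonometric polynomial by its quasi-norm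
  with exponent \<open>q\<close> (\<open>trig_poly_nikolskii\<close>) thus bounds \<open>\<bar>T \<tau>\<bar> powr q\<close> by an average of \<open>\<bar>T\<bar> powr q\<close>
  against a kernel \<open>n * (1 + n * \<bar>\<theta> - \<tau>\<bar>) powr (- M)\<close> with \<open>M\<close> as large as desired (\<open>poly_le_local_energy\<close>).
  That average, to the power \<open>1 / q\<close>, is \<open>B\<close> up to a constant. A weight that is regularized on the
  scale \<open>1 / n\<close> varies more slowly than the kernel, so a Jensen inequality with the exponent \<open>p / q \<ge> 1\<close> and
  Tonelli's theorem bound the norm of \<open>B\<close> (\<open>reg_weight_energy_le\<close>). The true weight replaces the regularized one
  because \<open>B\<close> is almost constant near \<open>0\<close> and \<open>\<pi>\<close>, and because a shift by \<open>\<epsilon> / n\<close> changes \<open>T\<close> by at most \<open>\<epsilon> * B\<close>.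
  Since \<open>B\<close> does not depend on \<open>p\<close> and no constant degenerates for large \<open>p\<close>, the case \<open>p = \<infinity>\<close> is a limit.

  Upper estimates. The differences are at most \<open>C * (h * \<phi> x) ^ k * B\<close>, with a factor \<open>B\<close> that is evaluated at the angle
  of \<open>x\<close>. This is enough for \<open>\<Psi>\<close> and \<open>\<Omega>\<close>, and for \<open>\<omega>\<close> if both exponents of its weight
  are nonnegative. If one is negative, the weight of \<open>\<omega>\<close> is singular at the end of the domain of the difference. There \<open>B\<close>
  is comparable to its values on a neighbouring interval of the same length, so that only the integral of the
  weight over the end piece matters (\<open>cut_W_end_bound\<close>); this integral is what depends on \<open>p\<close>.

  Lower estimates. Take the single step \<open>h = \<theta> * t\<close> with a small constant \<open>\<theta>\<close>. On the interval without its ends all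
  differences are defined and all weights are comparable, and each difference deviates from \<open>(h * \<phi> x) ^ k * Q x\<close>
  by at most a small multiple of \<open>(h * \<phi> x) ^ k * B\<close>. The norm of \<open>B\<close> is controlled by the norm of \<open>Q\<close>
  over that same inner interval, hence the deviation can be absorbed (\<open>lower_bound_from_difference\<close>).
\<close>

section \<open>Trigonometric polynomials\<close>

text \<open>The exponent range \<open>-N..N\<close> is shifted to an algebraic polynomial of degree at most \<open>2 * N\<close> on the unit
  circle; products and sums then come for free.\<close>
definition trig_poly :: "nat \<Rightarrow> (real \<Rightarrow> complex) set" where
  "trig_poly N = {f. \<exists>G. degree G \<le> 2 * N \<and> (\<forall>\<theta>. f \<theta> = cis (- (real N * \<theta>)) * poly G (cis \<theta>))}"

lemma trig_polyI:
  "degree G \<le> 2 * N \<Longrightarrow> (\<And>\<theta>. f \<theta> = cis (- (real N * \<theta>)) * poly G (cis \<theta>)) \<Longrightarrow> f \<in> trig_poly N"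
  by (auto simp: trig_poly_def)

lemma trig_poly_mult:
  assumes "f \<in> trig_poly N" "g \<in> trig_poly M"
  shows "(\<lambda>\<theta>. f \<theta> * g \<theta>) \<in> trig_poly (N + M)"
proof -
  obtain F where F: "degree F \<le> 2 * N" "\<And>\<theta>. f \<theta> = cis (- (real N * \<theta>)) * poly F (cis \<theta>)"
    using assms(1) by (auto simp: trig_poly_def)
  obtain G where G: "degree G \<le> 2 * M" "\<And>\<theta>. g \<theta> = cis (- (real M * \<theta>)) * poly G (cis \<theta>)"
    using assms(2) by (auto simp: trig_poly_def)
  have *: "cis (- (real (N + M) * \<theta>)) = cis (- (real N * \<theta>)) * cis (- (real M * \<theta>))" for \<theta>
    by (simp add: cis_mult algebra_simps)
  show ?thesis
  proof (rule trig_polyI)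
    show "degree (F * G) \<le> 2 * (N + M)"
      using order.trans[OF degree_mult_le add_mono[OF F(1) G(1)]] by simp
    show "f \<theta> * g \<theta> = cis (- (real (N + M) * \<theta>)) * poly (F * G) (cis \<theta>)" for \<theta>
      unfolding * F(2) G(2) by (simp add: algebra_simps)
  qed
qed

lemma trig_poly_mono:
  assumes "f \<in> trig_poly N" "N \<le> M"
  shows "f \<in> trig_poly M"
proof -
  obtain F where F: "degree F \<le> 2 * N" "\<And>\<theta>. f \<theta> = cis (- (real N * \<theta>)) * poly F (cis \<theta>)"
    using assms(1) by (auto simp: trig_poly_def)
  show ?thesis
  proof (rule trig_polyI)
    show "degree (monom 1 (M - N) * F) \<le> 2 * M"
      using degree_mult_le[of "monom 1 (M - N)" F] F(1) assms(2)
      by (simp add: degree_monom_eq)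
    have "cis (- (real N * \<theta>)) = cis (- (real M * \<theta>)) * cis \<theta> ^ (M - N)" for \<theta>
      using assms(2) unfolding Complex.DeMoivre cis_mult by (simp add: of_nat_diff algebra_simps)
    then show "f \<theta> = cis (- (real M * \<theta>)) * poly (monom 1 (M - N) * F) (cis \<theta>)" for \<theta>
      unfolding F(2) by (simp add: poly_monom algebra_simps)
  qed
qed

lemma trig_poly_const: "(\<lambda>\<theta>. c) \<in> trig_poly N"
  by (rule trig_poly_mono[of _ 0], rule trig_polyI[of "[:c:]"]) auto

lemma trig_poly_add:
  assumes "f \<in> trig_poly N" "g \<in> trig_poly N"
  shows "(\<lambda>\<theta>. f \<theta> + g \<theta>) \<in> trig_poly N"
proof -
  obtain F where F: "degree F \<le> 2 * N" "\<And>\<theta>. f \<theta> = cis (- (real N * \<theta>)) * poly F (cis \<theta>)"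
    using assms(1) by (auto simp: trig_poly_def)
  obtain G where G: "degree G \<le> 2 * N" "\<And>\<theta>. g \<theta> = cis (- (real N * \<theta>)) * poly G (cis \<theta>)"
    using assms(2) by (auto simp: trig_poly_def)
  show ?thesis
  proof (rule trig_polyI)
    show "degree (F + G) \<le> 2 * N" using F(1) G(1) by (rule degree_add_le)
    show "f \<theta> + g \<theta> = cis (- (real N * \<theta>)) * poly (F + G) (cis \<theta>)" for \<theta>
      unfolding F(2) G(2) by (simp add: algebra_simps)
  qed
qed

lemma trig_poly_sum:
  assumes "finite A" "\<And>j. j \<in> A \<Longrightarrow> f j \<in> trig_poly N"
  shows "(\<lambda>\<theta>. \<Sum>j\<in>A. f j \<theta>) \<in> trig_poly N"
  using assms by (induction A rule: finite_induct) (auto intro!: trig_poly_add trig_poly_const)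

lemma trig_poly_power:
  assumes "f \<in> trig_poly N"
  shows "(\<lambda>\<theta>. f \<theta> ^ L) \<in> trig_poly (L * N)"
proof (induction L)
  case (Suc L)
  then show ?case using trig_poly_mult[OF assms Suc] by (simp add: algebra_simps)
qed (auto intro: trig_poly_const)

lemma trig_poly_cis:
  assumes "j \<le> N"
  shows "(\<lambda>\<theta>. cis (real j * (\<theta> - \<tau>))) \<in> trig_poly N" "(\<lambda>\<theta>. cis (- (real j * (\<theta> - \<tau>)))) \<in> trig_poly N"
proof -
  show "(\<lambda>\<theta>. cis (real j * (\<theta> - \<tau>))) \<in> trig_poly N"
  proof (rule trig_polyI[of "monom (cis (- (real j * \<tau>))) (N + j)"])
    show "degree (monom (cis (- (real j * \<tau>))) (N + j)) \<le> 2 * N"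
      using assms by (intro order.trans[OF degree_monom_le]) simp
  qed (unfold poly_monom Complex.DeMoivre cis_mult, simp add: algebra_simps)
  show "(\<lambda>\<theta>. cis (- (real j * (\<theta> - \<tau>)))) \<in> trig_poly N"
  proof (rule trig_polyI[of "monom (cis (real j * \<tau>)) (N - j)"])
    show "degree (monom (cis (real j * \<tau>)) (N - j)) \<le> 2 * N"
      using assms by (intro order.trans[OF degree_monom_le]) simp
  qed (use assms in \<open>unfold poly_monom Complex.DeMoivre cis_mult, simp add: algebra_simps of_nat_diff\<close>)
qed

lemma trig_poly_neg_cos: "(\<lambda>\<theta>. - complex_of_real (cos \<theta>)) \<in> trig_poly 1"
proof (rule trig_polyI[of "[:-1/2, 0, -1/2:]"])
  show "- complex_of_real (cos \<theta>) = cis (- (real 1 * \<theta>)) * poly [:-1/2, 0, -1/2:] (cis \<theta>)" for \<theta>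
  proof -
    have "cis \<theta> * cis (- \<theta>) = 1" by (simp add: cis_mult)
    moreover have "complex_of_real (cos \<theta>) = (cis \<theta> + cis (- \<theta>)) / 2"
      by (simp add: complex_eq_iff)
    ultimately show ?thesis by (simp add: algebra_simps) (simp add: field_simps)
  qed
qed simp

lemma trig_poly_of_poly:
  assumes "degree Q \<le> n"
  shows "(\<lambda>\<theta>. complex_of_real (poly Q (- cos \<theta>))) \<in> trig_poly n"
proof -
  have eq: "complex_of_real (poly Q (- cos \<theta>)) =
      (\<Sum>i\<le>degree Q. of_real (coeff Q i) * (- complex_of_real (cos \<theta>)) ^ i)" for \<theta>
    unfolding poly_altdef by simp
  show ?thesis unfolding eq
  proof (rule trig_poly_sum)
    fix i assume i: "i \<in> {..degree Q}"
    have "(\<lambda>\<theta>. complex_of_real (coeff Q i) * (- complex_of_real (cos \<theta>)) ^ i) \<in> trig_poly (0 + i * 1)"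
      by (intro trig_poly_mult trig_poly_const trig_poly_power trig_poly_neg_cos)
    then show "(\<lambda>\<theta>. complex_of_real (coeff Q i) * (- complex_of_real (cos \<theta>)) ^ i) \<in> trig_poly n"
      by (rule trig_poly_mono) (use i assms in auto)
  qed simp
qed

lemma continuous_on_trig_poly:
  assumes "f \<in> trig_poly N"
  shows "continuous_on A f"
proof -
  obtain F where F: "\<And>\<theta>. f \<theta> = cis (- (real N * \<theta>)) * poly F (cis \<theta>)"
    using assms by (auto simp: trig_poly_def)
  have "f = (\<lambda>\<theta>. cis (- (real N * \<theta>)) * poly F (cis \<theta>))" using F by blast
  then show ?thesis by (simp only:) (intro continuous_intros)
qed

lemma has_integral_cis_int:
  assumes "m \<noteq> (0::int)"
  shows "((\<lambda>\<theta>. cis (of_int m * \<theta>)) has_integral 0) {-pi..pi}"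
proof -
  have "((\<lambda>\<theta>. cis (of_int m * \<theta>)) has_integral
      (- \<i> / of_int m * cis (of_int m * pi) - (- \<i> / of_int m * cis (of_int m * (- pi))))) {-pi..pi}"
  proof (rule fundamental_theorem_of_calculus)
    fix x :: real
    have "((\<lambda>\<theta>. cis (of_int m * \<theta>)) has_vector_derivative (of_int m *\<^sub>R (\<i> * cis (of_int m * x)))) (at x within {-pi..pi})"
      unfolding has_vector_derivative_def
      by (rule derivative_eq_intros refl | simp)+ (auto simp: scaleR_conv_of_real)
    then have "((\<lambda>\<theta>. - \<i> / of_int m * cis (of_int m * \<theta>)) has_vector_derivative
        (- \<i> / of_int m * (of_int m *\<^sub>R (\<i> * cis (of_int m * x))))) (at x within {-pi..pi})"
      by (rule has_vector_derivative_mult_right)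
    moreover have "- \<i> / of_int m * (of_int m *\<^sub>R (\<i> * cis (of_int m * x))) = cis (of_int m * x)"
      using assms by (simp add: scaleR_conv_of_real field_simps)
    ultimately show "((\<lambda>\<theta>. - \<i> / of_int m * cis (of_int m * \<theta>)) has_vector_derivative cis (of_int m * x)) (at x within {-pi..pi})"
      by simp
  qed auto
  moreover have "cis (of_int m * pi) = cis (of_int m * (- pi))"
  proof -
    have "sin (of_int m * pi) = 0" by (simp add: mult.commute)
    then show ?thesis by (simp add: complex_eq_iff)
  qed
  ultimately show ?thesis by simp
qed

text \<open>Each coefficient is the integral of \<open>f\<close> against a character, hence at most the mean of \<open>\<bar>f\<bar>\<close>.\<close>
lemma trig_poly_expansion:
  assumes f: "f \<in> trig_poly N"
  obtains g where "\<And>\<theta>. f \<theta> = (\<Sum>j\<le>2*N. g j * cis ((real j - real N) * \<theta>))"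
    and "\<And>j. j \<le> 2 * N \<Longrightarrow> norm (g j) \<le> integral {-pi..pi} (\<lambda>\<theta>. norm (f \<theta>)) / (2 * pi)"
proof -
  obtain G where G: "degree G \<le> 2 * N" "\<And>\<theta>. f \<theta> = cis (- (real N * \<theta>)) * poly G (cis \<theta>)"
    using f by (auto simp: trig_poly_def)
  have exp: "f \<theta> = (\<Sum>j\<le>2*N. coeff G j * cis ((real j - real N) * \<theta>))" for \<theta>
  proof -
    have "poly G (cis \<theta>) = (\<Sum>j\<le>2*N. coeff G j * cis \<theta> ^ j)"
      unfolding poly_altdef using G(1)
      by (intro sum.mono_neutral_left) (auto simp: coeff_eq_0)
    moreover have "cis (- (real N * \<theta>)) * (coeff G j * cis \<theta> ^ j) = coeff G j * cis ((real j - real N) * \<theta>)" for j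
      unfolding Complex.DeMoivre mult.left_commute[of "cis _" "coeff G j"] cis_mult
      by (simp add: algebra_simps)
    ultimately show ?thesis unfolding G(2) by (simp only: sum_distrib_left)
  qed
  have "norm (coeff G i) \<le> integral {-pi..pi} (\<lambda>\<theta>. norm (f \<theta>)) / (2 * pi)" if i: "i \<le> 2 * N" for i
  proof -
    have "((\<lambda>\<theta>. \<Sum>j\<le>2*N. coeff G j * cis (of_int (int j - int i) * \<theta>)) has_integral
        (\<Sum>j\<le>2*N. coeff G j * (if j = i then of_real (2 * pi) else 0))) {-pi..pi}"
    proof (intro has_integral_sum has_integral_mult_right finite_atMost)
      fix j
      show "((\<lambda>\<theta>. cis (of_int (int j - int i) * \<theta>)) has_integral (if j = i then of_real (2 * pi) else 0)) {-pi..pi}"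
      proof (cases "j = i")
        case True
        have "((\<lambda>\<theta>. 1 :: complex) has_integral ((pi - (-pi)) *\<^sub>R 1)) {-pi..pi}"
          using has_integral_const_real[of "1::complex" "-pi" pi] by simp
        then show ?thesis using True by (simp add: scaleR_conv_of_real)
      qed (use has_integral_cis_int[of "int j - int i"] in auto)
    qed
    moreover have "(\<Sum>j\<le>2*N. coeff G j * cis (of_int (int j - int i) * \<theta>)) = f \<theta> * cis (- ((real i - real N) * \<theta>))" for \<theta>
      unfolding exp sum_distrib_right
      by (intro sum.cong refl) (simp add: mult.assoc cis_mult algebra_simps)
    moreover have "(\<Sum>j\<le>2*N. coeff G j * (if j = i then of_real (2 * pi) else 0)) = coeff G i * of_real (2 * pi)"
      using i by (simp add: if_distrib cong: if_cong)
    ultimately have hi: "((\<lambda>\<theta>. f \<theta> * cis (- ((real i - real N) * \<theta>))) has_integral coeff G i * of_real (2 * pi)) {-pi..pi}"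
      by simp
    have "norm (coeff G i * of_real (2 * pi)) \<le> integral {-pi..pi} (\<lambda>\<theta>. norm (f \<theta>))"
      unfolding integral_unique[OF hi, symmetric]
    proof (rule integral_norm_bound_integral)
      show "(\<lambda>\<theta>. norm (f \<theta>)) integrable_on {-pi..pi}"
        by (intro integrable_continuous_interval continuous_intros continuous_on_trig_poly[OF f])
    qed (use hi in \<open>auto simp: norm_mult\<close>)
    then show ?thesis by (simp add: norm_mult field_simps)
  qed
  with exp show ?thesis using that by blast
qed

text \<open>Summing the coefficient bounds gives \<open>\<bar>f\<bar> \<le> c * I\<close>, where \<open>I\<close> is the integral of \<open>\<bar>f\<bar>\<close>. For \<open>q < 1\<close> this
  improves itself: bounding \<open>\<bar>f\<bar>\<close> by \<open>(c * I) powr (1 - q) * \<bar>f\<bar> powr q\<close> under the integral makes \<open>c * I\<close>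
  itself at most \<open>Y\<close>.\<close>
lemma trig_poly_nikolskii:
  assumes f: "f \<in> trig_poly N" and q: "0 < q" "q \<le> 1"
  defines "Y \<equiv> ((2 * real N + 1) / (2 * pi) * integral {-pi..pi} (\<lambda>\<theta>. norm (f \<theta>) powr q)) powr (1 / q)"
  shows "norm (f \<theta>) \<le> Y" "norm (f \<theta> - f \<theta>') \<le> real N * \<bar>\<theta> - \<theta>'\<bar> * Y"
proof -
  define I where "I = integral {-pi..pi} (\<lambda>\<theta>. norm (f \<theta>))"
  define c where "c = (2 * real N + 1) / (2 * pi)"
  define Iq where "Iq = integral {-pi..pi} (\<lambda>\<theta>. norm (f \<theta>) powr q)"
  note cont = continuous_on_trig_poly[OF f]
  obtain g where g: "\<And>\<theta>. f \<theta> = (\<Sum>j\<le>2*N. g j * cis ((real j - real N) * \<theta>))"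
    and gb: "\<And>j. j \<le> 2 * N \<Longrightarrow> norm (g j) \<le> I / (2 * pi)"
    using trig_poly_expansion[OF f] unfolding I_def by metis
  have I0: "I \<ge> 0" unfolding I_def
    by (intro integral_nonneg integrable_continuous_interval continuous_intros cont) auto
  have c0: "c > 0" unfolding c_def by (intro divide_pos_pos) auto
  have "(\<Sum>j\<le>2*N. norm (g j)) \<le> (\<Sum>j\<le>2*N. I / (2 * pi))" by (intro sum_mono gb) auto
  also have "\<dots> = c * I" by (simp add: c_def field_simps)
  finally have sumg: "(\<Sum>j\<le>2*N. norm (g j)) \<le> c * I" .
  have b1: "norm (f \<theta>) \<le> c * I" for \<theta>
  proof -
    have "norm (f \<theta>) \<le> (\<Sum>j\<le>2*N. norm (g j * cis ((real j - real N) * \<theta>)))"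
      unfolding g by (rule norm_sum)
    then show ?thesis using sumg by (simp add: norm_mult)
  qed
  have cis_lip: "norm (cis x - cis y) \<le> \<bar>x - y\<bar>" for x y :: real
  proof -
    have "norm (cis x - cis y) = norm (cis y * (cis (x - y) - 1))"
      by (simp add: algebra_simps cis_mult)
    also have "\<dots> = 2 * \<bar>sin ((x - y) / 2)\<bar>" by (simp add: norm_mult dist_norm[symmetric] norm_minus_commute)
       (use dist_exp_i_1[of "x - y"] in \<open>simp add: cis_conv_exp dist_norm\<close>)
    also have "\<dots> \<le> \<bar>x - y\<bar>" using abs_sin_x_le_abs_x[of "(x - y) / 2"] by simp
    finally show ?thesis .
  qed
  have b2: "norm (f \<theta> - f \<theta>') \<le> real N * \<bar>\<theta> - \<theta>'\<bar> * (c * I)" for \<theta> \<theta>'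
  proof -
    have "f \<theta> - f \<theta>' = (\<Sum>j\<le>2*N. g j * (cis ((real j - real N) * \<theta>) - cis ((real j - real N) * \<theta>')))"
      unfolding g by (simp add: sum_subtractf algebra_simps)
    also have "norm \<dots> \<le> (\<Sum>j\<le>2*N. norm (g j) * (real N * \<bar>\<theta> - \<theta>'\<bar>))"
    proof (rule sum_norm_le)
      fix j assume j: "j \<in> {..2*N}"
      have "norm (cis ((real j - real N) * \<theta>) - cis ((real j - real N) * \<theta>')) \<le> \<bar>(real j - real N) * \<theta> - (real j - real N) * \<theta>'\<bar>"
        by (rule cis_lip)
      also have "\<dots> = \<bar>real j - real N\<bar> * \<bar>\<theta> - \<theta>'\<bar>" by (simp add: abs_mult flip: right_diff_distrib)
      also have "\<dots> \<le> real N * \<bar>\<theta> - \<theta>'\<bar>" using j by (intro mult_right_mono) auto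
      finally show "norm (g j * (cis ((real j - real N) * \<theta>) - cis ((real j - real N) * \<theta>'))) \<le> norm (g j) * (real N * \<bar>\<theta> - \<theta>'\<bar>)"
        by (simp add: norm_mult mult_left_mono)
    qed
    also have "\<dots> = (\<Sum>j\<le>2*N. norm (g j)) * (real N * \<bar>\<theta> - \<theta>'\<bar>)" by (simp add: sum_distrib_right)
    also have "\<dots> \<le> c * I * (real N * \<bar>\<theta> - \<theta>'\<bar>)" by (intro mult_right_mono sumg) auto
    finally show ?thesis by (simp add: algebra_simps)
  qed
  have contq: "continuous_on A (\<lambda>\<theta>. norm (f \<theta>) powr q)" for A
    using q by (intro continuous_on_powr' continuous_intros cont) auto
  have key: "c * I \<le> Y"
  proof (cases "c * I = 0")
    case False
    then have pos: "c * I > 0" using c0 I0 by (simp add: less_le)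
    \<comment> \<open>Here \<open>\<bar>f\<bar> \<le> c * I\<close> is used a second time, under the integral.\<close>
    have "I \<le> integral {-pi..pi} (\<lambda>\<theta>. (c * I) powr (1 - q) * norm (f \<theta>) powr q)"
      unfolding I_def
    proof (rule integral_le)
      show "(\<lambda>\<theta>. norm (f \<theta>)) integrable_on {-pi..pi}"
        by (intro integrable_continuous_interval continuous_intros cont)
      show "(\<lambda>\<theta>. (c * integral {-pi..pi} (\<lambda>\<theta>. norm (f \<theta>))) powr (1 - q) * norm (f \<theta>) powr q) integrable_on {-pi..pi}"
        by (intro integrable_continuous_interval continuous_intros contq)
      fix \<theta>
      have "norm (f \<theta>) = norm (f \<theta>) powr (1 - q) * norm (f \<theta>) powr q"
        by (simp flip: powr_add)
      also have "\<dots> \<le> (c * I) powr (1 - q) * norm (f \<theta>) powr q"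
        using b1[of \<theta>] q by (intro mult_right_mono powr_mono2) auto
      finally show "norm (f \<theta>) \<le> (c * integral {-pi..pi} (\<lambda>\<theta>. norm (f \<theta>))) powr (1 - q) * norm (f \<theta>) powr q"
        unfolding I_def .
    qed
    also have "\<dots> = (c * I) powr (1 - q) * Iq" by (simp add: Iq_def)
    finally have "c * I \<le> (c * I) powr (1 - q) * (c * Iq)"
      using mult_left_mono[of I _ c] c0 by (simp add: algebra_simps)
    moreover have "c * I = (c * I) powr (1 - q) * (c * I) powr q" using pos by (simp flip: powr_add)
    ultimately have "(c * I) powr (1 - q) * (c * I) powr q \<le> (c * I) powr (1 - q) * (c * Iq)" by simp
    moreover have "(c * I) powr (1 - q) > 0" using pos by (simp only: powr_gt_zero)
    ultimately have "(c * I) powr q \<le> c * Iq" using mult_le_cancel_left_pos by blast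
    then have "((c * I) powr q) powr (1 / q) \<le> (c * Iq) powr (1 / q)"
      using q by (intro powr_mono2) auto
    moreover have "((c * I) powr q) powr (1 / q) = c * I"
      using q pos unfolding powr_powr by (simp del: mult_eq_0_iff)
    ultimately show ?thesis by (simp only: Y_def c_def Iq_def)
  next
    case True
    then show ?thesis unfolding True Y_def by simp
  qed
  show "norm (f \<theta>) \<le> Y" using b1[of \<theta>] key by linarith
  have "real N * \<bar>\<theta> - \<theta>'\<bar> * (c * I) \<le> real N * \<bar>\<theta> - \<theta>'\<bar> * Y" by (intro mult_left_mono key) auto
  then show "norm (f \<theta> - f \<theta>') \<le> real N * \<bar>\<theta> - \<theta>'\<bar> * Y" using b2[of \<theta> \<theta>'] by linarith
qed

section \<open>Pointwise bounds by a local energy\<close>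

text \<open>A crude form of Jordan's inequality, from the Taylor polynomial of degree three.\<close>
lemma sin_ge_half:
  assumes "0 \<le> x" "x \<le> pi / 2"
  shows "x / 2 \<le> sin x"
proof -
  have "\<bar>sin x - (\<Sum>m<3. sin_coeff m * x ^ m)\<bar> \<le> inverse (fact 3) * \<bar>x\<bar> ^ 3"
    by (rule Maclaurin_sin_bound)
  then have "x - x * (x * x) / 6 \<le> sin x"
    using assms by (simp add: sin_coeff_def numeral_3_eq_3 fact_numeral power3_eq_cube field_simps)
      (drule mult_left_mono[OF abs_ge_minus_self, of 6 "sin x - x", simplified, THEN order.trans], simp add: algebra_simps)
  moreover have "x * x \<le> 3"
  proof -
    have "x \<le> 16/10" using assms pi_approx by simp
    then have "x * x \<le> (16/10) * (16/10)" using assms by (intro mult_mono) auto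
    then show ?thesis by simp
  qed
  then have "x * (x * x) \<le> x * 3" using assms by (intro mult_left_mono)
  ultimately show ?thesis by simp
qed

lemma abs_sin_half_ge: "\<bar>u\<bar> \<le> pi \<Longrightarrow> \<bar>u\<bar> / 4 \<le> \<bar>sin (u / 2)\<bar>"
  using sin_ge_half[of "\<bar>u\<bar> / 2"] by (cases "u \<ge> 0") (auto simp: abs_if)

text \<open>Its squared modulus is the Fejer kernel, normalized to the value \<open>1\<close> at \<open>0\<close>.\<close>
definition cis_mean :: "nat \<Rightarrow> real \<Rightarrow> complex" where
  "cis_mean n u = (\<Sum>j<n. cis (real j * u)) / of_nat n"

lemma norm_cis_minus_1: "norm (cis u - 1) = 2 * \<bar>sin (u / 2)\<bar>"
  using dist_exp_i_1[of u] by (simp add: cis_conv_exp dist_norm)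

lemma norm_cis_mean_le_1:
  assumes "n \<ge> 1"
  shows "norm (cis_mean n u) \<le> 1"
proof -
  have "norm (\<Sum>j<n. cis (real j * u)) \<le> (\<Sum>j<n. 1)" by (intro sum_norm_le) simp
  then show ?thesis using assms by (simp add: cis_mean_def norm_divide)
qed

text \<open>The geometric sum gives decay \<open>1 / (n * \<bar>sin (u / 2)\<bar>)\<close>; adding the trivial bound \<open>1\<close> makes the estimate
  uniform in \<open>u\<close>.\<close>
lemma norm_cis_mean_decay:
  assumes "n \<ge> 1"
  shows "norm (cis_mean n u) * (1 + real n * \<bar>sin (u / 2)\<bar>) \<le> 2"
proof -
  have geom: "(cis u - 1) * (\<Sum>j<n. cis (real j * u)) = cis (real n * u) - 1"
  proof -
    have "(\<Sum>j<n. cis (real j * u)) = (\<Sum>j<n. cis u ^ j)" by (simp add: Complex.DeMoivre)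
    then show ?thesis using power_diff_1_eq[of "cis u" n] by (simp only: Complex.DeMoivre)
  qed
  have "norm (cis u - 1) * norm (\<Sum>j<n. cis (real j * u)) \<le> 2"
    unfolding norm_mult[symmetric] geom using norm_triangle_ineq4[of "cis (real n * u)" 1] by simp
  then have "\<bar>sin (u / 2)\<bar> * norm (\<Sum>j<n. cis (real j * u)) \<le> 1"
    unfolding norm_cis_minus_1 by simp
  moreover have "norm (\<Sum>j<n. cis (real j * u)) = real n * norm (cis_mean n u)"
    using assms by (simp add: cis_mean_def norm_divide)
  ultimately have "norm (cis_mean n u) * (real n * \<bar>sin (u / 2)\<bar>) \<le> 1" by (simp add: algebra_simps)
  then show ?thesis using norm_cis_mean_le_1[OF assms, of u] by (simp add: algebra_simps)
qed

lemma norm_cis_mean_minus_1: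
  assumes "n \<ge> 1"
  shows "norm (cis_mean n u - 1) \<le> real n * \<bar>u\<bar>"
proof -
  have "norm (\<Sum>j<n. cis (real j * u) - 1) \<le> (\<Sum>j<n. real n * \<bar>u\<bar>)"
  proof (rule sum_norm_le)
    fix j assume j: "j \<in> {..<n}"
    have "norm (cis (real j * u) - 1) \<le> \<bar>real j * u\<bar>"
      unfolding norm_cis_minus_1 using abs_sin_x_le_abs_x[of "real j * u / 2"] by simp
    also have "\<dots> \<le> real n * \<bar>u\<bar>" unfolding abs_mult using j by (intro mult_right_mono) auto
    finally show "norm (cis (real j * u) - 1) \<le> real n * \<bar>u\<bar>" .
  qed
  moreover have "cis_mean n u - 1 = (\<Sum>j<n. cis (real j * u) - 1) / of_nat n"
    using assms by (simp add: cis_mean_def sum_subtractf diff_divide_distrib)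
  ultimately show ?thesis using assms by (simp add: norm_divide divide_le_eq mult_ac)
qed

text \<open>A trigonometric polynomial of degree of order \<open>L * n\<close> that is \<open>1\<close> at \<open>0\<close> and decays like the power \<open>2 * L\<close>
  of \<open>1 / (1 + n * \<bar>u\<bar>)\<close> for \<open>\<bar>u\<bar> \<le> \<pi>\<close>.\<close>
definition bump :: "nat \<Rightarrow> nat \<Rightarrow> real \<Rightarrow> complex" where
  "bump L n u = (cis_mean n u * cnj (cis_mean n u)) ^ L"

lemma norm_bump: "norm (bump L n u) = norm (cis_mean n u) ^ (2 * L)"
  by (simp add: bump_def norm_power norm_mult power_mult power2_eq_square)

lemma bump_0: "n \<ge> 1 \<Longrightarrow> bump L n 0 = 1"
  by (simp add: bump_def cis_mean_def)

lemma norm_bump_minus_1: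
  assumes "n \<ge> 1"
  shows "norm (bump L n u - 1) \<le> 2 * real L * real n * \<bar>u\<bar>"
proof -
  define z where "z = cis_mean n u"
  have z: "norm z \<le> 1" "norm (z - 1) \<le> real n * \<bar>u\<bar>"
    using norm_cis_mean_le_1[OF assms] norm_cis_mean_minus_1[OF assms] by (auto simp: z_def)
  have "norm (z * cnj z - 1) = norm (z * cnj (z - 1) + (z - 1))" by (simp add: algebra_simps)
  also have "\<dots> \<le> norm z * norm (z - 1) + norm (z - 1)"
    using norm_triangle_ineq[of "z * cnj (z - 1)" "z - 1"] by (simp only: norm_mult complex_mod_cnj)
  also have "\<dots> \<le> 2 * (real n * \<bar>u\<bar>)" using z mult_right_mono[of "norm z" 1 "norm (z - 1)"] by simp
  finally have 1: "norm (z * cnj z - 1) \<le> 2 * (real n * \<bar>u\<bar>)" .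
  have "norm ((z * cnj z) ^ L - 1 ^ L) \<le> real L * norm (z * cnj z - 1)"
    using z by (intro norm_power_diff) (auto simp: norm_mult mult_le_one)
  also have "\<dots> \<le> real L * (2 * (real n * \<bar>u\<bar>))" by (intro mult_left_mono 1) auto
  finally show ?thesis by (simp add: bump_def z_def)
qed

lemma trig_poly_bump: "(\<lambda>\<theta>. bump L n (\<theta> - \<tau>)) \<in> trig_poly (L * (2 * n))"
proof -
  have 1: "(\<lambda>\<theta>. (\<Sum>j<n. cis (real j * (\<theta> - \<tau>))) * (1 / of_nat n)) \<in> trig_poly (n + 0)"
    by (intro trig_poly_mult trig_poly_sum trig_poly_const trig_poly_cis) auto
  have 2: "(\<lambda>\<theta>. (\<Sum>j<n. cis (- (real j * (\<theta> - \<tau>)))) * (1 / of_nat n)) \<in> trig_poly (n + 0)"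
    by (intro trig_poly_mult trig_poly_sum trig_poly_const trig_poly_cis) auto
  have "(\<lambda>\<theta>. cis_mean n (\<theta> - \<tau>) * cnj (cis_mean n (\<theta> - \<tau>))) \<in> trig_poly (n + n)"
    using trig_poly_mult[OF 1 2] unfolding cis_mean_def by (simp add: cis_cnj)
  from trig_poly_power[OF this, of L] show ?thesis unfolding bump_def by (simp add: mult_2)
qed

text \<open>The average of \<open>\<bar>Q (- cos \<theta>)\<bar> powr q\<close> near the angle \<open>\<tau>\<close> on the scale \<open>1 / n\<close>, with polynomially decaying
  tails. The degree bound \<open>n\<close> is taken as a real number because it enters only as a scale.\<close>
definition local_energy :: "real \<Rightarrow> real \<Rightarrow> real poly \<Rightarrow> real \<Rightarrow> real \<Rightarrow> real" where
  "local_energy q M Q n \<tau> = integral {0..pi} (\<lambda>\<theta>. n * (\<bar>poly Q (- cos \<theta>)\<bar> powr q * (1 + n * \<bar>\<theta> - \<tau>\<bar>) powr (- M)))"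

lemma continuous_energy_integrand:
  fixes q n :: real
  assumes "0 < q" "0 \<le> n"
  shows "continuous_on A (\<lambda>\<theta>. n * (\<bar>poly Q (- cos \<theta>)\<bar> powr q * (1 + n * \<bar>\<theta> - \<tau>\<bar>) powr (- M)))"
proof -
  have pos: "1 + n * \<bar>\<theta> - \<tau>\<bar> > 0" for \<theta> using assms mult_nonneg_nonneg[of n "\<bar>\<theta> - \<tau>\<bar>"] by linarith
  have 1: "continuous_on A (\<lambda>\<theta>. \<bar>poly Q (- cos \<theta>)\<bar> powr q)"
    using assms by (intro continuous_on_powr' continuous_intros) auto
  have 2: "continuous_on A (\<lambda>\<theta>. (1 + n * \<bar>\<theta> - \<tau>\<bar>) powr (- M))"
    using pos by (intro continuous_on_powr continuous_intros) (metis less_irrefl)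
  show ?thesis by (intro continuous_on_mult_left continuous_on_mult 1 2)
qed

lemma local_energy_nonneg: "0 < q \<Longrightarrow> 0 \<le> n \<Longrightarrow> 0 \<le> local_energy q M Q n \<tau>"
  unfolding local_energy_def
  by (intro integral_nonneg integrable_continuous_interval continuous_energy_integrand) auto

text \<open>Moving the centre by \<open>1 / n\<close> changes \<open>1 + n * \<bar>\<theta> - \<tau>\<bar>\<close> by at most a factor \<open>2\<close>.\<close>
lemma local_energy_slow:
  assumes "0 < q" "0 < n" "0 \<le> M" "\<bar>\<tau> - \<tau>'\<bar> \<le> 1 / n"
  shows "local_energy q M Q n \<tau> \<le> 2 powr M * local_energy q M Q n \<tau>'"
proof -
  have *: "(1 + n * \<bar>\<theta> - \<tau>\<bar>) powr (- M) \<le> 2 powr M * (1 + n * \<bar>\<theta> - \<tau>'\<bar>) powr (- M)" for \<theta>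
  proof -
    have "n * \<bar>\<tau> - \<tau>'\<bar> \<le> 1" using assms by (simp add: field_simps)
    moreover have "n * \<bar>\<theta> - \<tau>'\<bar> \<le> n * \<bar>\<theta> - \<tau>\<bar> + n * \<bar>\<tau> - \<tau>'\<bar>"
      using assms by (simp flip: distrib_left)
    moreover have "0 \<le> n * \<bar>\<theta> - \<tau>\<bar>" "0 \<le> n * \<bar>\<theta> - \<tau>'\<bar>" using assms by auto
    ultimately have "0 < (1 + n * \<bar>\<theta> - \<tau>'\<bar>) / 2" "(1 + n * \<bar>\<theta> - \<tau>'\<bar>) / 2 \<le> 1 + n * \<bar>\<theta> - \<tau>\<bar>" by auto
    then have "(1 + n * \<bar>\<theta> - \<tau>\<bar>) powr (- M) \<le> ((1 + n * \<bar>\<theta> - \<tau>'\<bar>) / 2) powr (- M)"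
      using assms by (intro powr_mono2') auto
    also have "\<dots> = 2 powr M * (1 + n * \<bar>\<theta> - \<tau>'\<bar>) powr (- M)"
      using \<open>0 \<le> n * \<bar>\<theta> - \<tau>'\<bar>\<close> by (simp add: powr_divide powr_minus field_simps)
    finally show ?thesis .
  qed
  have "local_energy q M Q n \<tau> \<le> integral {0..pi} (\<lambda>\<theta>. 2 powr M * (n * (\<bar>poly Q (- cos \<theta>)\<bar> powr q * (1 + n * \<bar>\<theta> - \<tau>'\<bar>) powr (- M))))"
    unfolding local_energy_def
  proof (rule integral_le)
    fix \<theta>
    have "n * (\<bar>poly Q (- cos \<theta>)\<bar> powr q * (1 + n * \<bar>\<theta> - \<tau>\<bar>) powr (- M))
      \<le> n * (\<bar>poly Q (- cos \<theta>)\<bar> powr q * (2 powr M * (1 + n * \<bar>\<theta> - \<tau>'\<bar>) powr (- M)))"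
      using assms by (intro mult_left_mono *) auto
    then show "n * (\<bar>poly Q (- cos \<theta>)\<bar> powr q * (1 + n * \<bar>\<theta> - \<tau>\<bar>) powr (- M))
      \<le> 2 powr M * (n * (\<bar>poly Q (- cos \<theta>)\<bar> powr q * (1 + n * \<bar>\<theta> - \<tau>'\<bar>) powr (- M)))"
      by (simp add: algebra_simps)
  qed (use assms in \<open>intro integrable_continuous_interval continuous_energy_integrand continuous_on_mult_left; simp\<close>)+
  then show ?thesis by (simp add: local_energy_def)
qed

text \<open>The integrand over \<open>{-pi..pi}\<close> folds onto \<open>{0..pi}\<close> since \<open>cos\<close> is even; for \<open>\<theta>\<close> and \<open>\<tau>\<close> in \<open>{0..pi}\<close> the
  reflected point \<open>- \<theta>\<close> is on the circle no closer to \<open>\<tau>\<close> than \<open>\<theta>\<close> is, so the decay of the bump survives the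
  folding.\<close>
lemma bump_energy_le:
  fixes n L :: nat
  assumes n: "n \<ge> 1" and q: "0 < q" and \<tau>: "\<tau> \<in> {0..pi}"
  defines "M \<equiv> 2 * real L * q"
  shows "real n * integral {-pi..pi} (\<lambda>\<theta>. norm (complex_of_real (poly Q (- cos \<theta>)) * bump L n (\<theta> - \<tau>)) powr q)
    \<le> 2 * 8 powr M * local_energy q M Q n \<tau>" (is "real n * integral _ ?g \<le> _")
proof -
  have M0: "M \<ge> 0" using q by (simp add: M_def)
  have cont: "continuous_on A ?g" for A
    using q by (intro continuous_on_powr' continuous_intros
      continuous_on_trig_poly[OF trig_poly_mult[OF trig_poly_of_poly[OF order.refl] trig_poly_bump]]) auto
  have pt: "real n * ?g \<theta> \<le> 8 powr M * (real n * (\<bar>poly Q (- cos \<theta>')\<bar> powr q * (1 + real n * \<bar>\<theta>' - \<tau>\<bar>) powr (- M)))"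
    if \<theta>: "\<theta>' \<in> {0..pi}" "\<theta> = \<theta>' \<or> \<theta> = - \<theta>'" for \<theta> \<theta>'
  proof -
    define s where "s = norm (cis_mean n (\<theta> - \<tau>))"
    define y where "y = 1 + real n * \<bar>\<theta>' - \<tau>\<bar>"
    have y: "y > 0" by (simp add: y_def add_pos_nonneg)
    \<comment> \<open>Here \<open>\<theta>'\<close> is the folded angle and \<open>\<theta> - \<tau>\<close> the argument of the bump: even for \<open>\<theta> = - \<theta>'\<close>, the sine that
      governs the decay dominates \<open>\<bar>\<theta>' - \<tau>\<bar>\<close>.\<close>
    have d: "\<bar>\<theta>' - \<tau>\<bar> / 4 \<le> \<bar>sin ((\<theta> - \<tau>) / 2)\<bar>"
    proof -
      have 1: "\<bar>\<theta>' - \<tau>\<bar> / 4 \<le> \<bar>sin ((\<theta>' - \<tau>) / 2)\<bar>" using \<theta> \<tau> by (intro abs_sin_half_ge) auto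
      have 2: "\<bar>sin ((\<theta>' - \<tau>) / 2)\<bar> \<le> \<bar>sin ((\<theta>' + \<tau>) / 2)\<bar>"
      proof (rule abs_le_square_iff[THEN iffD2])
        have "cos (2 * ((\<theta>' - \<tau>) / 2)) - cos (2 * ((\<theta>' + \<tau>) / 2)) = 2 * (sin \<theta>' * sin \<tau>)"
        proof -
          have "cos (\<theta>' - \<tau>) - cos (\<theta>' + \<tau>) = 2 * (sin \<theta>' * sin \<tau>)" by (simp add: cos_add cos_diff)
          then show ?thesis by (simp only: mult_2 field_sum_of_halves)
        qed
        moreover have "sin \<theta>' * sin \<tau> \<ge> 0" using \<theta> \<tau> by (intro mult_nonneg_nonneg sin_ge_zero) auto
        ultimately show "(sin ((\<theta>' - \<tau>) / 2))\<^sup>2 \<le> (sin ((\<theta>' + \<tau>) / 2))\<^sup>2"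
          unfolding cos_double_sin by simp
      qed
      have "\<bar>sin ((- \<theta>' - \<tau>) / 2)\<bar> = \<bar>sin ((\<theta>' + \<tau>) / 2)\<bar>"
      proof -
        have "(- \<theta>' - \<tau>) / 2 = - ((\<theta>' + \<tau>) / 2)" by (simp add: field_simps)
        then show ?thesis by (simp only: sin_minus abs_minus_cancel)
      qed
      then show ?thesis using 1 2 \<theta>(2) by auto
    qed
    have "y \<le> 4 * (1 + real n * \<bar>sin ((\<theta> - \<tau>) / 2)\<bar>)"
      using mult_left_mono[OF d, of "real n"] unfolding y_def by simp
    then have "s * y \<le> s * (4 * (1 + real n * \<bar>sin ((\<theta> - \<tau>) / 2)\<bar>))"
      by (intro mult_left_mono) (auto simp: s_def)
    also have "\<dots> \<le> 8" using norm_cis_mean_decay[OF n, of "\<theta> - \<tau>"] unfolding s_def[symmetric] by (simp add: algebra_simps)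
    finally have s: "0 \<le> s" "s \<le> 8 / y" using y by (simp_all add: s_def pos_le_divide_eq)
    have "?g \<theta> = \<bar>poly Q (- cos \<theta>')\<bar> powr q * (s ^ (2 * L)) powr q"
      using \<theta>(2) by (auto simp: norm_mult norm_bump s_def powr_mult)
    also have "(s ^ (2 * L)) powr q \<le> ((8 / y) ^ (2 * L)) powr q"
      using s q by (intro powr_mono2 power_mono) auto
    also have "\<dots> = (8 / y) powr M"
      using y by (simp add: powr_powr M_def flip: powr_realpow)
    also have "\<dots> = 8 powr M * y powr (- M)" using y by (simp add: powr_divide powr_minus field_simps)
    finally have "?g \<theta> \<le> \<bar>poly Q (- cos \<theta>')\<bar> powr q * (8 powr M * y powr (- M))" by (simp add: mult_left_mono)
    then have "real n * ?g \<theta> \<le> real n * (\<bar>poly Q (- cos \<theta>')\<bar> powr q * (8 powr M * y powr (- M)))"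
      by (intro mult_left_mono) auto
    then show ?thesis by (simp add: y_def algebra_simps)
  qed
  have int: "?g integrable_on {a..b}" for a b by (intro integrable_continuous_interval cont)
  have "integral {-pi..pi} ?g = integral {-pi..0} ?g + integral {0..pi} ?g"
    by (rule Henstock_Kurzweil_Integration.integral_combine[symmetric]) (auto intro: int)
  also have "integral {-pi..0} ?g = integral {0..pi} (\<lambda>\<theta>. ?g (- \<theta>))"
    using Henstock_Kurzweil_Integration.integral_reflect_real[of pi 0 "\<lambda>\<theta>. ?g (- \<theta>)"] by simp
  finally have split: "integral {-pi..pi} ?g = integral {0..pi} (\<lambda>\<theta>. ?g (- \<theta>)) + integral {0..pi} ?g" .
  have 1: "real n * integral {0..pi} (\<lambda>\<theta>. ?g (- \<theta>)) \<le> 8 powr M * local_energy q M Q n \<tau>"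
    unfolding local_energy_def integral_mult_right[symmetric]
  proof (rule integral_le)
    show "(\<lambda>\<theta>. real n * ?g (- \<theta>)) integrable_on {0..pi}"
      by (intro integrable_continuous_interval continuous_on_mult_left continuous_on_compose2[OF cont[of UNIV]] continuous_intros) auto
    show "(\<lambda>\<theta>. 8 powr M * (real n * (\<bar>poly Q (- cos \<theta>)\<bar> powr q * (1 + real n * \<bar>\<theta> - \<tau>\<bar>) powr (- M)))) integrable_on {0..pi}"
      using q by (intro integrable_continuous_interval continuous_energy_integrand continuous_on_mult_left) auto
  qed (use pt in blast)
  have 2: "real n * integral {0..pi} ?g \<le> 8 powr M * local_energy q M Q n \<tau>"
    unfolding local_energy_def integral_mult_right[symmetric]
  proof (rule integral_le)
    show "(\<lambda>\<theta>. real n * ?g \<theta>) integrable_on {0..pi}"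
      by (intro integrable_continuous_interval continuous_on_mult_left cont)
    show "(\<lambda>\<theta>. 8 powr M * (real n * (\<bar>poly Q (- cos \<theta>)\<bar> powr q * (1 + real n * \<bar>\<theta> - \<tau>\<bar>) powr (- M)))) integrable_on {0..pi}"
      using q by (intro integrable_continuous_interval continuous_energy_integrand continuous_on_mult_left) auto
  qed (use pt in blast)
  show ?thesis unfolding split using 1 2 by (simp add: algebra_simps)
qed

text \<open>Apply \<open>trig_poly_nikolskii\<close> to the product of \<open>Q (- cos \<theta>)\<close> with a bump centred at \<open>\<tau>\<close>. At the second point
  \<open>\<tau>'\<close> the bump differs from \<open>1\<close> by at most a multiple of \<open>n * \<bar>\<tau> - \<tau>'\<bar>\<close>, so increments of the polynomial are
  estimated without derivatives.\<close>
lemma poly_le_local_energy: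
  fixes n L :: nat
  assumes q: "0 < q" "q \<le> 1"
  defines "M \<equiv> 2 * real L * q"
  shows "\<exists>C\<ge>1. \<forall>n\<ge>1. \<forall>Q. degree Q \<le> n \<longrightarrow> (\<forall>\<tau>\<in>{0..pi}. \<forall>\<tau>'\<in>{0..pi}.
     \<bar>poly Q (- cos \<tau>)\<bar> \<le> C * local_energy q M Q (real n) \<tau> powr (1/q) \<and>
     (\<bar>\<tau> - \<tau>'\<bar> \<le> 1 / real n \<longrightarrow>
       \<bar>poly Q (- cos \<tau>) - poly Q (- cos \<tau>')\<bar> \<le> C * (real n * \<bar>\<tau> - \<tau>'\<bar>) * local_energy q M Q (real n) \<tau> powr (1/q)))"
proof -
  define C0 where "C0 = (4 * real L + 3) * 8 powr M"
  define C1 where "C1 = C0 powr (1/q)"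
  define C2 where "C2 = C1 * ((2 * real L + 1) + 2 * real L * (2 powr M) powr (1/q))"
  have M0: "M \<ge> 0" using q by (simp add: M_def)
  have "8 powr M \<ge> 1" using M0 ge_one_powr_ge_zero by auto
  then have "1 * 1 \<le> C0" unfolding C0_def by (intro mult_mono) auto
  then have C0: "C0 \<ge> 1" by simp
  then have C1: "C1 \<ge> 1" unfolding C1_def using q by (intro ge_one_powr_ge_zero) auto
  have "1 * 1 \<le> C2" unfolding C2_def using C1 by (intro mult_mono) auto
  then have C2: "C2 \<ge> 1" by simp
  have C12: "C1 \<le> C2" unfolding C2_def using C1 mult_left_mono[of 1 "(2 * real L + 1) + 2 * real L * (2 powr M) powr (1/q)" C1] by simp
  show ?thesis
  proof (intro exI[of _ C2] conjI allI impI ballI C2)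
    fix n :: nat and Q :: "real poly" and \<tau> \<tau>' assume n: "n \<ge> 1" and Q: "degree Q \<le> n"
      and \<tau>: "\<tau> \<in> {0..pi}" and \<tau>': "\<tau>' \<in> {0..pi}"
    define T where "T \<theta> = poly Q (- cos \<theta>)" for \<theta>
    define U where "U \<tau> \<theta> = complex_of_real (T \<theta>) * bump L n (\<theta> - \<tau>)" for \<tau> \<theta>
    define N where "N = n + L * (2 * n)"
    define E where "E \<tau> = local_energy q M Q (real n) \<tau>" for \<tau>
    have U: "U \<tau> \<in> trig_poly N" for \<tau> unfolding U_def T_def N_def
      by (intro trig_poly_mult trig_poly_of_poly trig_poly_bump Q)
    define Y where "Y \<tau> = ((2 * real N + 1) / (2 * pi) * integral {-pi..pi} (\<lambda>\<theta>. norm (U \<tau> \<theta>) powr q)) powr (1 / q)" for \<tau>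
    have E0: "E \<tau> \<ge> 0" for \<tau> unfolding E_def using q by (intro local_energy_nonneg) auto
    have Y: "Y \<tau> \<le> C1 * E \<tau> powr (1/q)" if \<tau>: "\<tau> \<in> {0..pi}" for \<tau>
    proof -
      define I where "I = integral {-pi..pi} (\<lambda>\<theta>. norm (U \<tau> \<theta>) powr q)"
      have "I \<ge> 0" unfolding I_def using q
        by (intro integral_nonneg integrable_continuous_interval continuous_on_powr' continuous_intros continuous_on_trig_poly[OF U]) auto
      have b: "real n * I \<le> 2 * 8 powr M * E \<tau>"
        using bump_energy_le[OF n q(1) \<tau>, of Q L] unfolding I_def U_def T_def E_def M_def by simp
      have "(2 * real N + 1) \<le> (4 * real L + 3) * real n"
        using n by (simp add: N_def algebra_simps)
      moreover have "(4 * real L + 3) * real n / (2 * pi) \<le> (4 * real L + 3) * real n / 2"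
        using pi_gt3 by (intro divide_left_mono) auto
      moreover have "(2 * real N + 1) / (2 * pi) \<le> (4 * real L + 3) * real n / (2 * pi)"
        using calculation(1) by (intro divide_right_mono) auto
      ultimately have "(2 * real N + 1) / (2 * pi) \<le> (4 * real L + 3) * real n / 2" by linarith
      then have "(2 * real N + 1) / (2 * pi) * I \<le> (4 * real L + 3) * real n / 2 * I"
        using \<open>I \<ge> 0\<close> by (intro mult_right_mono)
      also have "\<dots> = (4 * real L + 3) / 2 * (real n * I)" by simp
      also have "\<dots> \<le> (4 * real L + 3) / 2 * (2 * 8 powr M * E \<tau>)" using b by (intro mult_left_mono) auto
      also have "\<dots> = C0 * E \<tau>" by (simp add: C0_def)
      finally have "Y \<tau> \<le> (C0 * E \<tau>) powr (1/q)" unfolding Y_def I_def[symmetric]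
        using q \<open>I \<ge> 0\<close> by (intro powr_mono2) auto
      then show ?thesis using E0 C0 by (simp add: C1_def powr_mult)
    qed
    note nik = trig_poly_nikolskii[OF U q, folded Y_def]
    have T: "\<bar>T \<tau>\<bar> \<le> C1 * E \<tau> powr (1/q)" if \<tau>: "\<tau> \<in> {0..pi}" for \<tau>
    proof -
      have "norm (U \<tau> \<tau>) = \<bar>T \<tau>\<bar>" using n by (simp add: U_def bump_0 norm_mult)
      then show ?thesis using nik(1)[of \<tau> \<tau>] Y[OF \<tau>] by linarith
    qed
    show "\<bar>poly Q (- cos \<tau>)\<bar> \<le> C2 * local_energy q M Q (real n) \<tau> powr (1/q)"
      using T[OF \<tau>] mult_right_mono[OF C12, of "E \<tau> powr (1/q)"] by (simp add: T_def E_def)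
    assume close: "\<bar>\<tau> - \<tau>'\<bar> \<le> 1 / real n"
    define e where "e = E \<tau> powr (1/q)"
    have "E \<tau>' \<le> 2 powr M * E \<tau>"
      unfolding E_def using n q close M0 by (intro local_energy_slow) (auto simp: abs_minus_commute)
    then have "E \<tau>' powr (1/q) \<le> (2 powr M * E \<tau>) powr (1/q)" using q E0 by (intro powr_mono2) auto
    then have E': "E \<tau>' powr (1/q) \<le> (2 powr M) powr (1/q) * e" using E0 by (simp add: powr_mult e_def)
    \<comment> \<open>Both points are tested with the bump centred at \<open>\<tau>\<close>, which is \<open>1\<close> there.\<close>
    have "T \<tau> - T \<tau>' = Re (U \<tau> \<tau> - U \<tau> \<tau>' + of_real (T \<tau>') * (bump L n (\<tau>' - \<tau>) - 1))"
      using n by (simp add: U_def bump_0 algebra_simps)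
    also have "\<bar>\<dots>\<bar> \<le> norm (U \<tau> \<tau> - U \<tau> \<tau>') + \<bar>T \<tau>'\<bar> * norm (bump L n (\<tau>' - \<tau>) - 1)"
      by (rule order.trans[OF abs_Re_le_cmod]) (rule order.trans[OF norm_triangle_ineq], simp add: norm_mult)
    also have "\<dots> \<le> real N * \<bar>\<tau> - \<tau>'\<bar> * (C1 * e) + (C1 * ((2 powr M) powr (1/q) * e)) * (2 * real L * real n * \<bar>\<tau>' - \<tau>\<bar>)"
    proof (intro add_mono mult_mono)
      show "norm (U \<tau> \<tau> - U \<tau> \<tau>') \<le> real N * \<bar>\<tau> - \<tau>'\<bar> * (C1 * e)"
        using nik(2)[of \<tau> \<tau> \<tau>'] mult_left_mono[OF Y[OF \<tau>], of "real N * \<bar>\<tau> - \<tau>'\<bar>"] by (simp add: e_def)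
      show "\<bar>T \<tau>'\<bar> \<le> C1 * ((2 powr M) powr (1/q) * e)"
        using order.trans[OF T[OF \<tau>'] mult_left_mono[OF E', of C1]] C1 by simp
      show "norm (bump L n (\<tau>' - \<tau>) - 1) \<le> 2 * real L * real n * \<bar>\<tau>' - \<tau>\<bar>"
        by (rule norm_bump_minus_1[OF n])
    qed (use C1 in \<open>auto simp: e_def\<close>)
    also have "\<dots> = C2 * (real n * \<bar>\<tau> - \<tau>'\<bar>) * e"
      by (simp add: N_def C2_def algebra_simps abs_minus_commute)
    finally show "\<bar>poly Q (- cos \<tau>) - poly Q (- cos \<tau>')\<bar> \<le> C2 * (real n * \<bar>\<tau> - \<tau>'\<bar>) * local_energy q M Q (real n) \<tau> powr (1/q)"
      by (simp add: T_def E_def e_def)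
  qed
qed

section \<open>Weighted integrals of the local energy\<close>

abbreviation power_integral :: "real \<Rightarrow> real set \<Rightarrow> (real \<Rightarrow> real) \<Rightarrow> ennreal" where
  "power_integral p A f \<equiv> (\<integral>\<^sup>+x\<in>A. ennreal (f x powr p) \<partial>lborel)"

lemma set_nn_integral_le:
  assumes "\<And>x. x \<in> A \<Longrightarrow> f x \<le> (g x :: ennreal)"
  shows "(\<integral>\<^sup>+x\<in>A. f x \<partial>M) \<le> (\<integral>\<^sup>+x\<in>A. g x \<partial>M)"
  by (intro nn_integral_mono) (use assms in \<open>auto split: split_indicator\<close>)

lemma set_nn_integral_subset:
  assumes "A \<subseteq> B"
  shows "(\<integral>\<^sup>+x\<in>A. f x \<partial>M) \<le> (\<integral>\<^sup>+x\<in>B. f x \<partial>M)"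
  by (intro nn_integral_mono) (use assms in \<open>auto split: split_indicator\<close>)

lemma set_nn_integral_cmult:
  assumes [measurable]: "f \<in> borel_measurable M" "A \<in> sets M"
  shows "(\<integral>\<^sup>+x\<in>A. c * f x \<partial>M) = c * (\<integral>\<^sup>+x\<in>A. f x \<partial>M)"
  unfolding mult.assoc by (rule nn_integral_cmult) measurable

lemma set_nn_integral_add:
  assumes [measurable]: "f \<in> borel_measurable M" "g \<in> borel_measurable M" "A \<in> sets M"
  shows "(\<integral>\<^sup>+x\<in>A. f x + g x \<partial>M) = (\<integral>\<^sup>+x\<in>A. f x \<partial>M) + (\<integral>\<^sup>+x\<in>A. g x \<partial>M)"
  unfolding distrib_right by (rule nn_integral_add) measurable

lemma set_nn_integral_Un_le:
  assumes [measurable]: "f \<in> borel_measurable M" "A \<in> sets M" "B \<in> sets M" and "S \<subseteq> A \<union> B"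
  shows "(\<integral>\<^sup>+x\<in>S. f x \<partial>M) \<le> (\<integral>\<^sup>+x\<in>A. f x \<partial>M) + (\<integral>\<^sup>+x\<in>B. f x \<partial>M)"
proof -
  have "(\<integral>\<^sup>+x\<in>S. f x \<partial>M) \<le> (\<integral>\<^sup>+x. f x * indicator A x + f x * indicator B x \<partial>M)"
    using assms(4) by (intro nn_integral_mono) (auto split: split_indicator)
  then show ?thesis by (simp add: nn_integral_add)
qed

lemma set_nn_integral_affine:
  fixes c t :: real
  assumes [measurable]: "f \<in> borel_measurable borel" and A[measurable]: "A \<in> sets borel"
    and c: "\<bar>c\<bar> = 1"
  shows "(\<integral>\<^sup>+x\<in>A. f x \<partial>lborel) = (\<integral>\<^sup>+x\<in>{x. t + c * x \<in> A}. f (t + c * x) \<partial>lborel)"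
proof -
  have "(\<integral>\<^sup>+x\<in>A. f x \<partial>lborel) = ennreal \<bar>c\<bar> * (\<integral>\<^sup>+x. f (t + c * x) * indicator A (t + c * x) \<partial>lborel)"
    by (rule nn_integral_real_affine) (use c in auto)
  then show ?thesis using c by (simp add: indicator_def)
qed

text \<open>Where \<open>G\<close> is constant up to a factor \<open>D\<close>, an inequality between the integrals of two weights passes on to
  their integrals against \<open>G\<close>.\<close>
lemma slow_variation_transfer:
  fixes w1 w2 G :: "real \<Rightarrow> ennreal"
  assumes [measurable]: "w1 \<in> borel_measurable borel" "w2 \<in> borel_measurable borel" "G \<in> borel_measurable borel"
      "I \<in> sets borel" "J \<in> sets borel"
    and G: "\<And>x y. x \<in> I \<Longrightarrow> y \<in> J \<Longrightarrow> G x \<le> D * G y"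
    and w: "(\<integral>\<^sup>+x\<in>I. w1 x \<partial>lborel) \<le> c * (\<integral>\<^sup>+x\<in>J. w2 x \<partial>lborel)"
    and pos: "(\<integral>\<^sup>+x\<in>J. w2 x \<partial>lborel) \<noteq> 0" "(\<integral>\<^sup>+x\<in>J. w2 x \<partial>lborel) \<noteq> \<infinity>"
  shows "(\<integral>\<^sup>+x\<in>I. w1 x * G x \<partial>lborel) \<le> c * D * (\<integral>\<^sup>+x\<in>J. w2 x * G x \<partial>lborel)"
proof -
  define A2 where "A2 = (\<integral>\<^sup>+x\<in>J. w2 x \<partial>lborel)"
  define X where "X = (\<integral>\<^sup>+x\<in>J. w2 x * G x \<partial>lborel)"
  have 1: "G x * A2 \<le> D * X" if "x \<in> I" for x
  proof -
    have "G x * A2 = (\<integral>\<^sup>+y\<in>J. G x * w2 y \<partial>lborel)" by (simp add: A2_def set_nn_integral_cmult)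
    also have "\<dots> \<le> (\<integral>\<^sup>+y\<in>J. D * (w2 y * G y) \<partial>lborel)"
    proof (rule set_nn_integral_le)
      fix y assume "y \<in> J"
      then show "G x * w2 y \<le> D * (w2 y * G y)"
        using mult_right_mono[OF G[OF that], of y "w2 y"] by (simp add: mult_ac)
    qed
    also have "\<dots> = D * X" unfolding X_def by (rule set_nn_integral_cmult) measurable
    finally show ?thesis .
  qed
  have "A2 * (\<integral>\<^sup>+x\<in>I. w1 x * G x \<partial>lborel) = (\<integral>\<^sup>+x\<in>I. A2 * (w1 x * G x) \<partial>lborel)"
    by (rule set_nn_integral_cmult[symmetric]) measurable
  also have "\<dots> \<le> (\<integral>\<^sup>+x\<in>I. (D * X) * w1 x \<partial>lborel)"
  proof (rule set_nn_integral_le)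
    fix x assume "x \<in> I"
    then show "A2 * (w1 x * G x) \<le> D * X * w1 x"
      using mult_right_mono[OF 1, of x "w1 x"] by (simp add: mult_ac)
  qed
  also have "\<dots> = D * X * (\<integral>\<^sup>+x\<in>I. w1 x \<partial>lborel)" by (rule set_nn_integral_cmult) measurable
  also have "\<dots> \<le> D * X * (c * A2)" unfolding A2_def by (rule mult_left_mono[OF w]) simp
  finally have "A2 * (\<integral>\<^sup>+x\<in>I. w1 x * G x \<partial>lborel) \<le> A2 * (c * D * X)" by (simp add: mult_ac)
  then show ?thesis using pos unfolding A2_def[symmetric] X_def[symmetric]
    by (simp add: ennreal_mult_le_mult_iff)
qed

text \<open>Absolute constants in front of integrals of \<open>p\<close>-th powers become \<open>p\<close>-th powers of constants that depend on
  \<open>q\<close> only; this is what makes the final constants uniform in \<open>p\<close>.\<close>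
lemma const_le_powr:
  fixes c p q :: real
  assumes "1 \<le> c" "0 < q" "q \<le> p"
  shows "c \<le> (c powr (1 / q)) powr p"
proof -
  have "c powr 1 \<le> c powr (p / q)" using assms by (intro powr_mono) auto
  then show ?thesis using assms by (simp add: powr_powr)
qed

lemma powr_ratio_le:
  fixes x y K g :: real
  assumes "0 < x" "0 < y" "1 \<le> K" "x \<le> K * y" "y \<le> K * x"
  shows "x powr g \<le> K powr \<bar>g\<bar> * y powr g"
proof (cases "g \<ge> 0")
  case True
  have "x powr g \<le> (K * y) powr g" using assms True by (intro powr_mono2) auto
  then show ?thesis using assms True by (simp add: powr_mult)
next
  case False
  have "x powr g \<le> (y / K) powr g"
    using assms False by (intro powr_mono2') (auto simp: field_simps)
  also have "\<dots> = K powr \<bar>g\<bar> * y powr g"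
    using assms False by (simp add: powr_divide powr_minus field_simps abs_if)
  finally show ?thesis .
qed

lemma powr_add_le:
  fixes x y p :: real
  assumes "0 \<le> x" "0 \<le> y" "0 < p"
  shows "(x + y) powr p \<le> 2 powr p * (x powr p + y powr p)"
proof -
  have "(x + y) powr p \<le> (2 * max x y) powr p" using assms by (intro powr_mono2) auto
  also have "\<dots> = 2 powr p * max x y powr p" using assms by (simp add: powr_mult)
  also have "\<dots> \<le> 2 powr p * (x powr p + y powr p)" by (intro mult_left_mono) (auto simp: max_def)
  finally show ?thesis .
qed

text \<open>Up to constants, the weight \<open>jacobi_w a b\<close> together with the Jacobian of \<open>x = - cos \<theta>\<close>, in the angle \<open>\<theta>\<close>.\<close>
definition arc_weight :: "real \<Rightarrow> real \<Rightarrow> real \<Rightarrow> real" where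
  "arc_weight g g' \<theta> = \<theta> powr g * (pi - \<theta>) powr g'"

definition reg_weight :: "real \<Rightarrow> real \<Rightarrow> real \<Rightarrow> real \<Rightarrow> real" where
  "reg_weight n g g' \<theta> = (1 / n + \<theta>) powr g * (1 / n + (pi - \<theta>)) powr g'"

lemma reg_weight_pos: "0 < n \<Longrightarrow> \<theta> \<in> {0..pi} \<Longrightarrow> 0 < reg_weight n g g' \<theta>"
proof -
  assume "0 < n" "\<theta> \<in> {0..pi}"
  moreover from this have "0 < 1 / n" by simp
  ultimately have "0 < 1 / n + \<theta>" "0 < 1 / n + (pi - \<theta>)" by (simp_all add: add_pos_nonneg)
  then show ?thesis by (simp add: reg_weight_def)
qed

lemma arc_weight_nonneg: "0 \<le> arc_weight g g' \<theta>"
  by (simp add: arc_weight_def)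

lemma measurable_arc_weight[measurable]: "arc_weight g g' \<in> borel_measurable borel"
  unfolding arc_weight_def by measurable

lemma measurable_reg_weight[measurable]: "reg_weight n g g' \<in> borel_measurable borel"
  unfolding reg_weight_def by measurable

text \<open>Regularizing at the scale \<open>1 / n\<close> makes the weight grow at most polynomially in the scaled distance, with an
  exponent that the decay of \<open>local_energy\<close> can beat.\<close>
lemma reg_weight_shift:
  assumes n: "0 < n" and \<theta>: "\<theta> \<in> {0..pi}" and \<theta>': "\<theta>' \<in> {0..pi}"
  shows "reg_weight n g g' \<theta> \<le> (1 + n * \<bar>\<theta> - \<theta>'\<bar>) powr (\<bar>g\<bar> + \<bar>g'\<bar>) * reg_weight n g g' \<theta>'"
proof -
  have gen: "1 / n + x \<le> (1 + n * \<bar>x - y\<bar>) * (1 / n + y)" if "0 \<le> x" "0 \<le> y" for x y :: real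
  proof -
    have "(1 + n * \<bar>x - y\<bar>) * (1 / n + y) = 1 / n + y + \<bar>x - y\<bar> + n * \<bar>x - y\<bar> * y"
      using n by (simp add: field_simps)
    moreover have "n * \<bar>x - y\<bar> * y \<ge> 0" using n that by simp
    ultimately show ?thesis by linarith
  qed
  have n': "1 / n > 0" using n by simp
  have K: "1 \<le> 1 + n * \<bar>\<theta> - \<theta>'\<bar>" using n by simp
  have 1: "(1 / n + \<theta>) powr g \<le> (1 + n * \<bar>\<theta> - \<theta>'\<bar>) powr \<bar>g\<bar> * (1 / n + \<theta>') powr g"
    using \<theta> \<theta>' K n' gen[of \<theta> \<theta>'] gen[of \<theta>' \<theta>]
    by (intro powr_ratio_le) (auto simp: abs_minus_commute intro: add_pos_nonneg)
  have 2: "(1 / n + (pi - \<theta>)) powr g' \<le> (1 + n * \<bar>\<theta> - \<theta>'\<bar>) powr \<bar>g'\<bar> * (1 / n + (pi - \<theta>')) powr g'"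
    using \<theta> \<theta>' K n' gen[of "pi - \<theta>" "pi - \<theta>'"] gen[of "pi - \<theta>'" "pi - \<theta>"]
    by (intro powr_ratio_le) (auto simp: abs_minus_commute intro: add_pos_nonneg)
  have "reg_weight n g g' \<theta> \<le> ((1 + n * \<bar>\<theta> - \<theta>'\<bar>) powr \<bar>g\<bar> * (1 / n + \<theta>') powr g) * ((1 + n * \<bar>\<theta> - \<theta>'\<bar>) powr \<bar>g'\<bar> * (1 / n + (pi - \<theta>')) powr g')"
    unfolding reg_weight_def by (intro mult_mono 1 2) auto
  then show ?thesis by (simp add: reg_weight_def powr_add mult_ac)
qed

lemma reg_weight_near:
  assumes n: "0 < n" and \<theta>: "\<theta> \<in> {0..pi}" and \<theta>': "\<theta>' \<in> {0..pi}" and "\<bar>\<theta> - \<theta>'\<bar> \<le> 1 / n"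
    and "\<bar>g\<bar> \<le> \<Gamma>" "\<bar>g'\<bar> \<le> \<Gamma>"
  shows "reg_weight n g g' \<theta> \<le> 4 powr \<Gamma> * reg_weight n g g' \<theta>'"
proof -
  have "(1 + n * \<bar>\<theta> - \<theta>'\<bar>) powr (\<bar>g\<bar> + \<bar>g'\<bar>) \<le> 2 powr (\<bar>g\<bar> + \<bar>g'\<bar>)"
    using assms by (intro powr_mono2) (auto simp: field_simps)
  also have "\<dots> \<le> 2 powr (\<Gamma> + \<Gamma>)" using assms by (intro powr_mono) auto
  also have "\<dots> = 4 powr \<Gamma>" unfolding powr_add by (simp flip: powr_mult)
  finally show ?thesis
    using reg_weight_shift[OF n \<theta> \<theta>', of g g'] reg_weight_pos[OF n \<theta>', of g g']
    by (meson less_imp_le mult_right_mono order.trans)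
qed

lemma has_integral_decay_half:
  fixes n a :: real
  assumes "0 < n" "0 \<le> a"
  shows "((\<lambda>x. n * (1 + n * x) powr (-2)) has_integral (1 - 1 / (1 + n * a))) {0..a}"
proof -
  have "((\<lambda>x. n * (1 + n * x) powr (-2)) has_integral ((- 1 / (1 + n * a)) - (- 1 / (1 + n * 0)))) {0..a}"
  proof (rule fundamental_theorem_of_calculus[OF assms(2)])
    fix x assume "x \<in> {0..a}"
    then have pos: "1 + n * x > 0" using assms by (simp add: add_pos_nonneg)
    have "((\<lambda>x. - 1 / (1 + n * x)) has_real_derivative n / (1 + n * x)\<^sup>2) (at x within {0..a})"
      using pos by (auto intro!: derivative_eq_intros simp: power2_eq_square)
    moreover have "n / (1 + n * x)\<^sup>2 = n * (1 + n * x) powr (-2)"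
      using pos by (simp add: powr_minus divide_inverse powr_numeral)
    ultimately show "((\<lambda>x. - 1 / (1 + n * x)) has_vector_derivative n * (1 + n * x) powr (-2)) (at x within {0..a})"
      by (simp add: has_real_derivative_iff_has_vector_derivative)
  qed
  then show ?thesis by simp
qed

lemma decay_mass:
  fixes n \<tau> :: real
  assumes n: "0 < n" and \<tau>: "\<tau> \<in> {0..pi}"
  shows "(\<integral>\<^sup>+\<theta>\<in>{0..pi}. ennreal (n * (1 + n * \<bar>\<theta> - \<tau>\<bar>) powr (-2)) \<partial>lborel) \<le> 2"
proof -
  let ?k = "\<lambda>x. ennreal (n * (1 + n * x) powr (-2))"
  have half: "(\<integral>\<^sup>+x\<in>{0..a}. ?k x \<partial>lborel) \<le> 1" if "0 \<le> a" for a
  proof -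
    have "(\<integral>\<^sup>+x\<in>{0..a}. ?k x \<partial>lborel) = ennreal (1 - 1 / (1 + n * a))"
      by (rule nn_integral_has_integral_lebesgue'[OF _ has_integral_decay_half]) (use n that in auto)
    also have "\<dots> \<le> 1" using n that by (simp add: ennreal_le_1)
    finally show ?thesis .
  qed
  have "(\<integral>\<^sup>+\<theta>\<in>{0..pi}. ?k \<bar>\<theta> - \<tau>\<bar> \<partial>lborel) \<le> (\<integral>\<^sup>+\<theta>\<in>{0..\<tau>}. ?k \<bar>\<theta> - \<tau>\<bar> \<partial>lborel) + (\<integral>\<^sup>+\<theta>\<in>{\<tau>..pi}. ?k \<bar>\<theta> - \<tau>\<bar> \<partial>lborel)"
    using \<tau> by (intro set_nn_integral_Un_le) auto
  also have "(\<integral>\<^sup>+\<theta>\<in>{0..\<tau>}. ?k \<bar>\<theta> - \<tau>\<bar> \<partial>lborel) = (\<integral>\<^sup>+x\<in>{x. \<tau> + (-1) * x \<in> {0..\<tau>}}. ?k \<bar>(\<tau> + (-1) * x) - \<tau>\<bar> \<partial>lborel)"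
    by (rule set_nn_integral_affine) auto
  also have "\<dots> = (\<integral>\<^sup>+x\<in>{0..\<tau>}. ?k x \<partial>lborel)"
    by (intro nn_integral_cong) (auto split: split_indicator)
  also have "\<dots> \<le> 1" using \<tau> by (intro half) auto
  also have "(\<integral>\<^sup>+\<theta>\<in>{\<tau>..pi}. ?k \<bar>\<theta> - \<tau>\<bar> \<partial>lborel) = (\<integral>\<^sup>+x\<in>{x. \<tau> + 1 * x \<in> {\<tau>..pi}}. ?k \<bar>(\<tau> + 1 * x) - \<tau>\<bar> \<partial>lborel)"
    by (rule set_nn_integral_affine) auto
  also have "\<dots> = (\<integral>\<^sup>+x\<in>{0..pi - \<tau>}. ?k x \<partial>lborel)"
    by (intro nn_integral_cong) (auto split: split_indicator)
  also have "\<dots> \<le> 1" using \<tau> by (intro half) auto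
  finally show ?thesis by (simp add: add_mono)
qed

text \<open>Jensen's inequality up to the factor \<open>4 powr P\<close>. With \<open>s = a / 4\<close>, the pointwise bound \<open>F \<le> s + s powr (1 -
  P) * F powr P\<close> is integrated; since the kernel has mass at most \<open>2\<close>, the first term costs only half of \<open>a\<close>.\<close>
lemma decay_jensen:
  fixes n \<tau> P :: real and F :: "real \<Rightarrow> real"
  assumes n: "0 < n" and \<tau>: "\<tau> \<in> {0..pi}" and P: "1 \<le> P"
    and F: "continuous_on {0..pi} F" "\<And>\<theta>. \<theta> \<in> {0..pi} \<Longrightarrow> 0 \<le> F \<theta>"
  defines "a \<equiv> integral {0..pi} (\<lambda>\<theta>. n * (F \<theta> * (1 + n * \<bar>\<theta> - \<tau>\<bar>) powr (-2)))"
  defines "X \<equiv> integral {0..pi} (\<lambda>\<theta>. n * (F \<theta> powr P * (1 + n * \<bar>\<theta> - \<tau>\<bar>) powr (-2)))"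
  shows "a powr P \<le> 4 powr P * X"
proof -
  have pos: "1 + n * \<bar>\<theta> - \<tau>\<bar> > 0" for \<theta> using n mult_nonneg_nonneg[of n "\<bar>\<theta> - \<tau>\<bar>"] by linarith
  have ck: "continuous_on {0..pi} (\<lambda>\<theta>. (1 + n * \<bar>\<theta> - \<tau>\<bar>) powr (-2))"
    using pos by (intro continuous_on_powr continuous_intros) (metis less_irrefl)
  have cF: "continuous_on {0..pi} (\<lambda>\<theta>. F \<theta> powr P)"
    using P F by (intro continuous_on_powr' continuous_intros) auto
  have i1: "(\<lambda>\<theta>. n * (F \<theta> * (1 + n * \<bar>\<theta> - \<tau>\<bar>) powr (-2))) integrable_on {0..pi}"
    by (intro integrable_continuous_interval continuous_on_mult_left continuous_on_mult ck F)
  have i2: "(\<lambda>\<theta>. n * (F \<theta> powr P * (1 + n * \<bar>\<theta> - \<tau>\<bar>) powr (-2))) integrable_on {0..pi}"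
    by (intro integrable_continuous_interval continuous_on_mult_left continuous_on_mult ck cF)
  have i3: "(\<lambda>\<theta>. n * (1 + n * \<bar>\<theta> - \<tau>\<bar>) powr (-2)) integrable_on {0..pi}"
    by (intro integrable_continuous_interval continuous_on_mult_left ck)
  have X0: "X \<ge> 0" unfolding X_def using n by (intro integral_nonneg i2) auto
  have a0: "a \<ge> 0" unfolding a_def using n F by (intro integral_nonneg i1) auto
  define K where "K = integral {0..pi} (\<lambda>\<theta>. n * (1 + n * \<bar>\<theta> - \<tau>\<bar>) powr (-2))"
  have "ennreal K = (\<integral>\<^sup>+\<theta>\<in>{0..pi}. ennreal (n * (1 + n * \<bar>\<theta> - \<tau>\<bar>) powr (-2)) \<partial>lborel)"
    unfolding K_def using n by (intro nn_integral_has_integral_lebesgue'[symmetric] integrable_integral i3) auto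
  also have "\<dots> \<le> ennreal 2" using decay_mass[OF n \<tau>] by simp
  finally have K: "K \<le> 2" by (subst (asm) ennreal_le_iff) auto
  show ?thesis
  proof (cases "a = 0")
    case False
    then have a: "a > 0" using a0 by simp
    \<comment> \<open>A quarter of \<open>a\<close>, since the kernel has mass at most \<open>2\<close> and half of \<open>a\<close> is to remain.\<close>
    define s where "s = a / 4"
    have s: "s > 0" using a by (simp add: s_def)
    have "a \<le> integral {0..pi} (\<lambda>\<theta>. s * (n * (1 + n * \<bar>\<theta> - \<tau>\<bar>) powr (-2)) + s powr (1 - P) * (n * (F \<theta> powr P * (1 + n * \<bar>\<theta> - \<tau>\<bar>) powr (-2))))"
      unfolding a_def
    proof (rule integral_le[OF i1])
      show "(\<lambda>\<theta>. s * (n * (1 + n * \<bar>\<theta> - \<tau>\<bar>) powr (-2)) + s powr (1 - P) * (n * (F \<theta> powr P * (1 + n * \<bar>\<theta> - \<tau>\<bar>) powr (-2)))) integrable_on {0..pi}"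
        by (intro integrable_continuous_interval continuous_on_mult_left continuous_on_mult continuous_on_add ck cF)
      fix \<theta> assume \<theta>: "\<theta> \<in> {0..pi}"
      have "F \<theta> \<le> s + s powr (1 - P) * F \<theta> powr P"
      proof (cases "F \<theta> \<le> s")
        case False
        then have "F \<theta> = F \<theta> powr (1 - P) * F \<theta> powr P" using s by (simp flip: powr_add)
        also have "\<dots> \<le> s powr (1 - P) * F \<theta> powr P"
          using False s P by (intro mult_right_mono powr_mono2') auto
        finally show ?thesis using s by linarith
      qed (simp add: add_increasing2)
      then have "n * (1 + n * \<bar>\<theta> - \<tau>\<bar>) powr (-2) * F \<theta> \<le> n * (1 + n * \<bar>\<theta> - \<tau>\<bar>) powr (-2) * (s + s powr (1 - P) * F \<theta> powr P)"
        using n by (intro mult_left_mono) auto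
      then show "n * (F \<theta> * (1 + n * \<bar>\<theta> - \<tau>\<bar>) powr (-2)) \<le> s * (n * (1 + n * \<bar>\<theta> - \<tau>\<bar>) powr (-2)) + s powr (1 - P) * (n * (F \<theta> powr P * (1 + n * \<bar>\<theta> - \<tau>\<bar>) powr (-2)))"
        by (simp add: algebra_simps)
    qed
    also have "\<dots> = s * K + s powr (1 - P) * X"
      unfolding K_def X_def using i2 i3
      by (subst Henstock_Kurzweil_Integration.integral_add) (auto intro!: integrable_on_mult_right)
    also have "s * K \<le> s * 2" using K s by (intro mult_left_mono) auto
    finally have "2 * s \<le> s powr (1 - P) * X" by (simp add: s_def)
    then have "s powr (P - 1) * s \<le> s powr (P - 1) * (s powr (1 - P) * X)"
      using s by (intro mult_left_mono) auto
    also have "\<dots> = X" using s by (simp flip: powr_add mult.assoc)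
    also have "s powr (P - 1) * s = s powr P" using s powr_add[of s "P - 1" 1] by simp
    finally have "s powr P \<le> X" .
    moreover have "a powr P = 4 powr P * s powr P" using s by (simp add: s_def flip: powr_mult)
    ultimately show ?thesis by simp
  qed (use X0 in simp)
qed

lemma measurable_poly_cos[measurable]: "(\<lambda>\<theta>. poly Q (- cos \<theta>) :: real) \<in> borel_measurable borel"
  by (intro borel_measurable_continuous_onI continuous_intros)

lemma ennreal_local_energy:
  assumes "0 < q" "0 \<le> n"
  shows "ennreal (local_energy q M Q n \<tau>) =
    (\<integral>\<^sup>+\<theta>\<in>{0..pi}. ennreal (n * (\<bar>poly Q (- cos \<theta>)\<bar> powr q * (1 + n * \<bar>\<theta> - \<tau>\<bar>) powr (- M))) \<partial>lborel)"
  unfolding local_energy_def using assms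
  by (intro nn_integral_has_integral_lebesgue'[symmetric] integrable_integral integrable_continuous_interval continuous_energy_integrand) auto

lemma measurable_local_energy:
  assumes "0 < q" "0 \<le> n"
  shows "local_energy q M Q n \<in> borel_measurable borel"
proof -
  have "local_energy q M Q n = (\<lambda>\<tau>. enn2real (\<integral>\<^sup>+\<theta>\<in>{0..pi}. ennreal (n * (\<bar>poly Q (- cos \<theta>)\<bar> powr q * (1 + n * \<bar>\<theta> - \<tau>\<bar>) powr (- M))) \<partial>lborel))"
    using assms by (simp add: fun_eq_iff local_energy_nonneg flip: ennreal_local_energy)
  also have "\<dots> \<in> borel_measurable borel"
    by measurable
  finally show ?thesis .
qed

text \<open>A factor \<open>(1 + n * \<bar>\<theta> - \<tau>\<bar>) powr (2 * \<Gamma> * q)\<close> of the kernel pays for moving the weight from \<open>\<tau>\<close> to \<open>\<theta>\<close>; the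
  remaining decay of order two is integrable. Jensen's inequality with exponent \<open>p / q\<close> and Tonelli's theorem
  conclude.\<close>
lemma reg_weight_energy_le:
  fixes n p q M g g' \<Gamma> :: real
  assumes n: "0 < n" and q: "0 < q" and p: "q \<le> p" and \<Gamma>: "\<bar>g\<bar> \<le> \<Gamma>" "\<bar>g'\<bar> \<le> \<Gamma>"
    and M: "2 * \<Gamma> * q + 2 \<le> M"
  shows "power_integral p {0..pi} (\<lambda>\<tau>. reg_weight n g g' \<tau> * local_energy q M Q n \<tau> powr (1/q))
    \<le> ennreal (2 * 4 powr (p/q)) * power_integral p {0..pi} (\<lambda>\<theta>. reg_weight n g g' \<theta> * \<bar>poly Q (- cos \<theta>)\<bar>)"
proof -
  let ?v = "reg_weight n g g'"
  define F where "F \<theta> = (?v \<theta> * \<bar>poly Q (- cos \<theta>)\<bar>) powr q" for \<theta>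
  define P where "P = p / q"
  have P: "P \<ge> 1" using p q by (simp add: P_def)
  have v0: "?v \<theta> > 0" if "\<theta> \<in> {0..pi}" for \<theta> using reg_weight_pos[OF n that] .
  have cv: "continuous_on {0..pi} ?v"
    unfolding reg_weight_def using n
    by (intro continuous_on_mult continuous_on_powr continuous_intros)
       (auto simp: add_pos_nonneg add_nonneg_eq_0_iff)
  have cF: "continuous_on {0..pi} F"
    unfolding F_def using q v0 by (intro continuous_on_powr' continuous_intros cv) (auto simp: less_imp_le)
  have [measurable]: "F \<in> borel_measurable borel" unfolding F_def by measurable
  have FP: "F \<theta> powr P = (?v \<theta> * \<bar>poly Q (- cos \<theta>)\<bar>) powr p" for \<theta>
    using q by (simp add: F_def P_def powr_powr)
  define X where "X \<tau> = integral {0..pi} (\<lambda>\<theta>. n * (F \<theta> powr P * (1 + n * \<bar>\<theta> - \<tau>\<bar>) powr (-2)))" for \<tau>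
  have pos: "1 + n * \<bar>\<theta> - \<tau>\<bar> > 0" for \<theta> \<tau> using n mult_nonneg_nonneg[of n "\<bar>\<theta> - \<tau>\<bar>"] by linarith
  have ck: "continuous_on {0..pi} (\<lambda>\<theta>. (1 + n * \<bar>\<theta> - \<tau>\<bar>) powr (-2))" for \<tau>
    using pos by (intro continuous_on_powr continuous_intros) (metis less_irrefl)
  have cFP: "continuous_on {0..pi} (\<lambda>\<theta>. F \<theta> powr P)"
    using P by (intro continuous_on_powr' continuous_intros cF) (auto simp: F_def)
  have pt: "(?v \<tau> * local_energy q M Q n \<tau> powr (1/q)) powr p \<le> 4 powr P * X \<tau>" if \<tau>: "\<tau> \<in> {0..pi}" for \<tau>
  proof -
    define a where "a = integral {0..pi} (\<lambda>\<theta>. n * (F \<theta> * (1 + n * \<bar>\<theta> - \<tau>\<bar>) powr (-2)))"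
    have "?v \<tau> powr q * local_energy q M Q n \<tau> \<le> a"
      unfolding a_def local_energy_def integral_mult_right[symmetric]
    proof (rule integral_le)
      show "(\<lambda>\<theta>. ?v \<tau> powr q * (n * (\<bar>poly Q (- cos \<theta>)\<bar> powr q * (1 + n * \<bar>\<theta> - \<tau>\<bar>) powr (- M)))) integrable_on {0..pi}"
        using q n by (intro integrable_continuous_interval continuous_on_mult_left continuous_energy_integrand) auto
      show "(\<lambda>\<theta>. n * (F \<theta> * (1 + n * \<bar>\<theta> - \<tau>\<bar>) powr (-2))) integrable_on {0..pi}"
        by (intro integrable_continuous_interval continuous_on_mult_left continuous_on_mult ck cF)
      fix \<theta> assume \<theta>: "\<theta> \<in> {0..pi}"
      define y where "y = 1 + n * \<bar>\<theta> - \<tau>\<bar>"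
      have y1: "1 \<le> y" using n by (simp add: y_def)
      have "?v \<tau> \<le> y powr (\<bar>g\<bar> + \<bar>g'\<bar>) * ?v \<theta>"
        using reg_weight_shift[OF n \<tau> \<theta>, of g g'] by (simp add: y_def abs_minus_commute)
      also have "\<dots> \<le> y powr (2 * \<Gamma>) * ?v \<theta>"
        using y1 \<Gamma> v0[OF \<theta>] by (intro mult_right_mono powr_mono) auto
      finally have "?v \<tau> powr q \<le> (y powr (2 * \<Gamma>) * ?v \<theta>) powr q"
        using v0[OF \<tau>] q by (intro powr_mono2) auto
      also have "\<dots> = y powr (2 * \<Gamma> * q) * ?v \<theta> powr q"
        using v0[OF \<theta>] by (simp add: powr_mult powr_powr)
      finally have "?v \<tau> powr q * y powr (- M) \<le> (y powr (2 * \<Gamma> * q) * ?v \<theta> powr q) * y powr (- M)"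
        by (intro mult_right_mono) auto
      also have "\<dots> = ?v \<theta> powr q * y powr (2 * \<Gamma> * q - M)" using y1 by (simp add: powr_diff powr_minus field_simps)
      also have "\<dots> \<le> ?v \<theta> powr q * y powr (-2)"
        using y1 M by (intro mult_left_mono powr_mono) auto
      finally have "?v \<tau> powr q * y powr (- M) \<le> ?v \<theta> powr q * y powr (-2)" .
      then have "n * \<bar>poly Q (- cos \<theta>)\<bar> powr q * (?v \<tau> powr q * y powr (- M)) \<le> n * \<bar>poly Q (- cos \<theta>)\<bar> powr q * (?v \<theta> powr q * y powr (-2))"
        using n by (intro mult_left_mono) auto
      then show "?v \<tau> powr q * (n * (\<bar>poly Q (- cos \<theta>)\<bar> powr q * (1 + n * \<bar>\<theta> - \<tau>\<bar>) powr (- M))) \<le> n * (F \<theta> * (1 + n * \<bar>\<theta> - \<tau>\<bar>) powr (-2))"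
        using v0[OF \<theta>] by (simp add: F_def y_def powr_mult mult_ac)
    qed
    moreover have le0: "local_energy q M Q n \<tau> \<ge> 0" using q n by (intro local_energy_nonneg) auto
    ultimately have "(?v \<tau> powr q * local_energy q M Q n \<tau>) powr P \<le> a powr P"
      using P by (intro powr_mono2) auto
    also have "a powr P \<le> 4 powr P * X \<tau>"
      unfolding a_def X_def by (rule decay_jensen[OF n \<tau> P cF]) (simp add: F_def)
    also have "(?v \<tau> powr q * local_energy q M Q n \<tau>) powr P = (?v \<tau> * local_energy q M Q n \<tau> powr (1/q)) powr p"
      using q v0[OF \<tau>] le0 by (simp add: P_def powr_mult powr_powr)
    finally show ?thesis .
  qed
  have eX: "ennreal (X \<tau>) = (\<integral>\<^sup>+\<theta>\<in>{0..pi}. ennreal (n * (F \<theta> powr P * (1 + n * \<bar>\<theta> - \<tau>\<bar>) powr (-2))) \<partial>lborel)" for \<tau>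
    unfolding X_def using n
    by (intro nn_integral_has_integral_lebesgue'[symmetric] integrable_integral integrable_continuous_interval
        continuous_on_mult_left continuous_on_mult ck cFP) auto
  have "power_integral p {0..pi} (\<lambda>\<tau>. ?v \<tau> * local_energy q M Q n \<tau> powr (1/q))
     \<le> (\<integral>\<^sup>+\<tau>\<in>{0..pi}. ennreal (4 powr P) * (\<integral>\<^sup>+\<theta>\<in>{0..pi}. ennreal (n * (F \<theta> powr P * (1 + n * \<bar>\<theta> - \<tau>\<bar>) powr (-2))) \<partial>lborel) \<partial>lborel)"
    unfolding eX[symmetric] by (intro set_nn_integral_le) (use pt in \<open>auto simp: ennreal_mult'[symmetric] intro!: ennreal_leI\<close>)
  also have "\<dots> = ennreal (4 powr P) * (\<integral>\<^sup>+\<tau>\<in>{0..pi}. (\<integral>\<^sup>+\<theta>\<in>{0..pi}. ennreal (n * (F \<theta> powr P * (1 + n * \<bar>\<theta> - \<tau>\<bar>) powr (-2))) \<partial>lborel) \<partial>lborel)"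
    by (rule set_nn_integral_cmult) measurable
  also have "(\<integral>\<^sup>+\<tau>\<in>{0..pi}. (\<integral>\<^sup>+\<theta>\<in>{0..pi}. ennreal (n * (F \<theta> powr P * (1 + n * \<bar>\<theta> - \<tau>\<bar>) powr (-2))) \<partial>lborel) \<partial>lborel)
      = (\<integral>\<^sup>+\<tau>. (\<integral>\<^sup>+\<theta>. ennreal (n * (F \<theta> powr P * (1 + n * \<bar>\<theta> - \<tau>\<bar>) powr (-2))) * indicator {0..pi} \<theta> * indicator {0..pi} \<tau> \<partial>lborel) \<partial>lborel)"
    by (intro nn_integral_cong nn_integral_multc[symmetric]) measurable
  also have "\<dots> = (\<integral>\<^sup>+\<theta>. (\<integral>\<^sup>+\<tau>. ennreal (n * (F \<theta> powr P * (1 + n * \<bar>\<theta> - \<tau>\<bar>) powr (-2))) * indicator {0..pi} \<theta> * indicator {0..pi} \<tau> \<partial>lborel) \<partial>lborel)"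
    by (rule lborel_pair.Fubini') measurable
  also have "\<dots> \<le> (\<integral>\<^sup>+\<theta>. 2 * (ennreal (F \<theta> powr P) * indicator {0..pi} \<theta>) \<partial>lborel)"
  proof (rule nn_integral_mono)
    fix \<theta> :: real
    show "(\<integral>\<^sup>+\<tau>. ennreal (n * (F \<theta> powr P * (1 + n * \<bar>\<theta> - \<tau>\<bar>) powr (-2))) * indicator {0..pi} \<theta> * indicator {0..pi} \<tau> \<partial>lborel)
        \<le> 2 * (ennreal (F \<theta> powr P) * indicator {0..pi} \<theta>)"
    proof (cases "\<theta> \<in> {0..pi}")
      case True
      have "(\<integral>\<^sup>+\<tau>. ennreal (n * (F \<theta> powr P * (1 + n * \<bar>\<theta> - \<tau>\<bar>) powr (-2))) * indicator {0..pi} \<theta> * indicator {0..pi} \<tau> \<partial>lborel)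
         = (\<integral>\<^sup>+\<tau>\<in>{0..pi}. ennreal (F \<theta> powr P) * ennreal (n * (1 + n * \<bar>\<tau> - \<theta>\<bar>) powr (-2)) \<partial>lborel)"
        using True n by (intro nn_integral_cong) (auto simp: ennreal_mult[symmetric] abs_minus_commute mult_ac split: split_indicator)
      also have "\<dots> = ennreal (F \<theta> powr P) * (\<integral>\<^sup>+\<tau>\<in>{0..pi}. ennreal (n * (1 + n * \<bar>\<tau> - \<theta>\<bar>) powr (-2)) \<partial>lborel)"
        by (rule set_nn_integral_cmult) measurable
      also have "\<dots> \<le> ennreal (F \<theta> powr P) * 2" by (intro mult_left_mono decay_mass[OF n True]) auto
      finally show ?thesis using True by (simp add: mult.commute)
    qed simp
  qed
  also have "\<dots> = 2 * power_integral P {0..pi} (\<lambda>\<theta>. F \<theta>)"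
    by (rule nn_integral_cmult) measurable
  finally have "power_integral p {0..pi} (\<lambda>\<tau>. ?v \<tau> * local_energy q M Q n \<tau> powr (1/q))
     \<le> ennreal (4 powr P) * (2 * power_integral P {0..pi} (\<lambda>\<theta>. F \<theta>))"
    by (simp add: mult_left_mono)
  then show ?thesis unfolding FP unfolding P_def
    by (simp add: ennreal_mult mult_ac)
qed

section \<open>Slowly varying majorants\<close>

lemma two_powr_abs_le: "\<bar>x\<bar> \<le> \<Gamma> \<Longrightarrow> 1 \<le> K \<Longrightarrow> K powr \<bar>x\<bar> \<le> K powr \<Gamma>" for K x \<Gamma> :: real
  by (intro powr_mono) auto

lemma powr_offset_far:
  fixes d x h :: real
  assumes "0 < d" "d \<le> x" "\<bar>h\<bar> \<le> \<Gamma>"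
  shows "x powr h \<le> 2 powr \<Gamma> * (d + x) powr h"
proof -
  have "x powr h \<le> 2 powr \<bar>h\<bar> * (d + x) powr h" using assms by (intro powr_ratio_le) auto
  also have "\<dots> \<le> 2 powr \<Gamma> * (d + x) powr h" by (intro mult_right_mono two_powr_abs_le assms) auto
  finally show ?thesis .
qed

lemma powr_offset_near:
  fixes d x h :: real
  assumes "0 < d" "0 \<le> x" "x \<le> d" "\<bar>h\<bar> \<le> \<Gamma>"
  shows "d powr h \<le> 2 powr \<Gamma> * (d + x) powr h"
proof -
  have "d powr h \<le> 2 powr \<bar>h\<bar> * (d + x) powr h" using assms by (intro powr_ratio_le) auto
  also have "\<dots> \<le> 2 powr \<Gamma> * (d + x) powr h" by (intro mult_right_mono two_powr_abs_le assms) auto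
  finally show ?thesis .
qed

lemma powr_offset_le:
  fixes d x h \<epsilon> :: real
  assumes "0 < d" "0 < \<epsilon>" "\<epsilon> * d \<le> x" "\<bar>h\<bar> \<le> \<Gamma>"
  shows "(d + x) powr h \<le> (1 + 1 / \<epsilon>) powr \<Gamma> * x powr h"
proof -
  define K where "K = 1 + 1 / \<epsilon>"
  have K: "1 \<le> K" using assms by (simp add: K_def)
  have x: "0 < x" using assms mult_pos_pos[of \<epsilon> d] by linarith
  have 1: "d + x \<le> K * x" using assms by (simp add: K_def field_simps)
  have 2: "x \<le> K * (d + x)" proof -
    have "x \<le> 1 * (d + x)" using assms(1) by simp
    also have "\<dots> \<le> K * (d + x)" using assms(1) x by (intro mult_right_mono K) auto
    finally show ?thesis .
  qed
  have "(d + x) powr h \<le> K powr \<bar>h\<bar> * x powr h" using assms(1) x K 1 2 by (intro powr_ratio_le) auto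
  also have "\<dots> \<le> K powr \<Gamma> * x powr h" by (intro mult_right_mono two_powr_abs_le assms K) auto
  finally show ?thesis by (simp add: K_def)
qed

lemma arc_weight_le_reg_weight_left:
  assumes n: "1 \<le> n" and \<theta>: "0 \<le> \<theta>" "\<theta> \<le> 1 / n" and \<Gamma>: "\<bar>g\<bar> \<le> \<Gamma>" "\<bar>g'\<bar> \<le> \<Gamma>"
  shows "arc_weight g g' \<theta> \<le> 4 powr \<Gamma> * (n * \<theta>) powr g * reg_weight n g g' \<theta>"
proof (cases "\<theta> = 0")
  case False
  have n': "0 < 1 / n" "1 / n \<le> 1" using n by auto
  have 1: "(1 / n) powr g \<le> 2 powr \<Gamma> * (1 / n + \<theta>) powr g"
    by (rule powr_offset_near[OF n'(1) \<theta> \<Gamma>(1)])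
  have far: "1 / n \<le> pi - \<theta>" using pi_gt3 n' \<theta> by linarith
  have 2: "(pi - \<theta>) powr g' \<le> 2 powr \<Gamma> * (1 / n + (pi - \<theta>)) powr g'"
    by (rule powr_offset_far[OF n'(1) far \<Gamma>(2)])
  have "\<theta> powr g = (n * \<theta>) powr g * (1 / n) powr g"
    using \<theta> n by (simp flip: powr_mult)
  then have "arc_weight g g' \<theta> = (n * \<theta>) powr g * ((1 / n) powr g * (pi - \<theta>) powr g')" by (simp add: arc_weight_def)
  also have "\<dots> \<le> (n * \<theta>) powr g * ((2 powr \<Gamma> * (1 / n + \<theta>) powr g) * (2 powr \<Gamma> * (1 / n + (pi - \<theta>)) powr g'))"
    by (intro mult_left_mono mult_mono 1 2) auto
  also have "\<dots> = (2 powr \<Gamma> * 2 powr \<Gamma>) * ((n * \<theta>) powr g * reg_weight n g g' \<theta>)" by (simp add: reg_weight_def)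
  also have "2 powr \<Gamma> * 2 powr \<Gamma> = 4 powr \<Gamma>" by (simp flip: powr_mult)
  finally show ?thesis by (simp add: mult_ac)
qed (simp add: arc_weight_def reg_weight_def)

lemma arc_weight_le_reg_weight_middle:
  assumes n: "1 \<le> n" and \<theta>: "1 / n \<le> \<theta>" "\<theta> \<le> pi - 1 / n" and \<Gamma>: "\<bar>g\<bar> \<le> \<Gamma>" "\<bar>g'\<bar> \<le> \<Gamma>"
  shows "arc_weight g g' \<theta> \<le> 4 powr \<Gamma> * reg_weight n g g' \<theta>"
proof -
  have n': "0 < 1 / n" using n by auto
  have far: "1 / n \<le> pi - \<theta>" using \<theta> by linarith
  have "arc_weight g g' \<theta> \<le> (2 powr \<Gamma> * (1 / n + \<theta>) powr g) * (2 powr \<Gamma> * (1 / n + (pi - \<theta>)) powr g')"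
    unfolding arc_weight_def by (intro mult_mono powr_offset_far n' \<theta> far \<Gamma>) auto
  also have "\<dots> = (2 powr \<Gamma> * 2 powr \<Gamma>) * reg_weight n g g' \<theta>" by (simp add: reg_weight_def)
  also have "2 powr \<Gamma> * 2 powr \<Gamma> = 4 powr \<Gamma>" by (simp flip: powr_mult)
  finally show ?thesis .
qed

lemma reg_weight_le_arc_weight:
  assumes n: "1 \<le> n" and \<epsilon>: "0 < \<epsilon>" and \<theta>: "\<epsilon> / n \<le> \<theta>" "\<theta> \<le> pi - \<epsilon> / n" and \<Gamma>: "\<bar>g\<bar> \<le> \<Gamma>" "\<bar>g'\<bar> \<le> \<Gamma>"
  shows "reg_weight n g g' \<theta> \<le> (1 + 1 / \<epsilon>) powr (2 * \<Gamma>) * arc_weight g g' \<theta>"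
proof -
  define K where "K = 1 + 1 / \<epsilon>"
  have n': "0 < 1 / n" using n by auto
  have e: "\<epsilon> * (1 / n) \<le> \<theta>" "\<epsilon> * (1 / n) \<le> pi - \<theta>" using \<theta> by (auto simp: algebra_simps)
  have "reg_weight n g g' \<theta> \<le> (K powr \<Gamma> * \<theta> powr g) * (K powr \<Gamma> * (pi - \<theta>) powr g')"
    unfolding reg_weight_def K_def by (intro mult_mono powr_offset_le n' \<epsilon> e \<Gamma>) auto
  also have "\<dots> = (K powr \<Gamma> * K powr \<Gamma>) * arc_weight g g' \<theta>" by (simp add: arc_weight_def)
  also have "K powr \<Gamma> * K powr \<Gamma> = K powr (2 * \<Gamma>)" by (simp flip: powr_add)
  finally show ?thesis by (simp add: K_def)
qed

lemma set_nn_integral_powr_le: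
  assumes [measurable]: "G \<in> borel_measurable borel" "A \<in> sets borel" and "0 \<le> c" "0 \<le> p"
    and F: "\<And>x. x \<in> A \<Longrightarrow> 0 \<le> F x \<and> F x \<le> c * G x"
    and G: "\<And>x. x \<in> A \<Longrightarrow> 0 \<le> G x"
  shows "power_integral p A F \<le> ennreal (c powr p) * power_integral p A G"
proof -
  have "power_integral p A F \<le> (\<integral>\<^sup>+x\<in>A. ennreal (c powr p) * ennreal (G x powr p) \<partial>lborel)"
  proof (rule set_nn_integral_le)
    fix x assume x: "x \<in> A"
    have "F x powr p \<le> (c * G x) powr p" using F[OF x] assms by (intro powr_mono2) auto
    also have "\<dots> = c powr p * G x powr p" using assms G[OF x] by (simp add: powr_mult)
    finally show "ennreal (F x powr p) \<le> ennreal (c powr p) * ennreal (G x powr p)"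
      by (simp add: ennreal_mult'[symmetric] ennreal_leI)
  qed
  also have "\<dots> = ennreal (c powr p) * power_integral p A G"
    by (rule set_nn_integral_cmult) measurable
  finally show ?thesis .
qed

text \<open>Near \<open>0\<close> a negative exponent makes the true weight larger than the regularized one. Since \<open>B\<close> and the
  regularized weight are almost constant on \<open>{0..1/n}\<close>, only the integral of \<open>(n * \<theta>) powr (g * p)\<close> matters,
  and \<open>q \<le> g * p + 1\<close> bounds it.\<close>
lemma arc_weight_end_bound:
  fixes B :: "real \<Rightarrow> real"
  assumes [measurable]: "B \<in> borel_measurable borel"
    and n: "1 \<le> n" and q: "0 < q" "q \<le> 1" "q \<le> p" and \<Gamma>: "\<bar>g\<bar> \<le> \<Gamma>" "\<bar>g'\<bar> \<le> \<Gamma>"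
    and g: "q \<le> g * p + 1" and B0: "\<And>\<theta>. 0 \<le> B \<theta>" and D: "1 \<le> D"
    and slow: "\<And>\<theta> \<theta>'. \<theta> \<in> {0..1/n} \<Longrightarrow> \<theta>' \<in> {0..1/n} \<Longrightarrow> B \<theta> \<le> D * B \<theta>'"
  shows "power_integral p {0..1/n} (\<lambda>\<theta>. arc_weight g g' \<theta> * B \<theta>)
    \<le> ennreal ((4 powr \<Gamma> * (4 powr \<Gamma> * D) * (1/q) powr (1/q)) powr p) *
       power_integral p {0..1/n} (\<lambda>\<theta>. reg_weight n g g' \<theta> * B \<theta>)"
proof -
  define G where "G \<theta> = ennreal ((reg_weight n g g' \<theta> * B \<theta>) powr p)" for \<theta>
  define w where "w \<theta> = ennreal ((n * \<theta>) powr (g * p))" for \<theta>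
  have [measurable]: "G \<in> borel_measurable borel" "w \<in> borel_measurable borel" unfolding G_def w_def by measurable
  have p: "p > 0" using q by linarith
  have n': "0 < 1 / n" "1 / n \<le> 1" using n by auto
  have sub: "\<theta> \<in> {0..pi}" if "\<theta> \<in> {0..1/n}" for \<theta>
    using that n' pi_gt3 unfolding atLeastAtMost_iff by linarith
  have rpos: "reg_weight n g g' \<theta> \<ge> 0" for \<theta> unfolding reg_weight_def by auto
  have pt: "ennreal ((arc_weight g g' \<theta> * B \<theta>) powr p) \<le> ennreal ((4 powr \<Gamma>) powr p) * (w \<theta> * G \<theta>)" if \<theta>: "\<theta> \<in> {0..1/n}" for \<theta>
  proof -
    have "arc_weight g g' \<theta> * B \<theta> \<le> (4 powr \<Gamma> * (n * \<theta>) powr g * reg_weight n g g' \<theta>) * B \<theta>"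
      using \<theta> n \<Gamma> B0 by (intro mult_right_mono arc_weight_le_reg_weight_left) auto
    then have "(arc_weight g g' \<theta> * B \<theta>) powr p \<le> ((4 powr \<Gamma> * (n * \<theta>) powr g * reg_weight n g g' \<theta>) * B \<theta>) powr p"
      using p B0 by (intro powr_mono2) (auto simp: arc_weight_nonneg)
    also have "\<dots> = (4 powr \<Gamma>) powr p * ((n * \<theta>) powr (g * p) * (reg_weight n g g' \<theta> * B \<theta>) powr p)"
      using rpos[of \<theta>] B0[of \<theta>] by (simp add: powr_mult powr_powr mult_ac)
    finally show ?thesis unfolding w_def G_def by (simp add: ennreal_mult[symmetric] ennreal_leI)
  qed
  have slowG: "G x \<le> ennreal ((4 powr \<Gamma> * D) powr p) * G y" if "x \<in> {0..1/n}" "y \<in> {0..1/n}" for x y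
  proof -
    have "reg_weight n g g' x * B x \<le> (4 powr \<Gamma> * reg_weight n g g' y) * (D * B y)"
      using that n \<Gamma> B0 rpos[of y] by (intro mult_mono slow reg_weight_near sub) auto
    then have "(reg_weight n g g' x * B x) powr p \<le> ((4 powr \<Gamma> * reg_weight n g g' y) * (D * B y)) powr p"
      using p B0 rpos by (intro powr_mono2) auto
    also have "\<dots> = (4 powr \<Gamma> * D) powr p * (reg_weight n g g' y * B y) powr p"
      using rpos[of y] B0[of y] D by (simp add: powr_mult mult_ac)
    finally show ?thesis unfolding G_def by (simp add: ennreal_mult[symmetric] ennreal_leI)
  qed
  have one: "(\<integral>\<^sup>+\<theta>\<in>{0..1/n}. 1 \<partial>lborel) = ennreal (1 / n)" using n' by simp
  have "(\<integral>\<^sup>+\<theta>\<in>{0..1/n}. w \<theta> \<partial>lborel) = ennreal (n powr (g * p) * ((1 / n) powr (g * p + 1) / (g * p + 1)))"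
    unfolding w_def
  proof (rule nn_integral_has_integral_lebesgue')
    have "((\<lambda>\<theta>. n powr (g * p) * \<theta> powr (g * p)) has_integral n powr (g * p) * ((1 / n) powr (g * p + 1) / (g * p + 1))) {0..1/n}"
      using g q n' by (intro has_integral_mult_right has_integral_powr_from_0) auto
    then show "((\<lambda>\<theta>. (n * \<theta>) powr (g * p)) has_integral n powr (g * p) * ((1 / n) powr (g * p + 1) / (g * p + 1))) {0..1/n}"
      using n by (subst has_integral_cong[where g = "\<lambda>\<theta>. n powr (g * p) * \<theta> powr (g * p)"]) (auto simp: powr_mult)
  qed simp
  also have "n powr (g * p) * ((1 / n) powr (g * p + 1) / (g * p + 1)) = (1 / n) / (g * p + 1)"
    using n by (simp add: powr_divide powr_add)
  also have "ennreal \<dots> \<le> ennreal (1 / q * (1 / n))"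
    using g q n' by (intro ennreal_leI) (auto intro!: divide_left_mono mult_left_mono simp: divide_inverse mult_ac)
  also have "\<dots> = ennreal (1 / q) * (\<integral>\<^sup>+\<theta>\<in>{0..1/n}. 1 \<partial>lborel)" unfolding one using q n' by (simp add: ennreal_mult[symmetric])
  finally have wint: "(\<integral>\<^sup>+\<theta>\<in>{0..1/n}. w \<theta> \<partial>lborel) \<le> ennreal (1 / q) * (\<integral>\<^sup>+\<theta>\<in>{0..1/n}. 1 \<partial>lborel)" .
  have "(\<integral>\<^sup>+\<theta>\<in>{0..1/n}. w \<theta> * G \<theta> \<partial>lborel) \<le> ennreal (1 / q) * ennreal ((4 powr \<Gamma> * D) powr p) * (\<integral>\<^sup>+\<theta>\<in>{0..1/n}. 1 * G \<theta> \<partial>lborel)"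
    using one n' by (intro slow_variation_transfer slowG wint) auto
  then have tr: "(\<integral>\<^sup>+\<theta>\<in>{0..1/n}. w \<theta> * G \<theta> \<partial>lborel) \<le> ennreal (1 / q) * ennreal ((4 powr \<Gamma> * D) powr p) * (\<integral>\<^sup>+\<theta>\<in>{0..1/n}. G \<theta> \<partial>lborel)" by simp
  have "power_integral p {0..1/n} (\<lambda>\<theta>. arc_weight g g' \<theta> * B \<theta>)
     \<le> (\<integral>\<^sup>+\<theta>\<in>{0..1/n}. ennreal ((4 powr \<Gamma>) powr p) * (w \<theta> * G \<theta>) \<partial>lborel)"
    by (intro set_nn_integral_le pt)
  also have "\<dots> = ennreal ((4 powr \<Gamma>) powr p) * (\<integral>\<^sup>+\<theta>\<in>{0..1/n}. w \<theta> * G \<theta> \<partial>lborel)"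
    by (rule set_nn_integral_cmult) measurable
  also have "\<dots> \<le> ennreal ((4 powr \<Gamma>) powr p) * (ennreal (1 / q) * ennreal ((4 powr \<Gamma> * D) powr p) * (\<integral>\<^sup>+\<theta>\<in>{0..1/n}. G \<theta> \<partial>lborel))"
    by (intro mult_left_mono tr) auto
  also have "\<dots> = ennreal ((4 powr \<Gamma>) powr p * ((4 powr \<Gamma> * D) powr p) * (1 / q)) * (\<integral>\<^sup>+\<theta>\<in>{0..1/n}. G \<theta> \<partial>lborel)"
    using q by (subst ennreal_mult, simp, simp)+ (simp only: mult_ac)
  also have "\<dots> \<le> ennreal ((4 powr \<Gamma> * (4 powr \<Gamma> * D) * (1/q) powr (1/q)) powr p) * (\<integral>\<^sup>+\<theta>\<in>{0..1/n}. G \<theta> \<partial>lborel)"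
  proof (intro mult_right_mono ennreal_leI)
    have "(4 powr \<Gamma>) powr p * ((4 powr \<Gamma> * D) powr p) * (1 / q) \<le> (4 powr \<Gamma>) powr p * ((4 powr \<Gamma> * D) powr p) * ((1/q) powr (1/q)) powr p"
      using q by (intro mult_left_mono const_le_powr) auto
    also have "\<dots> = (4 powr \<Gamma> * (4 powr \<Gamma> * D) * (1/q) powr (1/q)) powr p" using D by (simp add: powr_mult)
    finally show "(4 powr \<Gamma>) powr p * ((4 powr \<Gamma> * D) powr p) * (1 / q) \<le> (4 powr \<Gamma> * (4 powr \<Gamma> * D) * (1/q) powr (1/q)) powr p" .
  qed simp
  finally show ?thesis unfolding G_def .
qed

lemma arc_weight_swap: "arc_weight g g' (pi - \<theta>) = arc_weight g' g \<theta>"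
  by (simp add: arc_weight_def)

lemma reg_weight_swap: "reg_weight n g g' (pi - \<theta>) = reg_weight n g' g \<theta>"
  by (simp add: reg_weight_def)

lemma set_nn_integral_flip:
  fixes f :: "real \<Rightarrow> ennreal"
  assumes [measurable]: "f \<in> borel_measurable borel"
  shows "(\<integral>\<^sup>+x\<in>{a..b}. f x \<partial>lborel) = (\<integral>\<^sup>+x\<in>{c-b..c-a}. f (c - x) \<partial>lborel)"
  by (subst set_nn_integral_affine[where t = c and c = "-1"])
     (auto intro!: nn_integral_cong split: split_indicator)

text \<open>The properties of a polynomial in the angle that the rest of the proof needs: \<open>B\<close> controls \<open>T\<close> and its
  increments on the scale \<open>1 / n\<close> and is itself almost constant on that scale.\<close>
locale slow_majorant =
  fixes n :: nat and C :: real and T B :: "real \<Rightarrow> real"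
  assumes n_ge: "1 \<le> n" and C_ge: "1 \<le> C"
    and B_measurable [measurable]: "B \<in> borel_measurable borel"
    and B_nonneg: "0 \<le> B \<theta>"
    and T_le: "\<tau> \<in> {0..pi} \<Longrightarrow> \<bar>T \<tau>\<bar> \<le> B \<tau>"
    and T_lipschitz: "\<lbrakk>\<tau> \<in> {0..pi}; \<tau>' \<in> {0..pi}; \<bar>\<tau> - \<tau>'\<bar> \<le> 1 / real n\<rbrakk>
      \<Longrightarrow> \<bar>T \<tau> - T \<tau>'\<bar> \<le> real n * \<bar>\<tau> - \<tau>'\<bar> * B \<tau>"
    and B_slow: "\<lbrakk>\<tau> \<in> {0..pi}; \<tau>' \<in> {0..pi}; \<bar>\<tau> - \<tau>'\<bar> \<le> 1 / real n\<rbrakk> \<Longrightarrow> B \<tau> \<le> C * B \<tau>'"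

text \<open>The end at \<open>\<pi>\<close> reduces to the end at \<open>0\<close> by the reflection \<open>\<theta> \<mapsto> \<pi> - \<theta>\<close>; in between, the two weights are
  comparable pointwise.\<close>
lemma (in slow_majorant) arc_weight_le_reg_weight_norm:
  assumes q: "0 < q" "q \<le> 1" "q \<le> p" and \<Gamma>: "\<bar>g\<bar> \<le> \<Gamma>" "\<bar>g'\<bar> \<le> \<Gamma>"
    and g: "q \<le> g * p + 1" "q \<le> g' * p + 1"
  shows "power_integral p {0..pi} (\<lambda>\<theta>. arc_weight g g' \<theta> * B \<theta>)
    \<le> ennreal ((3 powr (1/q) * (4 powr \<Gamma> * (4 powr \<Gamma> * C) * (1/q) powr (1/q))) powr p) *
       power_integral p {0..pi} (\<lambda>\<theta>. reg_weight n g g' \<theta> * B \<theta>)"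
proof -
  have n: "1 \<le> real n" using n_ge by simp
  define c where "c = 4 powr \<Gamma> * (4 powr \<Gamma> * C) * (1/q) powr (1/q)"
  define F where "F \<theta> = ennreal ((arc_weight g g' \<theta> * B \<theta>) powr p)" for \<theta>
  define G where "G \<theta> = ennreal ((reg_weight n g g' \<theta> * B \<theta>) powr p)" for \<theta>
  have [measurable]: "F \<in> borel_measurable borel" "G \<in> borel_measurable borel" unfolding F_def G_def by measurable
  have p: "p > 0" using q by linarith
  have n': "0 < 1 / real n" "1 / real n \<le> 1" using n by auto
  have \<Gamma>0: "\<Gamma> \<ge> 0" using \<Gamma> by linarith
  have four: "1 \<le> 4 powr \<Gamma>" using \<Gamma>0 by (intro ge_one_powr_ge_zero) auto
  have qq: "1 \<le> (1/q) powr (1/q)" using q by (intro ge_one_powr_ge_zero) auto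
  have "1 * 1 \<le> (4 powr \<Gamma> * C) * (1/q) powr (1/q)"
    using four C_ge qq mult_mono[of 1 "4 powr \<Gamma>" 1 C] by (intro mult_mono) auto
  then have cge: "4 powr \<Gamma> \<le> c" unfolding c_def using four
    by (simp add: mult.assoc)
  have c0: "c \<ge> 0" using cge four by linarith
  have rpos: "reg_weight n g g' \<theta> \<ge> 0" for \<theta> unfolding reg_weight_def by auto
  have sub: "\<theta> \<in> {0..pi}" "pi - \<theta> \<in> {0..pi}" if "\<theta> \<in> {0..1/real n}" for \<theta>
    using that n' pi_gt3 unfolding atLeastAtMost_iff by linarith+
  have near: "\<bar>\<theta> - \<theta>'\<bar> \<le> 1 / real n" "\<bar>(pi - \<theta>) - (pi - \<theta>')\<bar> \<le> 1 / real n" if "\<theta> \<in> {0..1/real n}" "\<theta>' \<in> {0..1/real n}" for \<theta> \<theta>'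
    using that unfolding atLeastAtMost_iff by linarith+
  have L: "(\<integral>\<^sup>+\<theta>\<in>{0..1/real n}. F \<theta> \<partial>lborel) \<le> ennreal (c powr p) * (\<integral>\<^sup>+\<theta>\<in>{0..pi}. G \<theta> \<partial>lborel)"
  proof -
    have "(\<integral>\<^sup>+\<theta>\<in>{0..1/real n}. F \<theta> \<partial>lborel) \<le> ennreal (c powr p) * (\<integral>\<^sup>+\<theta>\<in>{0..1/real n}. G \<theta> \<partial>lborel)"
      unfolding F_def G_def c_def
      by (rule arc_weight_end_bound[OF _ n q \<Gamma> g(1) B_nonneg C_ge B_slow[OF sub(1) sub(1) near(1)]]) auto
    also have "\<dots> \<le> ennreal (c powr p) * (\<integral>\<^sup>+\<theta>\<in>{0..pi}. G \<theta> \<partial>lborel)"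
      using sub(1) by (intro mult_left_mono set_nn_integral_subset subsetI) auto
    finally show ?thesis .
  qed
  have R: "(\<integral>\<^sup>+\<theta>\<in>{pi-1/real n..pi}. F \<theta> \<partial>lborel) \<le> ennreal (c powr p) * (\<integral>\<^sup>+\<theta>\<in>{0..pi}. G \<theta> \<partial>lborel)"
  proof -
    have "(\<integral>\<^sup>+\<theta>\<in>{pi-1/real n..pi}. F \<theta> \<partial>lborel) = (\<integral>\<^sup>+\<theta>\<in>{0..1/real n}. F (pi - \<theta>) \<partial>lborel)"
      by (subst set_nn_integral_flip[where c = pi]) auto
    also have "\<dots> \<le> ennreal (c powr p) * (\<integral>\<^sup>+\<theta>\<in>{0..1/real n}. G (pi - \<theta>) \<partial>lborel)"
      unfolding F_def G_def c_def arc_weight_swap reg_weight_swap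
      by (rule arc_weight_end_bound[OF _ n q \<Gamma>(2,1) g(2) B_nonneg C_ge B_slow[OF sub(2) sub(2) near(2)]]) auto
    also have "(\<integral>\<^sup>+\<theta>\<in>{0..1/real n}. G (pi - \<theta>) \<partial>lborel) = (\<integral>\<^sup>+\<theta>\<in>{pi-1/real n..pi}. G \<theta> \<partial>lborel)"
      by (subst (2) set_nn_integral_flip[where c = pi]) auto
    also have "ennreal (c powr p) * \<dots> \<le> ennreal (c powr p) * (\<integral>\<^sup>+\<theta>\<in>{0..pi}. G \<theta> \<partial>lborel)"
      using sub(2)[of "pi - _"] by (intro mult_left_mono set_nn_integral_subset subsetI) auto
    finally show ?thesis .
  qed
  have M: "(\<integral>\<^sup>+\<theta>\<in>{1/real n..pi-1/real n}. F \<theta> \<partial>lborel) \<le> ennreal (c powr p) * (\<integral>\<^sup>+\<theta>\<in>{0..pi}. G \<theta> \<partial>lborel)"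
  proof -
    have "(\<integral>\<^sup>+\<theta>\<in>{1/real n..pi-1/real n}. F \<theta> \<partial>lborel) \<le> ennreal (c powr p) * (\<integral>\<^sup>+\<theta>\<in>{1/real n..pi-1/real n}. G \<theta> \<partial>lborel)"
      unfolding F_def G_def
    proof (rule set_nn_integral_powr_le)
      fix \<theta> assume \<theta>: "\<theta> \<in> {1/real n..pi-1/real n}"
      have "arc_weight g g' \<theta> \<le> 4 powr \<Gamma> * reg_weight n g g' \<theta>"
        using \<theta> by (intro arc_weight_le_reg_weight_middle n \<Gamma>) auto
      also have "\<dots> \<le> c * reg_weight n g g' \<theta>" by (intro mult_right_mono cge rpos)
      finally have "arc_weight g g' \<theta> * B \<theta> \<le> (c * reg_weight n g g' \<theta>) * B \<theta>" by (intro mult_right_mono B_nonneg)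
      then show "0 \<le> arc_weight g g' \<theta> * B \<theta> \<and> arc_weight g g' \<theta> * B \<theta> \<le> c * (reg_weight n g g' \<theta> * B \<theta>)"
        using B_nonneg arc_weight_nonneg by (simp add: mult.assoc)
    qed (use c0 p rpos B_nonneg in auto)
    also have "\<dots> \<le> ennreal (c powr p) * (\<integral>\<^sup>+\<theta>\<in>{0..pi}. G \<theta> \<partial>lborel)"
    proof (intro mult_left_mono set_nn_integral_subset subsetI)
      fix x assume "x \<in> {1 / real n..pi - 1 / real n}"
      then show "x \<in> {0..pi}" using n'(1) unfolding atLeastAtMost_iff by linarith
    qed simp
    finally show ?thesis .
  qed
  have "(\<integral>\<^sup>+\<theta>\<in>{0..pi}. F \<theta> \<partial>lborel) \<le> (\<integral>\<^sup>+\<theta>\<in>{0..1/real n}. F \<theta> \<partial>lborel) + (\<integral>\<^sup>+\<theta>\<in>{1/real n..pi}. F \<theta> \<partial>lborel)"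
    by (intro set_nn_integral_Un_le) auto
  also have "(\<integral>\<^sup>+\<theta>\<in>{1/real n..pi}. F \<theta> \<partial>lborel) \<le> (\<integral>\<^sup>+\<theta>\<in>{1/real n..pi-1/real n}. F \<theta> \<partial>lborel) + (\<integral>\<^sup>+\<theta>\<in>{pi-1/real n..pi}. F \<theta> \<partial>lborel)"
    by (intro set_nn_integral_Un_le) auto
  finally have "(\<integral>\<^sup>+\<theta>\<in>{0..pi}. F \<theta> \<partial>lborel) \<le> (\<integral>\<^sup>+\<theta>\<in>{0..1/real n}. F \<theta> \<partial>lborel) + ((\<integral>\<^sup>+\<theta>\<in>{1/real n..pi-1/real n}. F \<theta> \<partial>lborel) + (\<integral>\<^sup>+\<theta>\<in>{pi-1/real n..pi}. F \<theta> \<partial>lborel))"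
    by (simp add: add_left_mono)
  also have "\<dots> \<le> ennreal (c powr p) * (\<integral>\<^sup>+\<theta>\<in>{0..pi}. G \<theta> \<partial>lborel) + (ennreal (c powr p) * (\<integral>\<^sup>+\<theta>\<in>{0..pi}. G \<theta> \<partial>lborel) + ennreal (c powr p) * (\<integral>\<^sup>+\<theta>\<in>{0..pi}. G \<theta> \<partial>lborel))"
    by (intro add_mono L M R)
  also have "\<dots> = (1 + (1 + 1)) * (ennreal (c powr p) * (\<integral>\<^sup>+\<theta>\<in>{0..pi}. G \<theta> \<partial>lborel))" unfolding distrib_right by simp
  also have "\<dots> = ennreal (3 * c powr p) * (\<integral>\<^sup>+\<theta>\<in>{0..pi}. G \<theta> \<partial>lborel)" by (simp add: ennreal_mult mult.assoc)
  also have "\<dots> \<le> ennreal ((3 powr (1/q) * c) powr p) * (\<integral>\<^sup>+\<theta>\<in>{0..pi}. G \<theta> \<partial>lborel)"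
  proof (intro mult_right_mono ennreal_leI)
    have "3 * c powr p \<le> (3 powr (1/q)) powr p * c powr p" using q by (intro mult_right_mono const_le_powr) auto
    then show "3 * c powr p \<le> (3 powr (1/q) * c) powr p" using c0 by (simp add: powr_mult)
  qed simp
  finally show ?thesis unfolding F_def G_def c_def .
qed

lemma ennreal_absorb:
  fixes X Y :: ennreal
  assumes "X \<le> Y + ennreal c * X" "X \<noteq> \<infinity>" "0 \<le> c" "c \<le> 1 / 2"
  shows "X \<le> 2 * Y"
proof (cases "Y = \<infinity>")
  case False
  obtain x where x: "X = ennreal x" "0 \<le> x" using assms(2) by (cases X) auto
  obtain y where y: "Y = ennreal y" "0 \<le> y" using False by (cases Y) auto
  have "ennreal x \<le> ennreal (y + c * x)" using assms x y by (simp add: ennreal_mult)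
  then have "x \<le> y + c * x" using x y assms by (subst (asm) ennreal_le_iff) auto
  moreover have "c * x \<le> (1/2) * x" using assms x by (intro mult_right_mono) auto
  ultimately have "x \<le> 2 * y" by simp
  then have "ennreal x \<le> ennreal (2 * y)" by (rule ennreal_leI)
  then show ?thesis using x y by (simp add: ennreal_mult)
qed (simp add: ennreal_mult_top)

text \<open>Near an endpoint, \<open>T\<close> is compared with its values at distance \<open>\<epsilon> / n\<close> further inside; the increment costs a
  factor \<open>\<epsilon>\<close> in front of \<open>B\<close>. A shift by a fixed amount, rather than a scaling, keeps the constants uniform in
  \<open>p\<close>.\<close>
lemma (in slow_majorant) shift_bound:
  assumes [measurable]: "T \<in> borel_measurable borel"
    and p: "0 < p" and \<Gamma>: "\<bar>g\<bar> \<le> \<Gamma>" "\<bar>g'\<bar> \<le> \<Gamma>" and \<epsilon>: "0 < \<epsilon>" "\<epsilon> \<le> 1"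
    and \<sigma>: "\<bar>\<sigma>\<bar> \<le> \<epsilon> / real n" and I: "{a..b} \<subseteq> {0..pi}" "{a+\<sigma>..b+\<sigma>} \<subseteq> {0..pi}"
  defines "v \<equiv> reg_weight n g g'"
  shows "power_integral p {a..b} (\<lambda>\<theta>. v \<theta> * \<bar>T \<theta>\<bar>)
    \<le> ennreal ((2 * 4 powr \<Gamma>) powr p) * power_integral p {a+\<sigma>..b+\<sigma>} (\<lambda>\<theta>. v \<theta> * \<bar>T \<theta>\<bar>)
     + ennreal ((2 * \<epsilon>) powr p) * power_integral p {0..pi} (\<lambda>\<theta>. v \<theta> * B \<theta>)"
proof -
  have n: "1 \<le> real n" using n_ge by simp
  have [measurable]: "v \<in> borel_measurable borel" unfolding v_def by measurable
  have v0: "v \<theta> \<ge> 0" for \<theta> unfolding v_def reg_weight_def by simp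
  define F where "F \<theta> = ennreal ((v \<theta> * \<bar>T \<theta>\<bar>) powr p)" for \<theta>
  define G where "G \<theta> = ennreal ((v \<theta> * B \<theta>) powr p)" for \<theta>
  have [measurable]: "F \<in> borel_measurable borel" "G \<in> borel_measurable borel" unfolding F_def G_def by measurable
  have pt: "F \<tau> \<le> ennreal ((2 * 4 powr \<Gamma>) powr p) * F (\<tau> + \<sigma>) + ennreal ((2 * \<epsilon>) powr p) * G \<tau>" if \<tau>: "\<tau> \<in> {a..b}" for \<tau>
  proof -
    have in1: "\<tau> \<in> {0..pi}" using I \<tau> by blast
    have in2: "\<tau> + \<sigma> \<in> {0..pi}" using I \<tau> by (subst atLeastAtMost_iff) (auto simp: subset_iff)
    have near: "\<bar>\<tau> - (\<tau> + \<sigma>)\<bar> \<le> 1 / real n" using \<sigma> \<epsilon> n by (simp add: order.trans[OF \<sigma>] divide_right_mono)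
    have "\<bar>T \<tau> - T (\<tau> + \<sigma>)\<bar> \<le> real n * \<bar>\<tau> - (\<tau> + \<sigma>)\<bar> * B \<tau>" by (rule T_lipschitz[OF in1 in2 near])
    also have "\<dots> \<le> \<epsilon> * B \<tau>" using \<sigma> n by (intro mult_right_mono B_nonneg) (simp add: field_simps)
    finally have "\<bar>T \<tau>\<bar> \<le> \<bar>T (\<tau> + \<sigma>)\<bar> + \<epsilon> * B \<tau>" by linarith
    then have "v \<tau> * \<bar>T \<tau>\<bar> \<le> v \<tau> * (\<bar>T (\<tau> + \<sigma>)\<bar> + \<epsilon> * B \<tau>)" by (intro mult_left_mono v0)
    also have "\<dots> = v \<tau> * \<bar>T (\<tau> + \<sigma>)\<bar> + \<epsilon> * (v \<tau> * B \<tau>)" by (simp add: algebra_simps)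
    also have "v \<tau> * \<bar>T (\<tau> + \<sigma>)\<bar> \<le> (4 powr \<Gamma> * v (\<tau> + \<sigma>)) * \<bar>T (\<tau> + \<sigma>)\<bar>"
      unfolding v_def using n_ge near in1 in2 \<Gamma> by (intro mult_right_mono reg_weight_near) auto
    finally have "(v \<tau> * \<bar>T \<tau>\<bar>) powr p \<le> ((4 powr \<Gamma> * v (\<tau> + \<sigma>)) * \<bar>T (\<tau> + \<sigma>)\<bar> + \<epsilon> * (v \<tau> * B \<tau>)) powr p"
      using p v0 by (intro powr_mono2) auto
    also have "\<dots> \<le> 2 powr p * (((4 powr \<Gamma> * v (\<tau> + \<sigma>)) * \<bar>T (\<tau> + \<sigma>)\<bar>) powr p + (\<epsilon> * (v \<tau> * B \<tau>)) powr p)"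
      using p v0 B_nonneg \<epsilon> by (intro powr_add_le) auto
    also have "\<dots> = (2 * 4 powr \<Gamma>) powr p * (v (\<tau> + \<sigma>) * \<bar>T (\<tau> + \<sigma>)\<bar>) powr p + (2 * \<epsilon>) powr p * (v \<tau> * B \<tau>) powr p"
      using v0 B_nonneg \<epsilon> by (simp add: powr_mult algebra_simps)
    finally show ?thesis unfolding F_def G_def by (simp add: ennreal_mult[symmetric] ennreal_plus[symmetric] ennreal_leI del: ennreal_plus)
  qed
  have "(\<integral>\<^sup>+\<theta>\<in>{a..b}. F \<theta> \<partial>lborel) \<le> (\<integral>\<^sup>+\<theta>\<in>{a..b}. ennreal ((2 * 4 powr \<Gamma>) powr p) * F (\<theta> + \<sigma>) + ennreal ((2 * \<epsilon>) powr p) * G \<theta> \<partial>lborel)"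
    by (intro set_nn_integral_le pt)
  also have "\<dots> = ennreal ((2 * 4 powr \<Gamma>) powr p) * (\<integral>\<^sup>+\<theta>\<in>{a..b}. F (\<theta> + \<sigma>) \<partial>lborel) + ennreal ((2 * \<epsilon>) powr p) * (\<integral>\<^sup>+\<theta>\<in>{a..b}. G \<theta> \<partial>lborel)"
    by (subst set_nn_integral_add) (auto simp: set_nn_integral_cmult)
  also have "(\<integral>\<^sup>+\<theta>\<in>{a..b}. F (\<theta> + \<sigma>) \<partial>lborel) = (\<integral>\<^sup>+\<theta>\<in>{a+\<sigma>..b+\<sigma>}. F \<theta> \<partial>lborel)"
    by (subst (2) set_nn_integral_affine[where t = \<sigma> and c = 1]) (auto simp: add.commute intro!: nn_integral_cong split: split_indicator)
  also have "(\<integral>\<^sup>+\<theta>\<in>{a..b}. G \<theta> \<partial>lborel) \<le> (\<integral>\<^sup>+\<theta>\<in>{0..pi}. G \<theta> \<partial>lborel)"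
    by (intro set_nn_integral_subset I)
  finally show ?thesis unfolding F_def G_def by (simp add: add_left_mono mult_left_mono)
qed

text \<open>A Remez inequality: the end pieces are shifted inside by \<open>shift_bound\<close>, and the choice of \<open>\<epsilon>\<close> makes the
  terms with \<open>B\<close> small enough to be absorbed by the left-hand side, which is finite.\<close>
lemma (in slow_majorant) reg_weight_remez:
  assumes [measurable]: "T \<in> borel_measurable borel"
    and q: "0 < q" "q \<le> p" and \<Gamma>: "\<bar>g\<bar> \<le> \<Gamma>" "\<bar>g'\<bar> \<le> \<Gamma>" and \<epsilon>: "0 < \<epsilon>" "\<epsilon> \<le> 1 / 2"
  defines "v \<equiv> reg_weight n g g'"
  assumes A: "power_integral p {0..pi} (\<lambda>\<theta>. v \<theta> * B \<theta>) \<le> ennreal (A powr p) * power_integral p {0..pi} (\<lambda>\<theta>. v \<theta> * \<bar>T \<theta>\<bar>)"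
    and A0: "0 \<le> A" and \<epsilon>A: "2 * \<epsilon> * A \<le> (1/8) powr (1/q)"
    and fin: "power_integral p {0..pi} (\<lambda>\<theta>. v \<theta> * \<bar>T \<theta>\<bar>) \<noteq> \<infinity>"
  shows "power_integral p {0..pi} (\<lambda>\<theta>. v \<theta> * \<bar>T \<theta>\<bar>)
    \<le> ennreal ((6 powr (1/q) * (2 * 4 powr \<Gamma>)) powr p) *
       power_integral p {\<epsilon>/real n..pi-\<epsilon>/real n} (\<lambda>\<theta>. v \<theta> * \<bar>T \<theta>\<bar>)"
proof -
  have n: "1 \<le> real n" using n_ge by simp
  define F where "F \<theta> = ennreal ((v \<theta> * \<bar>T \<theta>\<bar>) powr p)" for \<theta>
  have [measurable]: "v \<in> borel_measurable borel" unfolding v_def by measurable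
  have [measurable]: "F \<in> borel_measurable borel" unfolding F_def by measurable
  define s where "s = \<epsilon> / real n"
  define X where "X = (\<integral>\<^sup>+\<theta>\<in>{0..pi}. F \<theta> \<partial>lborel)"
  define K where "K = (\<integral>\<^sup>+\<theta>\<in>{s..pi-s}. F \<theta> \<partial>lborel)"
  define c where "c = (2 * 4 powr \<Gamma>) powr p"
  have p: "p > 0" using q by linarith
  have \<Gamma>0: "\<Gamma> \<ge> 0" using \<Gamma> by linarith
  have "1 * 1 \<le> 2 * 4 powr \<Gamma>" using \<Gamma>0 by (intro mult_mono ge_one_powr_ge_zero) auto
  then have c1: "c \<ge> 1" unfolding c_def using p by (intro ge_one_powr_ge_zero) auto
  have s: "0 < s" "s \<le> 1 / 2" using \<epsilon> n by (auto simp: s_def field_simps)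
  have err: "ennreal ((2 * \<epsilon>) powr p) * power_integral p {0..pi} (\<lambda>\<theta>. v \<theta> * B \<theta>) \<le> ennreal (1/8) * X"
  proof -
    have "ennreal ((2 * \<epsilon>) powr p) * power_integral p {0..pi} (\<lambda>\<theta>. v \<theta> * B \<theta>) \<le> ennreal ((2 * \<epsilon>) powr p) * (ennreal (A powr p) * X)"
      unfolding X_def F_def by (intro mult_left_mono A) auto
    also have "\<dots> = ennreal ((2 * \<epsilon> * A) powr p) * X" using \<epsilon> A0 by (simp add: powr_mult ennreal_mult mult.assoc)
    also have "\<dots> \<le> ennreal (1/8) * X"
    proof (intro mult_right_mono ennreal_leI)
      have "(2 * \<epsilon> * A) powr p \<le> ((1/8) powr (1/q)) powr p" using \<epsilon> A0 \<epsilon>A p by (intro powr_mono2) auto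
      also have "\<dots> = (1/8) powr (p / q)" by (simp add: powr_powr)
      also have "\<dots> \<le> (1/8) powr 1" using q by (intro powr_mono') auto
      finally show "(2 * \<epsilon> * A) powr p \<le> 1/8" by simp
    qed simp
    finally show ?thesis .
  qed
  have shift: "(\<integral>\<^sup>+\<theta>\<in>{a..b}. F \<theta> \<partial>lborel) \<le> ennreal c * K + ennreal (1/8) * X"
    if "\<bar>\<sigma>\<bar> \<le> s" "{a..b} \<subseteq> {0..pi}" "{a+\<sigma>..b+\<sigma>} \<subseteq> {s..pi-s}" for a b \<sigma>
  proof -
    have "{a+\<sigma>..b+\<sigma>} \<subseteq> {0..pi}" using that(3) s by (auto simp: subset_iff)
    then have "(\<integral>\<^sup>+\<theta>\<in>{a..b}. F \<theta> \<partial>lborel) \<le> ennreal c * (\<integral>\<^sup>+\<theta>\<in>{a+\<sigma>..b+\<sigma>}. F \<theta> \<partial>lborel) + ennreal ((2 * \<epsilon>) powr p) * power_integral p {0..pi} (\<lambda>\<theta>. v \<theta> * B \<theta>)"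
      unfolding F_def c_def v_def using that \<epsilon> unfolding s_def by (intro shift_bound p \<Gamma>) auto
    also have "\<dots> \<le> ennreal c * K + ennreal (1/8) * X"
      unfolding K_def by (intro add_mono mult_left_mono set_nn_integral_subset that err) auto
    finally show ?thesis .
  qed
  have "X \<le> (\<integral>\<^sup>+\<theta>\<in>{0..s}. F \<theta> \<partial>lborel) + (\<integral>\<^sup>+\<theta>\<in>{s..pi}. F \<theta> \<partial>lborel)"
    unfolding X_def by (intro set_nn_integral_Un_le) auto
  also have "(\<integral>\<^sup>+\<theta>\<in>{s..pi}. F \<theta> \<partial>lborel) \<le> K + (\<integral>\<^sup>+\<theta>\<in>{pi-s..pi}. F \<theta> \<partial>lborel)"
    unfolding K_def by (intro set_nn_integral_Un_le) auto
  finally have "X \<le> (\<integral>\<^sup>+\<theta>\<in>{0..s}. F \<theta> \<partial>lborel) + (K + (\<integral>\<^sup>+\<theta>\<in>{pi-s..pi}. F \<theta> \<partial>lborel))"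
    by (simp add: add_left_mono)
  also have "\<dots> \<le> (ennreal c * K + ennreal (1/8) * X) + (ennreal c * K + (ennreal c * K + ennreal (1/8) * X))"
  proof (intro add_mono)
    show "(\<integral>\<^sup>+\<theta>\<in>{0..s}. F \<theta> \<partial>lborel) \<le> ennreal c * K + ennreal (1/8) * X"
      by (rule shift[of s]) (use s pi_gt3 in auto)
    show "(\<integral>\<^sup>+\<theta>\<in>{pi-s..pi}. F \<theta> \<partial>lborel) \<le> ennreal c * K + ennreal (1/8) * X"
      by (rule shift[of "-s"]) (use s pi_gt3 in auto)
    show "K \<le> ennreal c * K" using c1 mult_right_mono[of 1 "ennreal c" K] by simp
  qed
  also have "\<dots> = (1 + 1 + 1) * (ennreal c * K) + (1 + 1) * (ennreal (1/8) * X)" unfolding distrib_right by (simp add: add_ac)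
  also have "\<dots> = ennreal (3 * c) * K + ennreal (1/4) * X"
  proof -
    have "(1 + 1 + 1 :: ennreal) * ennreal c = ennreal (3 * c)" using c1 by (simp add: ennreal_mult)
    moreover have "(1 + 1 :: ennreal) * ennreal (1/8) = ennreal (1/4)"
      using ennreal_mult[of 2 "1/8"] by simp
    ultimately show ?thesis by (simp only: mult.assoc[symmetric])
  qed
  finally have "X \<le> 2 * (ennreal (3 * c) * K)"
    by (rule ennreal_absorb) (use fin in \<open>auto simp: X_def F_def\<close>)
  also have "\<dots> = ennreal (6 * c) * K" using c1 by (simp add: ennreal_mult mult.assoc[symmetric])
  also have "\<dots> \<le> ennreal ((6 powr (1/q) * (2 * 4 powr \<Gamma>)) powr p) * K"
  proof (intro mult_right_mono ennreal_leI)
    have "6 * c \<le> (6 powr (1/q)) powr p * c" using q c1 by (intro mult_right_mono const_le_powr) auto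
    then show "6 * c \<le> (6 powr (1/q) * (2 * 4 powr \<Gamma>)) powr p" by (simp add: powr_mult c_def)
  qed simp
  finally show ?thesis unfolding X_def K_def F_def s_def .
qed

text \<open>The constants are fixed in this order: \<open>L\<close> so large that the kernel beats the weights, then the constant \<open>A\<close>
  of \<open>reg_weight_energy_le\<close>, then \<open>\<epsilon>\<close> in terms of \<open>A\<close>. The function \<open>B\<close> is the same for all exponents \<open>p\<close> and
  all weights.\<close>
theorem slow_majorant_exists:
  fixes q \<Gamma> :: real
  assumes q: "0 < q" "q \<le> 1" and \<Gamma>: "0 \<le> \<Gamma>"
  shows "\<exists>C \<epsilon>. 1 \<le> C \<and> 0 < \<epsilon> \<and> \<epsilon> \<le> 1 / 2 \<and> (\<forall>n Q. 1 \<le> n \<longrightarrow> degree Q \<le> n \<longrightarrow>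
    (\<exists>B. slow_majorant n C (\<lambda>\<tau>. poly Q (- cos \<tau>)) B \<and>
      (\<forall>p\<ge>q. \<forall>g g'. \<bar>g\<bar> \<le> \<Gamma> \<longrightarrow> \<bar>g'\<bar> \<le> \<Gamma> \<longrightarrow> q \<le> g * p + 1 \<longrightarrow> q \<le> g' * p + 1 \<longrightarrow>
        power_integral p {0..pi} (\<lambda>\<theta>. arc_weight g g' \<theta> * B \<theta>)
         \<le> ennreal (C powr p) * power_integral p {\<epsilon>/real n..pi-\<epsilon>/real n} (\<lambda>\<theta>. arc_weight g g' \<theta> * \<bar>poly Q (- cos \<theta>)\<bar>))))"
proof -
  obtain L :: nat where L: "2 * \<Gamma> * q + 2 \<le> 2 * real L * q"
  proof -
    obtain L :: nat where "(2 * \<Gamma> * q + 2) / (2 * q) \<le> real L" using real_arch_simple by blast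
    then show ?thesis using q that[of L] by (simp add: field_simps)
  qed
  define M where "M = 2 * real L * q"
  have M: "2 * \<Gamma> * q + 2 \<le> M" using L by (simp add: M_def)
  have M0: "M \<ge> 0" using q by (simp add: M_def)
  obtain C0 where C0: "1 \<le> C0" and pw: "\<And>n Q \<tau> \<tau>'. 1 \<le> n \<Longrightarrow> degree Q \<le> n \<Longrightarrow> \<tau> \<in> {0..pi} \<Longrightarrow> \<tau>' \<in> {0..pi} \<Longrightarrow>
     \<bar>poly Q (- cos \<tau>)\<bar> \<le> C0 * local_energy q M Q (real n) \<tau> powr (1/q) \<and>
     (\<bar>\<tau> - \<tau>'\<bar> \<le> 1 / real n \<longrightarrow>
       \<bar>poly Q (- cos \<tau>) - poly Q (- cos \<tau>')\<bar> \<le> C0 * (real n * \<bar>\<tau> - \<tau>'\<bar>) * local_energy q M Q (real n) \<tau> powr (1/q))"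
    using poly_le_local_energy[OF q, of L] unfolding M_def by blast
  define D where "D = (2 powr M) powr (1/q)"
  have D: "1 \<le> D" unfolding D_def using M0 q by (intro ge_one_powr_ge_zero) auto
  define A where "A = C0 * (2 powr (1/q) * 4 powr (1/q))"
  have A: "0 < A" using C0 by (simp add: A_def)
  \<comment> \<open>Small enough for the factor \<open>1 / 8\<close> that the absorption of two end pieces requires, after taking powers with
    any exponent \<open>p \<ge> q\<close>.\<close>
  define \<epsilon> where "\<epsilon> = min (1/2) ((1/8) powr (1/q) / (2 * A))"
  have \<epsilon>: "0 < \<epsilon>" "\<epsilon> \<le> 1/2" using A by (auto simp: \<epsilon>_def)
  have \<epsilon>A: "2 * \<epsilon> * A \<le> (1/8) powr (1/q)"
  proof -
    have "\<epsilon> \<le> (1/8) powr (1/q) / (2 * A)" by (simp add: \<epsilon>_def)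
    then show ?thesis using A by (simp add: field_simps)
  qed
  define c1 where "c1 = 3 powr (1/q) * (4 powr \<Gamma> * (4 powr \<Gamma> * D) * (1/q) powr (1/q))"
  define c3 where "c3 = 6 powr (1/q) * (2 * 4 powr \<Gamma>)"
  define c4 where "c4 = (1 + 1/\<epsilon>) powr (2 * \<Gamma>)"
  define C where "C = max (max 1 D) (c1 * A * c3 * c4)"
  have pos: "0 \<le> c1" "0 \<le> c3" "0 \<le> c4" using D by (auto simp: c1_def c3_def c4_def)
  have C1: "1 \<le> C" "D \<le> C" "c1 * A * c3 * c4 \<le> C" by (auto simp: C_def)
  show ?thesis
  proof (rule exI[of _ C], rule exI[of _ \<epsilon>], intro conjI allI impI C1 \<epsilon>)
    fix n :: nat and Q :: "real poly" assume n: "1 \<le> n" and Q: "degree Q \<le> n"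
    define T where "T \<theta> = poly Q (- cos \<theta>)" for \<theta>
    define B where "B \<theta> = C0 * local_energy q M Q (real n) \<theta> powr (1/q)" for \<theta>
    have [measurable]: "T \<in> borel_measurable borel" unfolding T_def by measurable
    have [measurable]: "local_energy q M Q (real n) \<in> borel_measurable borel" using q by (intro measurable_local_energy) auto
    have Bm[measurable]: "B \<in> borel_measurable borel" unfolding B_def by measurable
    have B0: "0 \<le> B \<theta>" for \<theta> using C0 by (simp add: B_def)
    have lip: "\<bar>T \<tau> - T \<tau>'\<bar> \<le> real n * \<bar>\<tau> - \<tau>'\<bar> * B \<tau>" if "\<tau> \<in> {0..pi}" "\<tau>' \<in> {0..pi}" "\<bar>\<tau> - \<tau>'\<bar> \<le> 1 / real n" for \<tau> \<tau>'
      using pw[OF n Q that(1,2)] that(3) by (simp add: T_def B_def mult_ac)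
    have slow: "B \<tau> \<le> D * B \<tau>'" if "\<bar>\<tau> - \<tau>'\<bar> \<le> 1 / real n" for \<tau> \<tau>'
    proof -
      have "local_energy q M Q (real n) \<tau> powr (1/q) \<le> (2 powr M * local_energy q M Q (real n) \<tau>') powr (1/q)"
        using q n M0 that by (intro powr_mono2 local_energy_slow local_energy_nonneg) auto
      also have "\<dots> = D * local_energy q M Q (real n) \<tau>' powr (1/q)"
        using q by (simp add: powr_mult D_def local_energy_nonneg)
      finally show ?thesis using C0 by (simp add: B_def mult_left_mono mult.left_commute)
    qed
    interpret slow_majorant n D T B
      by unfold_locales (use n D B0 lip slow pw[OF n Q] in \<open>auto simp: B_def T_def\<close>)
    have "slow_majorant n C (\<lambda>\<tau>. poly Q (- cos \<tau>)) B"
    proof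
      show "B \<tau> \<le> C * B \<tau>'" if "\<tau> \<in> {0..pi}" "\<tau>' \<in> {0..pi}" "\<bar>\<tau> - \<tau>'\<bar> \<le> 1 / real n" for \<tau> \<tau>'
        using B_slow[OF that] mult_right_mono[OF C1(2) B0[of \<tau>']] by linarith
    qed (use n C1 B0 T_le T_lipschitz in \<open>auto simp: T_def\<close>)
    moreover have "power_integral p {0..pi} (\<lambda>\<theta>. arc_weight g g' \<theta> * B \<theta>)
         \<le> ennreal (C powr p) * power_integral p {\<epsilon>/real n..pi-\<epsilon>/real n} (\<lambda>\<theta>. arc_weight g g' \<theta> * \<bar>poly Q (- cos \<theta>)\<bar>)"
      if p: "q \<le> p" and g\<Gamma>: "\<bar>g\<bar> \<le> \<Gamma>" "\<bar>g'\<bar> \<le> \<Gamma>" and g: "q \<le> g * p + 1" "q \<le> g' * p + 1" for p g g'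
    proof -
      define X where "X = power_integral p {0..pi} (\<lambda>\<theta>. reg_weight n g g' \<theta> * \<bar>T \<theta>\<bar>)"
      have p0: "p > 0" using p q by linarith
      have n1: "1 \<le> real n" using n by simp
      have "power_integral p {0..pi} (\<lambda>\<theta>. reg_weight n g g' \<theta> * B \<theta>)
         \<le> ennreal (C0 powr p) * power_integral p {0..pi} (\<lambda>\<theta>. reg_weight n g g' \<theta> * local_energy q M Q n \<theta> powr (1/q))"
        using C0 p0 by (intro set_nn_integral_powr_le) (auto simp: B_def reg_weight_def mult_ac)
      also have "\<dots> \<le> ennreal (C0 powr p) * (ennreal (2 * 4 powr (p/q)) * X)"
        unfolding X_def T_def using n by (intro mult_left_mono reg_weight_energy_le[where \<Gamma> = \<Gamma>] q p g\<Gamma> M) auto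
      also have "\<dots> = ennreal (C0 powr p * (2 * 4 powr (p/q))) * X" by (simp add: ennreal_mult mult.assoc)
      also have "\<dots> \<le> ennreal (A powr p) * X"
      proof (intro mult_right_mono ennreal_leI)
        have "2 * 4 powr (p/q) \<le> (2 powr (1/q)) powr p * (4 powr (1/q)) powr p"
          using q p by (intro mult_mono const_le_powr) (auto simp: powr_powr)
        then have "C0 powr p * (2 * 4 powr (p/q)) \<le> C0 powr p * ((2 powr (1/q)) powr p * (4 powr (1/q)) powr p)"
          by (intro mult_left_mono) auto
        then show "C0 powr p * (2 * 4 powr (p/q)) \<le> A powr p" using C0 by (simp add: A_def powr_mult)
      qed simp
      finally have regB: "power_integral p {0..pi} (\<lambda>\<theta>. reg_weight n g g' \<theta> * B \<theta>) \<le> ennreal (A powr p) * X" .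
      have fin: "X \<noteq> \<infinity>"
      proof -
        have c: "continuous_on {0..pi} (\<lambda>\<theta>. (reg_weight n g g' \<theta> * \<bar>T \<theta>\<bar>) powr p)"
          using p0 n1 by (intro continuous_on_powr')
            (auto simp: reg_weight_def T_def add_nonneg_eq_0_iff intro!: continuous_intros)
        have "X = ennreal (integral {0..pi} (\<lambda>\<theta>. (reg_weight n g g' \<theta> * \<bar>T \<theta>\<bar>) powr p))"
          unfolding X_def by (intro nn_integral_has_integral_lebesgue' integrable_integral integrable_continuous_interval c) auto
        then show ?thesis by simp
      qed
      have "power_integral p {0..pi} (\<lambda>\<theta>. arc_weight g g' \<theta> * B \<theta>)
         \<le> ennreal (c1 powr p) * power_integral p {0..pi} (\<lambda>\<theta>. reg_weight n g g' \<theta> * B \<theta>)"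
        unfolding c1_def by (rule arc_weight_le_reg_weight_norm[OF q p g\<Gamma> g])
      also have "\<dots> \<le> ennreal (c1 powr p) * (ennreal (A powr p) * X)" by (intro mult_left_mono regB) auto
      also have "X \<le> ennreal (c3 powr p) * power_integral p {\<epsilon>/n..pi-\<epsilon>/n} (\<lambda>\<theta>. reg_weight n g g' \<theta> * \<bar>T \<theta>\<bar>)"
        unfolding X_def c3_def using A
        by (intro reg_weight_remez[where A = A] q p g\<Gamma> \<epsilon> \<epsilon>A regB[unfolded X_def] fin[unfolded X_def]) auto
      also have "power_integral p {\<epsilon>/n..pi-\<epsilon>/n} (\<lambda>\<theta>. reg_weight n g g' \<theta> * \<bar>T \<theta>\<bar>)
         \<le> ennreal (c4 powr p) * power_integral p {\<epsilon>/n..pi-\<epsilon>/n} (\<lambda>\<theta>. arc_weight g g' \<theta> * \<bar>T \<theta>\<bar>)"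
      proof (rule set_nn_integral_powr_le)
        fix \<theta> assume \<theta>: "\<theta> \<in> {\<epsilon>/n..pi-\<epsilon>/n}"
        have "reg_weight n g g' \<theta> * \<bar>T \<theta>\<bar> \<le> (c4 * arc_weight g g' \<theta>) * \<bar>T \<theta>\<bar>"
          unfolding c4_def using \<theta> by (intro mult_right_mono reg_weight_le_arc_weight n1 \<epsilon> g\<Gamma>) auto
        then show "0 \<le> reg_weight n g g' \<theta> * \<bar>T \<theta>\<bar> \<and> reg_weight n g g' \<theta> * \<bar>T \<theta>\<bar> \<le> c4 * (arc_weight g g' \<theta> * \<bar>T \<theta>\<bar>)"
          by (auto simp: reg_weight_def mult.assoc)
      qed (use p0 pos arc_weight_nonneg in auto)
      finally have "power_integral p {0..pi} (\<lambda>\<theta>. arc_weight g g' \<theta> * B \<theta>)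
         \<le> ennreal (c1 powr p) * (ennreal (A powr p) * (ennreal (c3 powr p) * (ennreal (c4 powr p) * power_integral p {\<epsilon>/n..pi-\<epsilon>/n} (\<lambda>\<theta>. arc_weight g g' \<theta> * \<bar>T \<theta>\<bar>))))"
        by (simp add: mult_left_mono)
      also have "\<dots> = ennreal ((c1 * A * c3 * c4) powr p) * power_integral p {\<epsilon>/n..pi-\<epsilon>/n} (\<lambda>\<theta>. arc_weight g g' \<theta> * \<bar>T \<theta>\<bar>)"
        using pos A by (simp add: powr_mult ennreal_mult mult.assoc)
      also have "\<dots> \<le> ennreal (C powr p) * power_integral p {\<epsilon>/n..pi-\<epsilon>/n} (\<lambda>\<theta>. arc_weight g g' \<theta> * \<bar>T \<theta>\<bar>)"
        using pos A C1 p0 by (intro mult_right_mono ennreal_leI powr_mono2) auto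
      finally show ?thesis by (simp add: T_def)
    qed
    ultimately show "\<exists>B. slow_majorant n C (\<lambda>\<tau>. poly Q (- cos \<tau>)) B \<and>
      (\<forall>p\<ge>q. \<forall>g g'. \<bar>g\<bar> \<le> \<Gamma> \<longrightarrow> \<bar>g'\<bar> \<le> \<Gamma> \<longrightarrow> q \<le> g * p + 1 \<longrightarrow> q \<le> g' * p + 1 \<longrightarrow>
        power_integral p {0..pi} (\<lambda>\<theta>. arc_weight g g' \<theta> * B \<theta>)
         \<le> ennreal (C powr p) * power_integral p {\<epsilon>/real n..pi-\<epsilon>/real n} (\<lambda>\<theta>. arc_weight g g' \<theta> * \<bar>poly Q (- cos \<theta>)\<bar>))"
      by blast
  qed
qed

section \<open>Norms with exponents from 0 to infinity\<close>

lemma nn_integral_lebesgue_on: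
  assumes "S \<in> sets borel"
  shows "(\<integral>\<^sup>+x. f x \<partial>lebesgue_on S) = (\<integral>\<^sup>+x\<in>S. f x \<partial>lborel)"
  using assms by (subst nn_integral_restrict_space) (auto simp: nn_integral_completion)

lemma Lp_norm_finite:
  fixes g :: "real \<Rightarrow> real"
  assumes "p \<noteq> \<infinity>" "S \<in> sets borel"
  defines "P \<equiv> enn2real p" and "I \<equiv> power_integral (enn2real p) S (\<lambda>x. \<bar>g x\<bar>)"
  shows "Lp_norm p S g = (if I = \<infinity> then \<infinity> else ennreal (enn2real I powr (1 / P)))"
  using assms(1) unfolding Lp_norm_def Let_def nn_integral_lebesgue_on[OF assms(2)] P_def I_def by simp

lemma Lp_norm_le_of_integral_le:
  assumes p: "p \<noteq> \<infinity>" "0 < p" and [simp]: "S \<in> sets borel" "S' \<in> sets borel" and c: "0 < c"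
    and le: "power_integral (enn2real p) S (\<lambda>x. \<bar>f x\<bar>) \<le> ennreal (c powr enn2real p) * power_integral (enn2real p) S' (\<lambda>x. \<bar>g x\<bar>)"
  shows "Lp_norm p S f \<le> ennreal c * Lp_norm p S' g"
proof -
  define P where "P = enn2real p"
  have P: "P > 0" using p by (simp add: P_def enn2real_positive_iff less_top)
  define I where "I = power_integral P S (\<lambda>x. \<bar>f x\<bar>)"
  define J where "J = power_integral P S' (\<lambda>x. \<bar>g x\<bar>)"
  have IJ: "I \<le> ennreal (c powr P) * J" using le by (simp add: I_def J_def P_def)
  have NI: "Lp_norm p S f = (if I = \<infinity> then \<infinity> else ennreal (enn2real I powr (1 / P)))"
    unfolding I_def P_def using p by (intro Lp_norm_finite) auto
  have NJ: "Lp_norm p S' g = (if J = \<infinity> then \<infinity> else ennreal (enn2real J powr (1 / P)))"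
    unfolding J_def P_def using p by (intro Lp_norm_finite) auto
  show ?thesis
  proof (cases "J = \<infinity>")
    case True
    then show ?thesis using c by (simp add: NJ ennreal_mult_top)
  next
    case False
    then obtain j where j: "J = ennreal j" "0 \<le> j" by (cases J) auto
    have "I \<le> ennreal (c powr P * j)" using IJ j by (simp add: ennreal_mult')
    moreover from this have "I \<noteq> \<infinity>" by (metis ennreal_less_top infinity_ennreal_def leD)
    ultimately have "I \<noteq> \<infinity>" "enn2real I \<le> c powr P * j"
      using j by (auto intro: enn2real_leI)
    then have "enn2real I powr (1 / P) \<le> (c powr P * j) powr (1 / P)"
      using P by (intro powr_mono2) auto
    also have "\<dots> = c * j powr (1 / P)" using P c j by (simp add: powr_mult powr_powr)
    finally show ?thesis using \<open>I \<noteq> \<infinity>\<close> False j c by (simp add: NI NJ ennreal_mult'[symmetric] ennreal_leI)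
  qed
qed

lemma measurable_lebesgue_on[measurable_dest]:
  assumes "f \<in> borel_measurable borel"
  shows "f \<in> borel_measurable (lebesgue_on S)"
  using assms by (intro measurable_restrict_space1 measurable_completion) (simp add: )

lemma AE_lebesgue_on_subset:
  assumes "AE x in lebesgue_on S'. R x" "S \<subseteq> S'" "S \<in> sets borel" "S' \<in> sets borel"
  shows "AE x in lebesgue_on S. R x"
  using assms by (subst AE_restrict_space_iff; (subst (asm) AE_restrict_space_iff)?) auto

lemma Lp_norm_mono:
  assumes p: "0 < p" and [measurable]: "f \<in> borel_measurable borel" "g \<in> borel_measurable borel"
    and [simp]: "S \<in> sets borel" "S' \<in> sets borel" and S: "S \<subseteq> S'" and c: "0 < c"
    and le: "\<And>x. x \<in> S \<Longrightarrow> \<bar>f x\<bar> \<le> c * \<bar>g x\<bar>"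
  shows "Lp_norm p S f \<le> ennreal c * Lp_norm p S' g"
proof (cases "p = \<infinity>")
  case True
  have "AE x in lebesgue_on S'. ennreal \<bar>g x\<bar> \<le> esssup (lebesgue_on S') (\<lambda>x. ennreal \<bar>g x\<bar>)"
    by (rule esssup_AE)
  then have "AE x in lebesgue_on S. ennreal \<bar>g x\<bar> \<le> esssup (lebesgue_on S') (\<lambda>x. ennreal \<bar>g x\<bar>)"
    by (rule AE_lebesgue_on_subset) (use S in auto)
  moreover have "AE x in lebesgue_on S. x \<in> S" by (rule AE_I2) simp
  ultimately have "AE x in lebesgue_on S. ennreal \<bar>f x\<bar> \<le> ennreal c * esssup (lebesgue_on S') (\<lambda>x. ennreal \<bar>g x\<bar>)"
  proof eventually_elim
    case (elim x)
    have "ennreal \<bar>f x\<bar> \<le> ennreal c * ennreal \<bar>g x\<bar>"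
      using le[OF elim(2)] c by (simp add: ennreal_mult'[symmetric] ennreal_leI)
    also have "\<dots> \<le> ennreal c * esssup (lebesgue_on S') (\<lambda>x. ennreal \<bar>g x\<bar>)" by (intro mult_left_mono elim) simp
    finally show ?case .
  qed
  then show ?thesis using True unfolding Lp_norm_def
    by (simp, intro esssup_I) (auto intro!: measurable_lebesgue_on)
next
  case False
  show ?thesis
  proof (rule Lp_norm_le_of_integral_le[OF False p _ _ c])
    have P: "0 \<le> enn2real p" by simp
    have "power_integral (enn2real p) S (\<lambda>x. \<bar>f x\<bar>) \<le> ennreal (c powr enn2real p) * power_integral (enn2real p) S (\<lambda>x. \<bar>g x\<bar>)"
      using c le by (intro set_nn_integral_powr_le) auto
    also have "\<dots> \<le> ennreal (c powr enn2real p) * power_integral (enn2real p) S' (\<lambda>x. \<bar>g x\<bar>)"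
      by (intro mult_left_mono set_nn_integral_subset S) auto
    finally show "power_integral (enn2real p) S (\<lambda>x. \<bar>f x\<bar>) \<le> ennreal (c powr enn2real p) * power_integral (enn2real p) S' (\<lambda>x. \<bar>g x\<bar>)" .
  qed auto
qed

text \<open>One constant for all \<open>p\<close> with \<open>q \<le> p\<close>, including \<open>p = \<infinity>\<close> and the quasi-norms with \<open>p < 1\<close>.\<close>
lemma Lp_norm_triangle:
  assumes p: "0 < p" "0 < q" "ennreal q \<le> p"
    and [measurable]: "f \<in> borel_measurable borel" "g \<in> borel_measurable borel" "h \<in> borel_measurable borel"
    and [simp]: "S \<in> sets borel"
    and le: "\<And>x. x \<in> S \<Longrightarrow> \<bar>f x\<bar> \<le> \<bar>g x\<bar> + \<bar>h x\<bar>"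
  shows "Lp_norm p S f \<le> ennreal (4 powr (1/q) * 2) * (Lp_norm p S g + Lp_norm p S h)"
proof -
  have four: "1 \<le> 4 powr (1/q)" using p by (intro ge_one_powr_ge_zero) auto
  then have K: "2 \<le> 4 powr (1/q) * 2" by simp
  have max: "\<bar>f x\<bar> \<le> 2 * \<bar>max \<bar>g x\<bar> \<bar>h x\<bar>\<bar>" if "x \<in> S" for x using le[OF that] by auto
  show ?thesis
  proof (cases "p = \<infinity>")
    case True
    have "AE x in lebesgue_on S. ennreal \<bar>g x\<bar> \<le> esssup (lebesgue_on S) (\<lambda>x. ennreal \<bar>g x\<bar>)"
      "AE x in lebesgue_on S. ennreal \<bar>h x\<bar> \<le> esssup (lebesgue_on S) (\<lambda>x. ennreal \<bar>h x\<bar>)"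
      by (rule esssup_AE)+
    moreover have "AE x in lebesgue_on S. x \<in> S" by (rule AE_I2) simp
    ultimately have "AE x in lebesgue_on S. ennreal \<bar>f x\<bar> \<le> esssup (lebesgue_on S) (\<lambda>x. ennreal \<bar>g x\<bar>) + esssup (lebesgue_on S) (\<lambda>x. ennreal \<bar>h x\<bar>)"
    proof eventually_elim
      case (elim x)
      have "ennreal \<bar>f x\<bar> \<le> ennreal \<bar>g x\<bar> + ennreal \<bar>h x\<bar>"
        using le[OF elim(3)] by (simp add: ennreal_plus[symmetric] ennreal_leI del: ennreal_plus)
      also have "\<dots> \<le> esssup (lebesgue_on S) (\<lambda>x. ennreal \<bar>g x\<bar>) + esssup (lebesgue_on S) (\<lambda>x. ennreal \<bar>h x\<bar>)"
        by (intro add_mono elim)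
      finally show ?case .
    qed
    then have "Lp_norm p S f \<le> Lp_norm p S g + Lp_norm p S h" using True unfolding Lp_norm_def
      by (simp, intro esssup_I) (auto intro!: measurable_lebesgue_on)
    also have "\<dots> \<le> ennreal (4 powr (1/q) * 2) * (Lp_norm p S g + Lp_norm p S h)"
      using mult_right_mono[of 1 "ennreal (4 powr (1/q) * 2)" "Lp_norm p S g + Lp_norm p S h"] K by simp
    finally show ?thesis .
  next
    case False
    define P where "P = enn2real p"
    have pP: "p = ennreal P" using False by (simp add: P_def less_top)
    have qP: "q \<le> P" using p False unfolding P_def by (metis enn2real_ennreal enn2real_mono infinity_ennreal_def less_imp_le less_top)
    have P: "P > 0" using qP p by linarith
    define I where "I u = power_integral P S (\<lambda>x. \<bar>u x\<bar>)" for u :: "real \<Rightarrow> real"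
    have le1: "Lp_norm p S f \<le> ennreal (4 powr (1/q) * 2) * Lp_norm p S u"
      if u: "I g \<le> I u" "I h \<le> I u" for u
    proof (rule Lp_norm_le_of_integral_le[OF False p(1)])
      have "I f \<le> (\<integral>\<^sup>+x\<in>S. ennreal (2 powr P) * (ennreal (\<bar>g x\<bar> powr P) + ennreal (\<bar>h x\<bar> powr P)) \<partial>lborel)"
        unfolding I_def
      proof (rule set_nn_integral_le)
        fix x assume "x \<in> S"
        then have "\<bar>f x\<bar> powr P \<le> (\<bar>g x\<bar> + \<bar>h x\<bar>) powr P" using P le by (intro powr_mono2) auto
        also have "\<dots> \<le> 2 powr P * (\<bar>g x\<bar> powr P + \<bar>h x\<bar> powr P)" using P by (intro powr_add_le) auto
        finally show "ennreal (\<bar>f x\<bar> powr P) \<le> ennreal (2 powr P) * (ennreal (\<bar>g x\<bar> powr P) + ennreal (\<bar>h x\<bar> powr P))"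
          by (simp add: ennreal_mult'[symmetric] ennreal_plus[symmetric] ennreal_leI del: ennreal_plus)
      qed
      also have "\<dots> = ennreal (2 powr P) * (I g + I h)"
        unfolding I_def by (subst set_nn_integral_cmult) (auto simp: set_nn_integral_add)
      also have "\<dots> \<le> ennreal (2 powr P) * (I u + I u)" by (intro mult_left_mono add_mono u) auto
      also have "\<dots> = ennreal (2 * 2 powr P) * I u" by (simp add: ennreal_mult mult_2[symmetric] mult_ac)
      also have "\<dots> \<le> ennreal ((4 powr (1/q) * 2) powr P) * I u"
      proof (intro mult_right_mono ennreal_leI)
        have "4 \<le> (4 powr (1/q)) powr P" using p qP by (intro const_le_powr) auto
        then have "2 * 2 powr P \<le> (4 powr (1/q)) powr P * 2 powr P" by (intro mult_right_mono) auto
        then show "2 * 2 powr P \<le> (4 powr (1/q) * 2) powr P" by (simp add: powr_mult)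
      qed simp
      finally show "power_integral (enn2real p) S (\<lambda>x. \<bar>f x\<bar>) \<le> ennreal ((4 powr (1/q) * 2) powr enn2real p) * power_integral (enn2real p) S (\<lambda>x. \<bar>u x\<bar>)"
        by (simp add: I_def P_def)
    qed (use four in auto)
    have "Lp_norm p S f \<le> ennreal (4 powr (1/q) * 2) * Lp_norm p S g \<or> Lp_norm p S f \<le> ennreal (4 powr (1/q) * 2) * Lp_norm p S h"
      using le1[of g] le1[of h] linear[of "I g" "I h"] by blast
    moreover have "ennreal (4 powr (1/q) * 2) * Lp_norm p S g \<le> ennreal (4 powr (1/q) * 2) * (Lp_norm p S g + Lp_norm p S h)"
      "ennreal (4 powr (1/q) * 2) * Lp_norm p S h \<le> ennreal (4 powr (1/q) * 2) * (Lp_norm p S g + Lp_norm p S h)"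
      by (intro mult_left_mono; simp)+
    ultimately show ?thesis using order.trans by blast
  qed
qed

text \<open>If \<open>\<bar>g\<bar> \<le> m\<close>, the hypothesis bounds the measure of \<open>{x. c * m + \<delta> < \<bar>f x\<bar>}\<close> by a constant times \<open>(c * m / (c
  * m + \<delta>)) powr P\<close>, which tends to \<open>0\<close>.\<close>
lemma Lp_norm_top_of_finite:
  fixes f g :: "real \<Rightarrow> real"
  assumes [measurable]: "f \<in> borel_measurable borel" "g \<in> borel_measurable borel"
    and [simp, measurable]: "S \<in> sets borel" "S' \<in> sets borel" and fin: "emeasure lborel S' \<noteq> \<infinity>" and c: "0 < c"
    and le: "\<And>P. 1 \<le> P \<Longrightarrow> power_integral P S (\<lambda>x. \<bar>f x\<bar>) \<le> ennreal (c powr P) * power_integral P S' (\<lambda>x. \<bar>g x\<bar>)"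
  shows "Lp_norm \<infinity> S f \<le> ennreal c * Lp_norm \<infinity> S' g"
proof (cases "Lp_norm \<infinity> S' g = \<infinity>")
  case True
  then show ?thesis using c by (simp add: ennreal_mult_top)
next
  case False
  then obtain m where m: "Lp_norm \<infinity> S' g = ennreal m" "0 \<le> m" by (cases "Lp_norm \<infinity> S' g") auto
  obtain \<mu> where \<mu>: "emeasure lborel S' = ennreal \<mu>" "0 \<le> \<mu>" using fin by (cases "emeasure lborel S'") auto
  have ae: "AE x in lebesgue_on S'. \<bar>g x\<bar> \<le> m"
    using esssup_AE[where M = "lebesgue_on S'" and f = "\<lambda>x. ennreal \<bar>g x\<bar>"] m by (simp add: Lp_norm_def)
  have gint: "power_integral P S' (\<lambda>x. \<bar>g x\<bar>) \<le> ennreal (m powr P * \<mu>)" if "1 \<le> P" for P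
  proof -
    have "power_integral P S' (\<lambda>x. \<bar>g x\<bar>) = (\<integral>\<^sup>+x. ennreal (\<bar>g x\<bar> powr P) \<partial>lebesgue_on S')"
      by (simp add: nn_integral_lebesgue_on)
    also have "\<dots> \<le> (\<integral>\<^sup>+x. ennreal (m powr P) \<partial>lebesgue_on S')"
      by (rule nn_integral_mono_AE) (use ae that in \<open>auto elim!: eventually_mono intro!: ennreal_leI powr_mono2\<close>)
    also have "\<dots> = ennreal (m powr P) * ennreal \<mu>"
      using \<mu> unfolding nn_integral_lebesgue_on[OF assms(4)] by (subst set_nn_integral_cmult[where f = "\<lambda>_. 1", simplified]) auto
    finally show ?thesis using \<mu> by (simp add: ennreal_mult)
  qed
  have bound: "Lp_norm \<infinity> S f \<le> ennreal (c * m) + ennreal \<delta>" if \<delta>: "0 < \<delta>" for \<delta>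
  proof -
    define s where "s = c * m + \<delta>"
    have s: "0 < s" "0 \<le> c * m" "c * m < s" using c m \<delta> by (auto simp: s_def add_nonneg_pos)
    define E where "E = {x \<in> S. s < \<bar>f x\<bar>}"
    have [measurable]: "E \<in> sets borel" unfolding E_def by measurable
    have b: "emeasure lborel E \<le> ennreal (\<mu> * (c * m / s) ^ Suc k)" for k
    proof -
      define P where "P = real (Suc k)"
      have P: "1 \<le> P" by (simp add: P_def)
      have "ennreal (s powr P) * emeasure lborel E = (\<integral>\<^sup>+x. ennreal (s powr P) * indicator E x \<partial>lborel)"
        by (simp add: nn_integral_cmult)
      also have "\<dots> \<le> power_integral P S (\<lambda>x. \<bar>f x\<bar>)"
        using s P by (intro nn_integral_mono) (auto simp: E_def split: split_indicator intro!: ennreal_leI powr_mono2)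
      also have "\<dots> \<le> ennreal (c powr P) * power_integral P S' (\<lambda>x. \<bar>g x\<bar>)" by (rule le[OF P])
      also have "\<dots> \<le> ennreal (c powr P) * ennreal (m powr P * \<mu>)" by (intro mult_left_mono gint P) simp
      also have "\<dots> = ennreal ((c * m) powr P * \<mu>)" using c m \<mu> by (simp add: ennreal_mult'[symmetric] powr_mult mult_ac)
      finally have "ennreal (1 / s powr P) * (ennreal (s powr P) * emeasure lborel E) \<le> ennreal (1 / s powr P) * ennreal ((c * m) powr P * \<mu>)"
        by (intro mult_left_mono) auto
      then have "emeasure lborel E \<le> ennreal ((1 / s powr P) * ((c * m) powr P * \<mu>))"
        using s by (simp add: mult.assoc[symmetric] ennreal_mult'[symmetric])
      also have "(1 / s powr P) * ((c * m) powr P * \<mu>) = \<mu> * (c * m / s) powr P" using s by (simp add: powr_divide)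
      also have "(c * m / s) powr P = (c * m / s) ^ Suc k"
      proof (cases "c * m = 0")
        case False
        then have "0 < c * m / s" using s by (intro divide_pos_pos) linarith+
        then show ?thesis unfolding P_def by (rule powr_realpow)
      next
        case True
        then show ?thesis using P by (simp only: True) simp
      qed
      finally show ?thesis .
    qed
    have "(\<lambda>k. ennreal (\<mu> * (c * m / s) ^ Suc k)) \<longlonglongrightarrow> ennreal (\<mu> * 0)"
      using s by (intro tendsto_ennrealI tendsto_mult tendsto_const LIMSEQ_Suc LIMSEQ_realpow_zero) auto
    then have "emeasure lborel E \<le> ennreal (\<mu> * 0)" by (rule LIMSEQ_le_const) (use b in blast)
    then have "E \<in> null_sets lborel" by (auto simp: null_sets_def)
    then have "E \<in> null_sets lebesgue" by (rule null_sets_completionI)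
    then have "AE x in lebesgue. x \<in> S \<longrightarrow> \<bar>f x\<bar> \<le> s"
      by (rule AE_I') (auto simp: E_def)
    then have "AE x in lebesgue_on S. ennreal \<bar>f x\<bar> \<le> ennreal s"
      by (subst AE_restrict_space_iff) (auto elim!: eventually_mono intro!: ennreal_leI)
    then have "Lp_norm \<infinity> S f \<le> ennreal s" unfolding Lp_norm_def
      by (simp, intro esssup_I) (auto intro!: measurable_lebesgue_on)
    then show ?thesis using s \<delta> by (simp add: s_def ennreal_plus)
  qed
  have "Lp_norm \<infinity> S f \<le> ennreal (c * m)"
    by (rule ennreal_le_epsilon) (use bound in auto)
  then show ?thesis using m c by (simp add: ennreal_mult)
qed

section \<open>From the angle to the interval\<close>

text \<open>The inverse of \<open>\<theta> \<mapsto> - cos \<theta>\<close>. Clipping the argument to \<open>{-1..1}\<close> makes it a continuous function on the whole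
  line.\<close>
definition angle :: "real \<Rightarrow> real" where
  "angle x = arccos (- max (- 1) (min 1 x))"

lemma measurable_angle[measurable]: "angle \<in> borel_measurable borel"
  unfolding angle_def by (intro borel_measurable_continuous_onI continuous_intros) auto

lemma angle_bounds: "angle x \<in> {0..pi}"
  unfolding angle_def using arccos_bounded[of "- max (- 1) (min 1 x)"] by auto

lemma cos_angle: "x \<in> {-1..1} \<Longrightarrow> - cos (angle x) = x"
  by (simp add: angle_def max_def min_def)

lemma angle_neg_cos: "\<theta> \<in> {0..pi} \<Longrightarrow> angle (- cos \<theta>) = \<theta>"
  by (simp add: angle_def arccos_cos)

lemma one_minus_cos_bounds:
  assumes "0 \<le> \<theta>" "\<theta> \<le> pi"
  shows "\<theta>\<^sup>2 / 8 \<le> 1 - cos \<theta>" "1 - cos \<theta> \<le> \<theta>\<^sup>2 / 2"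
proof -
  have eq: "1 - cos \<theta> = 2 * (sin (\<theta> / 2))\<^sup>2" using cos_double_sin[of "\<theta> / 2"] by simp
  have "\<theta> / 2 / 2 \<le> sin (\<theta> / 2)" using assms by (intro sin_ge_half) auto
  then have "(\<theta> / 2 / 2)\<^sup>2 \<le> (sin (\<theta> / 2))\<^sup>2" using assms by (intro power_mono) auto
  then show "\<theta>\<^sup>2 / 8 \<le> 1 - cos \<theta>" unfolding eq by (simp add: power_divide)
  have "sin (\<theta> / 2) \<le> \<theta> / 2" using assms by (intro sin_x_le_x) auto
  moreover have "0 \<le> sin (\<theta> / 2)" using assms by (intro sin_ge_zero) auto
  ultimately have "(sin (\<theta> / 2))\<^sup>2 \<le> (\<theta> / 2)\<^sup>2" by (intro power_mono) auto
  then show "1 - cos \<theta> \<le> \<theta>\<^sup>2 / 2" unfolding eq by (simp add: power_divide)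
qed

lemma one_minus_cos_powr:
  assumes "0 < \<theta>" "\<theta> \<le> pi" "\<bar>g\<bar> \<le> \<Gamma>"
  shows "(1 - cos \<theta>) powr (g / 2) \<le> 8 powr (\<Gamma> / 2) * \<theta> powr g"
    "\<theta> powr g \<le> 8 powr (\<Gamma> / 2) * (1 - cos \<theta>) powr (g / 2)"
proof -
  note b = one_minus_cos_bounds[OF less_imp_le[OF assms(1)] assms(2)]
  have t: "0 < \<theta>\<^sup>2" using assms by simp
  then have pos: "0 < 1 - cos \<theta>" using b by linarith
  have sq: "(\<theta>\<^sup>2) powr (g / 2) = \<theta> powr g"
    using assms by (simp add: powr_powr flip: powr_numeral)
  have e: "8 powr \<bar>g / 2\<bar> \<le> 8 powr (\<Gamma> / 2)" using assms by (intro powr_mono) auto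
  have r: "1 - cos \<theta> \<le> 8 * \<theta>\<^sup>2" "\<theta>\<^sup>2 \<le> 8 * (1 - cos \<theta>)" using b t by (auto simp: field_simps)
  have "(1 - cos \<theta>) powr (g / 2) \<le> 8 powr \<bar>g / 2\<bar> * (\<theta>\<^sup>2) powr (g / 2)"
    by (intro powr_ratio_le t pos r) simp
  also have "\<dots> \<le> 8 powr (\<Gamma> / 2) * (\<theta>\<^sup>2) powr (g / 2)" by (intro mult_right_mono e) auto
  finally show "(1 - cos \<theta>) powr (g / 2) \<le> 8 powr (\<Gamma> / 2) * \<theta> powr g" by (simp add: sq)
  have "(\<theta>\<^sup>2) powr (g / 2) \<le> 8 powr \<bar>g / 2\<bar> * (1 - cos \<theta>) powr (g / 2)"
    by (intro powr_ratio_le t pos r) simp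
  also have "\<dots> \<le> 8 powr (\<Gamma> / 2) * (1 - cos \<theta>) powr (g / 2)" by (intro mult_right_mono e) auto
  finally show "\<theta> powr g \<le> 8 powr (\<Gamma> / 2) * (1 - cos \<theta>) powr (g / 2)" by (simp add: sq)
qed

lemma jacobi_w_nonneg: "0 \<le> jacobi_w a b x"
  by (simp add: jacobi_w_def)

lemma measurable_jacobi_w[measurable]: "jacobi_w a b \<in> borel_measurable borel"
  unfolding jacobi_w_def by measurable

text \<open>Both \<open>1 - x\<close> and \<open>1 + x\<close> are squares of half-angle sines up to the factor \<open>2\<close>, and \<open>sin \<theta>\<close> is the square
  root of their product; hence the exponents \<open>2 * a + 1 / P\<close> and \<open>2 * b + 1 / P\<close>.\<close>
lemma jacobi_w_arc_weight:
  assumes \<theta>: "\<theta> \<in> {0..pi}" and P: "0 < P" and \<Gamma>: "\<bar>2 * a + 1 / P\<bar> \<le> \<Gamma>" "\<bar>2 * b + 1 / P\<bar> \<le> \<Gamma>"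
  shows "jacobi_w a b (- cos \<theta>) * sin \<theta> powr (1 / P) \<le> 8 powr \<Gamma> * arc_weight (2 * b + 1 / P) (2 * a + 1 / P) \<theta>"
    "arc_weight (2 * b + 1 / P) (2 * a + 1 / P) \<theta> \<le> 8 powr \<Gamma> * (jacobi_w a b (- cos \<theta>) * sin \<theta> powr (1 / P))"
proof -
  define J where "J = jacobi_w a b (- cos \<theta>) * sin \<theta> powr (1 / P)"
  define W where "W = arc_weight (2 * b + 1 / P) (2 * a + 1 / P) \<theta>"
  have "J \<le> 8 powr \<Gamma> * W \<and> W \<le> 8 powr \<Gamma> * J"
  proof (cases "\<theta> = 0 \<or> \<theta> = pi")
    case True
    then show ?thesis by (auto simp: J_def W_def arc_weight_def)
  next
    case False
    then have \<theta>': "0 < \<theta>" "\<theta> < pi" using \<theta> by auto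
    define u where "u = 1 - cos \<theta>"
    define w where "w = 1 - cos (pi - \<theta>)"
    have w: "w = 1 + cos \<theta>" by (simp add: w_def)
    have u0: "0 < u" using one_minus_cos_bounds(1)[of \<theta>] \<theta>' zero_less_power[of \<theta> 2] unfolding u_def by linarith
    have w0: "0 < w" using one_minus_cos_bounds(1)[of "pi - \<theta>"] \<theta>' zero_less_power[of "pi - \<theta>" 2] unfolding w_def by linarith
    have "(sin \<theta>)\<^sup>2 = u * w" by (simp add: u_def w sin_squared_eq algebra_simps power2_eq_square)
    then have "sin \<theta> = sqrt (u * w)" using \<theta>' by (metis real_sqrt_abs abs_of_pos sin_gt_zero)
    then have "sin \<theta> = (u * w) powr (1/2)" using u0 w0 by (simp add: powr_half_sqrt)
    then have "sin \<theta> powr (1 / P) = u powr (1 / P / 2) * w powr (1 / P / 2)"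
      using u0 w0 by (simp add: powr_powr powr_mult mult.commute)
    then have "J = w powr (a + 1 / P / 2) * u powr (b + 1 / P / 2)"
      by (simp add: J_def jacobi_w_def w u_def powr_add)
    also have "a + 1 / P / 2 = (2 * a + 1 / P) / 2" by simp
    also have "b + 1 / P / 2 = (2 * b + 1 / P) / 2" by simp
    finally have J: "J = w powr ((2 * a + 1 / P) / 2) * u powr ((2 * b + 1 / P) / 2)" .
    have W: "W = (pi - \<theta>) powr (2 * a + 1 / P) * \<theta> powr (2 * b + 1 / P)" by (simp add: W_def arc_weight_def)
    have 8: "8 powr (\<Gamma> / 2) * 8 powr (\<Gamma> / 2) = 8 powr \<Gamma>" by (simp flip: powr_add)
    have "J \<le> (8 powr (\<Gamma> / 2) * (pi - \<theta>) powr (2 * a + 1 / P)) * (8 powr (\<Gamma> / 2) * \<theta> powr (2 * b + 1 / P))"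
      unfolding J u_def w_def using \<theta>' \<Gamma> by (intro mult_mono one_minus_cos_powr) auto
    also have "\<dots> = (8 powr (\<Gamma> / 2) * 8 powr (\<Gamma> / 2)) * W" by (simp add: W)
    finally have 1: "J \<le> 8 powr \<Gamma> * W" unfolding 8 .
    have "W \<le> (8 powr (\<Gamma> / 2) * w powr ((2 * a + 1 / P) / 2)) * (8 powr (\<Gamma> / 2) * u powr ((2 * b + 1 / P) / 2))"
      unfolding W u_def w_def using \<theta>' \<Gamma> by (intro mult_mono one_minus_cos_powr) auto
    also have "\<dots> = (8 powr (\<Gamma> / 2) * 8 powr (\<Gamma> / 2)) * J" by (simp add: J)
    finally show ?thesis using 1 unfolding 8 by simp
  qed
  then show "jacobi_w a b (- cos \<theta>) * sin \<theta> powr (1 / P) \<le> 8 powr \<Gamma> * arc_weight (2 * b + 1 / P) (2 * a + 1 / P) \<theta>"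
    "arc_weight (2 * b + 1 / P) (2 * a + 1 / P) \<theta> \<le> 8 powr \<Gamma> * (jacobi_w a b (- cos \<theta>) * sin \<theta> powr (1 / P))"
    by (auto simp: J_def W_def)
qed

lemma jacobi_integral_substitution:
  fixes F :: "real \<Rightarrow> real"
  assumes [measurable]: "F \<in> borel_measurable borel" and F: "\<And>x. 0 \<le> F x" and P: "0 < P" and st: "0 \<le> s" "s < t" "t \<le> pi"
  shows "power_integral P {- cos s..- cos t} (\<lambda>x. jacobi_w a b x * F x)
    = power_integral P {s..t} (\<lambda>\<theta>. jacobi_w a b (- cos \<theta>) * sin \<theta> powr (1 / P) * F (- cos \<theta>))"
proof -
  have "power_integral P {- cos s..- cos t} (\<lambda>x. jacobi_w a b x * F x)
    = (\<integral>\<^sup>+\<theta>. ennreal ((jacobi_w a b (- cos \<theta>) * F (- cos \<theta>)) powr P) * ennreal (sin \<theta>) * indicator {s..t} \<theta> \<partial>lborel)"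
    using st by (intro nn_integral_substitution_aux) (auto intro!: derivative_eq_intros continuous_intros sin_ge_zero)
  also have "\<dots> = power_integral P {s..t} (\<lambda>\<theta>. jacobi_w a b (- cos \<theta>) * sin \<theta> powr (1 / P) * F (- cos \<theta>))"
  proof (intro nn_integral_cong)
    fix \<theta>
    show "ennreal ((jacobi_w a b (- cos \<theta>) * F (- cos \<theta>)) powr P) * ennreal (sin \<theta>) * indicator {s..t} \<theta>
      = ennreal ((jacobi_w a b (- cos \<theta>) * sin \<theta> powr (1 / P) * F (- cos \<theta>)) powr P) * indicator {s..t} \<theta>"
    proof (cases "\<theta> \<in> {s..t}")
      case True
      then have "sin \<theta> \<ge> 0" using st by (intro sin_ge_zero) auto
      then have "(jacobi_w a b (- cos \<theta>) * sin \<theta> powr (1 / P) * F (- cos \<theta>)) powr P = (jacobi_w a b (- cos \<theta>) * F (- cos \<theta>)) powr P * sin \<theta>"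
        using P F jacobi_w_nonneg by (simp add: powr_mult powr_powr)
      then show ?thesis by (simp add: ennreal_mult')
    qed simp
  qed
  finally show ?thesis .
qed

lemma exponent_ge:
  assumes "min 1 p = ennreal q" "0 < q" "p \<noteq> \<infinity>"
  shows "q \<le> enn2real p" "0 < enn2real p"
proof -
  have "ennreal q \<le> p" using assms(1) min.cobounded2[of 1 p] by simp
  moreover have "p = ennreal (enn2real p)" using assms(3) by (simp add: less_top)
  ultimately have "ennreal q \<le> ennreal (enn2real p)" by simp
  then show "q \<le> enn2real p" by (subst (asm) ennreal_le_iff) auto
  then show "0 < enn2real p" using assms(2) by linarith
qed

text \<open>For \<open>p = \<infinity>\<close> the term \<open>1 / enn2real p\<close> is \<open>0\<close>, so the hypotheses on \<open>a\<close> and \<open>b\<close> cover all \<open>p\<close>; they give \<open>p \<le>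
  g * p + 1\<close> for the exponents \<open>g\<close> of the angular weight. That \<open>B\<close> serves all \<open>p\<close> at once allows the passage
  to the limit \<open>p = \<infinity>\<close>.\<close>
theorem jacobi_majorant:
  fixes q a b :: real
  assumes q: "0 < q" "q \<le> 1"
  shows "\<exists>C \<epsilon>. 0 < \<epsilon> \<and> \<epsilon> \<le> 1 / 2 \<and> (\<forall>n Q. 1 \<le> n \<longrightarrow> degree Q \<le> n \<longrightarrow>
    (\<exists>B. slow_majorant n C (\<lambda>\<tau>. poly Q (- cos \<tau>)) B \<and>
      (\<forall>p. min 1 p = ennreal q \<longrightarrow> 1 / 2 \<le> a + 1 / enn2real p \<longrightarrow> 1 / 2 \<le> b + 1 / enn2real p \<longrightarrow>
        Lp_norm p {-1..1} (\<lambda>x. jacobi_w a b x * B (angle x))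
         \<le> ennreal C * Lp_norm p {- cos (\<epsilon> / real n)..cos (\<epsilon> / real n)} (\<lambda>x. jacobi_w a b x * poly Q x))))"
proof -
  define \<Gamma> where "\<Gamma> = 2 * \<bar>a\<bar> + 2 * \<bar>b\<bar> + 1 / q"
  have \<Gamma>0: "0 \<le> \<Gamma>" using q by (simp add: \<Gamma>_def)
  have \<Gamma>: "\<bar>2 * a + 1 / P\<bar> \<le> \<Gamma>" "\<bar>2 * b + 1 / P\<bar> \<le> \<Gamma>" if "q \<le> P" for P
  proof -
    have "1 / P \<le> 1 / q" "0 \<le> 1 / P" using that q by (auto intro: divide_left_mono)
    then show "\<bar>2 * a + 1 / P\<bar> \<le> \<Gamma>" "\<bar>2 * b + 1 / P\<bar> \<le> \<Gamma>" unfolding \<Gamma>_def by linarith+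
  qed
  obtain C0 \<epsilon> where C0: "1 \<le> C0" and \<epsilon>: "0 < \<epsilon>" "\<epsilon> \<le> 1 / 2" and maj: "\<And>n Q. 1 \<le> n \<Longrightarrow> degree Q \<le> n \<Longrightarrow>
    \<exists>B. slow_majorant n C0 (\<lambda>\<tau>. poly Q (- cos \<tau>)) B \<and>
      (\<forall>p\<ge>q. \<forall>g g'. \<bar>g\<bar> \<le> \<Gamma> \<longrightarrow> \<bar>g'\<bar> \<le> \<Gamma> \<longrightarrow> q \<le> g * p + 1 \<longrightarrow> q \<le> g' * p + 1 \<longrightarrow>
        power_integral p {0..pi} (\<lambda>\<theta>. arc_weight g g' \<theta> * B \<theta>)
         \<le> ennreal (C0 powr p) * power_integral p {\<epsilon>/real n..pi-\<epsilon>/real n} (\<lambda>\<theta>. arc_weight g g' \<theta> * \<bar>poly Q (- cos \<theta>)\<bar>))"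
    using slow_majorant_exists[OF q \<Gamma>0] by (elim exE conjE) (rule that; blast)
  define C where "C = 8 powr \<Gamma> * C0 * 8 powr \<Gamma>"
  have e8: "1 \<le> 8 powr \<Gamma>" using \<Gamma>0 by (intro ge_one_powr_ge_zero) auto
  have "1 * C0 * 1 \<le> C" unfolding C_def using e8 C0 by (intro mult_mono) auto
  then have C: "1 \<le> C" "C0 \<le> C" using C0 by auto
  show ?thesis
  proof (rule exI[of _ C], rule exI[of _ \<epsilon>], intro conjI allI impI \<epsilon>)
    fix n :: nat and Q :: "real poly" assume n: "1 \<le> n" and Q: "degree Q \<le> n"
    obtain B where B: "slow_majorant n C0 (\<lambda>\<tau>. poly Q (- cos \<tau>)) B"
      and int: "\<And>p g g'. q \<le> p \<Longrightarrow> \<bar>g\<bar> \<le> \<Gamma> \<Longrightarrow> \<bar>g'\<bar> \<le> \<Gamma> \<Longrightarrow> q \<le> g * p + 1 \<Longrightarrow> q \<le> g' * p + 1 \<Longrightarrow>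
        power_integral p {0..pi} (\<lambda>\<theta>. arc_weight g g' \<theta> * B \<theta>)
         \<le> ennreal (C0 powr p) * power_integral p {\<epsilon>/real n..pi-\<epsilon>/real n} (\<lambda>\<theta>. arc_weight g g' \<theta> * \<bar>poly Q (- cos \<theta>)\<bar>)"
      using maj[OF n Q] by blast
    interpret slow_majorant n C0 "\<lambda>\<tau>. poly Q (- cos \<tau>)" B by (rule B)
    have Bx[measurable]: "(\<lambda>x. B (angle x)) \<in> borel_measurable borel" by measurable
    have Qm[measurable]: "poly Q \<in> borel_measurable borel" by (intro borel_measurable_continuous_onI continuous_intros)
    have s: "0 < \<epsilon> / real n" "\<epsilon> / real n \<le> 1 / 2"
      using \<epsilon> n by (auto simp: field_simps)
    have main: "(\<integral>\<^sup>+x\<in>{-1..1}. ennreal (\<bar>jacobi_w a b x * B (angle x)\<bar> powr P) \<partial>lborel)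
       \<le> ennreal (C powr P) * (\<integral>\<^sup>+x\<in>{- cos (\<epsilon> / real n)..cos (\<epsilon> / real n)}. ennreal (\<bar>jacobi_w a b x * poly Q x\<bar> powr P) \<partial>lborel)"
      if P: "q \<le> P" and a: "1 / 2 \<le> a + 1 / P" and b: "1 / 2 \<le> b + 1 / P" for P
    proof -
      define g where "g = 2 * b + 1 / P"
      define g' where "g' = 2 * a + 1 / P"
      have P0: "0 < P" using P q by linarith
      have g: "q \<le> g * P + 1" "q \<le> g' * P + 1"
      proof -
        have "1 / 2 * (2 * P) \<le> (b + 1 / P) * (2 * P)" "1 / 2 * (2 * P) \<le> (a + 1 / P) * (2 * P)"
          using P0 by (intro mult_right_mono a b; simp)+
        moreover have "(b + 1 / P) * (2 * P) = g * P + 1" "(a + 1 / P) * (2 * P) = g' * P + 1"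
          using P0 by (auto simp: g_def g'_def field_simps)
        ultimately show "q \<le> g * P + 1" "q \<le> g' * P + 1" using P by linarith+
      qed
      note G = \<Gamma>[OF P]
      have arc0: "0 \<le> sin \<theta> powr (1/P)" for \<theta> by simp
      have "(\<integral>\<^sup>+x\<in>{-1..1}. ennreal (\<bar>jacobi_w a b x * B (angle x)\<bar> powr P) \<partial>lborel)
        = power_integral P {- cos 0..- cos pi} (\<lambda>x. jacobi_w a b x * B (angle x))"
        using B_nonneg jacobi_w_nonneg by simp
      also have "\<dots> = power_integral P {0..pi} (\<lambda>\<theta>. jacobi_w a b (- cos \<theta>) * sin \<theta> powr (1 / P) * B (angle (- cos \<theta>)))"
        using P0 by (intro jacobi_integral_substitution B_nonneg Bx) auto
      also have "\<dots> \<le> ennreal ((8 powr \<Gamma>) powr P) * power_integral P {0..pi} (\<lambda>\<theta>. arc_weight g g' \<theta> * B \<theta>)"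
      proof (rule set_nn_integral_powr_le)
        fix \<theta> :: real assume \<theta>: "\<theta> \<in> {0..pi}"
        have "jacobi_w a b (- cos \<theta>) * sin \<theta> powr (1 / P) * B (angle (- cos \<theta>)) \<le> (8 powr \<Gamma> * arc_weight g g' \<theta>) * B \<theta>"
          unfolding angle_neg_cos[OF \<theta>] g_def g'_def by (intro mult_right_mono B_nonneg jacobi_w_arc_weight \<theta> P0 G)
        then show "0 \<le> jacobi_w a b (- cos \<theta>) * sin \<theta> powr (1 / P) * B (angle (- cos \<theta>)) \<and>
          jacobi_w a b (- cos \<theta>) * sin \<theta> powr (1 / P) * B (angle (- cos \<theta>)) \<le> 8 powr \<Gamma> * (arc_weight g g' \<theta> * B \<theta>)"
          using jacobi_w_nonneg B_nonneg by (simp add: mult.assoc)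
      qed (use P0 B_nonneg arc_weight_nonneg in auto)
      also have "power_integral P {0..pi} (\<lambda>\<theta>. arc_weight g g' \<theta> * B \<theta>)
         \<le> ennreal (C0 powr P) * power_integral P {\<epsilon>/real n..pi-\<epsilon>/real n} (\<lambda>\<theta>. arc_weight g g' \<theta> * \<bar>poly Q (- cos \<theta>)\<bar>)"
        using G by (intro int P g) (auto simp: g_def g'_def)
      also have "power_integral P {\<epsilon>/real n..pi-\<epsilon>/real n} (\<lambda>\<theta>. arc_weight g g' \<theta> * \<bar>poly Q (- cos \<theta>)\<bar>)
         \<le> ennreal ((8 powr \<Gamma>) powr P) * power_integral P {\<epsilon>/real n..pi-\<epsilon>/real n} (\<lambda>\<theta>. jacobi_w a b (- cos \<theta>) * sin \<theta> powr (1 / P) * \<bar>poly Q (- cos \<theta>)\<bar>)"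
      proof (rule set_nn_integral_powr_le)
        fix \<theta> :: real assume "\<theta> \<in> {\<epsilon>/real n..pi-\<epsilon>/real n}"
        then have \<theta>: "\<theta> \<in> {0..pi}" using s unfolding atLeastAtMost_iff by linarith
        have "arc_weight g g' \<theta> * \<bar>poly Q (- cos \<theta>)\<bar> \<le> (8 powr \<Gamma> * (jacobi_w a b (- cos \<theta>) * sin \<theta> powr (1 / P))) * \<bar>poly Q (- cos \<theta>)\<bar>"
          unfolding g_def g'_def by (intro mult_right_mono jacobi_w_arc_weight \<theta> P0 G) auto
        then show "0 \<le> arc_weight g g' \<theta> * \<bar>poly Q (- cos \<theta>)\<bar> \<and>
           arc_weight g g' \<theta> * \<bar>poly Q (- cos \<theta>)\<bar> \<le> 8 powr \<Gamma> * (jacobi_w a b (- cos \<theta>) * sin \<theta> powr (1 / P) * \<bar>poly Q (- cos \<theta>)\<bar>)"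
          using arc_weight_nonneg by (simp add: mult.assoc)
      qed (use P0 jacobi_w_nonneg in auto)
      also have "power_integral P {\<epsilon>/real n..pi-\<epsilon>/real n} (\<lambda>\<theta>. jacobi_w a b (- cos \<theta>) * sin \<theta> powr (1 / P) * \<bar>poly Q (- cos \<theta>)\<bar>)
        = power_integral P {- cos (\<epsilon>/real n)..- cos (pi-\<epsilon>/real n)} (\<lambda>x. jacobi_w a b x * \<bar>poly Q x\<bar>)"
      proof (rule jacobi_integral_substitution[symmetric])
        show "\<epsilon> / real n < pi - \<epsilon> / real n" using s pi_gt3 by linarith
        show "pi - \<epsilon> / real n \<le> pi" using s by linarith
      qed (use P0 s in auto)
      also have "\<dots> = (\<integral>\<^sup>+x\<in>{- cos (\<epsilon> / real n)..cos (\<epsilon> / real n)}. ennreal (\<bar>jacobi_w a b x * poly Q x\<bar> powr P) \<partial>lborel)"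
        using jacobi_w_nonneg by (simp add: abs_mult)
      finally have "(\<integral>\<^sup>+x\<in>{-1..1}. ennreal (\<bar>jacobi_w a b x * B (angle x)\<bar> powr P) \<partial>lborel)
        \<le> ennreal ((8 powr \<Gamma>) powr P) * (ennreal (C0 powr P) * (ennreal ((8 powr \<Gamma>) powr P) * (\<integral>\<^sup>+x\<in>{- cos (\<epsilon> / real n)..cos (\<epsilon> / real n)}. ennreal (\<bar>jacobi_w a b x * poly Q x\<bar> powr P) \<partial>lborel)))"
        by (simp add: mult_left_mono)
      then show ?thesis using C0 by (simp add: C_def powr_mult ennreal_mult mult.assoc)
    qed
    have "slow_majorant n C (\<lambda>\<tau>. poly Q (- cos \<tau>)) B"
    proof
      show "B \<tau> \<le> C * B \<tau>'" if "\<tau> \<in> {0..pi}" "\<tau>' \<in> {0..pi}" "\<bar>\<tau> - \<tau>'\<bar> \<le> 1 / real n" for \<tau> \<tau>'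
        using B_slow[OF that] mult_right_mono[OF C(2) B_nonneg[of \<tau>']] by linarith
    qed (use n C B_nonneg T_le T_lipschitz in auto)
    moreover have "Lp_norm p {-1..1} (\<lambda>x. jacobi_w a b x * B (angle x))
         \<le> ennreal C * Lp_norm p {- cos (\<epsilon> / real n)..cos (\<epsilon> / real n)} (\<lambda>x. jacobi_w a b x * poly Q x)"
      if p: "min 1 p = ennreal q" and a: "1 / 2 \<le> a + 1 / enn2real p" and b: "1 / 2 \<le> b + 1 / enn2real p" for p
      proof (cases "p = \<infinity>")
        case False
        note P = exponent_ge[OF p q(1) False]
        show ?thesis
        proof (rule Lp_norm_le_of_integral_le[OF False])
          show "0 < p" using P(2) by (cases "p = 0") (auto simp: zero_less_iff_neq_zero)
        qed (use C main[OF P(1) a b] in auto)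
      next
        case True
        have q1: "q = 1"
          using p q unfolding True by (simp add: min_def)
        have "Lp_norm \<infinity> {-1..1} (\<lambda>x. jacobi_w a b x * B (angle x))
         \<le> ennreal C * Lp_norm \<infinity> {- cos (\<epsilon> / real n)..cos (\<epsilon> / real n)} (\<lambda>x. jacobi_w a b x * poly Q x)"
        proof (rule Lp_norm_top_of_finite)
          fix P :: real assume P: "1 \<le> P"
          then have "0 \<le> 1 / P" by simp
          then show "(\<integral>\<^sup>+x\<in>{-1..1}. ennreal (\<bar>jacobi_w a b x * B (angle x)\<bar> powr P) \<partial>lborel)
            \<le> ennreal (C powr P) * (\<integral>\<^sup>+x\<in>{- cos (\<epsilon> / real n)..cos (\<epsilon> / real n)}. ennreal (\<bar>jacobi_w a b x * poly Q x\<bar> powr P) \<partial>lborel)"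
            using a b P q1 by (intro main) (auto simp: True intro: add_increasing2)
        next
          show "emeasure lborel {- cos (\<epsilon> / real n)..cos (\<epsilon> / real n)} \<noteq> \<infinity>"
            by (simp add: emeasure_lborel_Icc_eq)
        qed (use C in auto)
        then show ?thesis using True by simp
      qed
    ultimately show "\<exists>B. slow_majorant n C (\<lambda>\<tau>. poly Q (- cos \<tau>)) B \<and>
      (\<forall>p. min 1 p = ennreal q \<longrightarrow> 1 / 2 \<le> a + 1 / enn2real p \<longrightarrow> 1 / 2 \<le> b + 1 / enn2real p \<longrightarrow>
        Lp_norm p {-1..1} (\<lambda>x. jacobi_w a b x * B (angle x))
         \<le> ennreal C * Lp_norm p {- cos (\<epsilon> / real n)..cos (\<epsilon> / real n)} (\<lambda>x. jacobi_w a b x * poly Q x))"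
      by blast
  qed
qed

section \<open>Symmetric differences of polynomials\<close>

lemma alternating_sum_Suc:
  fixes f :: "nat \<Rightarrow> real"
  shows "(\<Sum>i=0..Suc k. real (Suc k choose i) * (-1) ^ (Suc k - i) * f i)
    = (\<Sum>i=0..k. real (k choose i) * (-1) ^ (k - i) * (f (Suc i) - f i))"
proof -
  have A: "(\<Sum>i=0..Suc k. real (k choose i) * (-1) ^ (Suc k - i) * f i)
      = (-1) ^ Suc k * f 0 + (\<Sum>i=0..k. real (k choose Suc i) * (-1) ^ (k - i) * f (Suc i))"
    by (simp only: sum.atLeast0_atMost_Suc_shift o_def binomial_n_0 of_nat_1 mult_1 diff_Suc_Suc diff_zero)
  have B: "(\<Sum>i=0..Suc k. real (k choose i) * (-1) ^ (Suc k - i) * f i)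
      = - (\<Sum>i=0..k. real (k choose i) * (-1) ^ (k - i) * f i)"
  proof -
    have s: "real (k choose i) * (-1) ^ (Suc k - i) * f i = - (real (k choose i) * (-1) ^ (k - i) * f i)" if "i \<in> {0..k}" for i
    proof -
      have "(-1 :: real) ^ (Suc k - i) = - ((-1) ^ (k - i))" using that by (simp only: atLeastAtMost_iff Suc_diff_le power_Suc mult_minus_left mult_1)
      then show ?thesis by (simp only: mult_minus_left mult_minus_right)
    qed
    have "(\<Sum>i=0..k. real (k choose i) * (-1) ^ (Suc k - i) * f i) = (\<Sum>i=0..k. - (real (k choose i) * (-1) ^ (k - i) * f i))"
      by (rule sum.cong[OF refl s])
    also have "\<dots> = - (\<Sum>i=0..k. real (k choose i) * (-1) ^ (k - i) * f i)" by (rule sum_negf)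
    finally have "(\<Sum>i=0..k. real (k choose i) * (-1) ^ (Suc k - i) * f i) = - (\<Sum>i=0..k. real (k choose i) * (-1) ^ (k - i) * f i)" .
    moreover have "real (k choose Suc k) = 0" by simp
    ultimately show ?thesis by (simp only: sum.atLeast0_atMost_Suc mult_zero_left add_0_right)
  qed
  have "(\<Sum>i=0..Suc k. real (Suc k choose i) * (-1) ^ (Suc k - i) * f i)
      = (-1) ^ Suc k * f 0 + (\<Sum>i=0..k. real (Suc k choose Suc i) * (-1) ^ (k - i) * f (Suc i))"
    by (simp only: sum.atLeast0_atMost_Suc_shift o_def binomial_n_0 of_nat_1 mult_1 diff_Suc_Suc diff_zero)
  also have "\<dots> = (-1) ^ Suc k * f 0 + (\<Sum>i=0..k. real (k choose Suc i) * (-1) ^ (k - i) * f (Suc i))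
       + (\<Sum>i=0..k. real (k choose i) * (-1) ^ (k - i) * f (Suc i))"
    by (simp only: binomial_Suc_Suc of_nat_add distrib_right sum.distrib add_ac)
  also have "\<dots> = (\<Sum>i=0..k. real (k choose i) * (-1) ^ (k - i) * f (Suc i)) - (\<Sum>i=0..k. real (k choose i) * (-1) ^ (k - i) * f i)"
    using A B by linarith
  finally show ?thesis by (simp only: right_diff_distrib sum_subtractf)
qed

text \<open>A difference of order \<open>Suc k\<close> is the difference of order \<open>k\<close> of \<open>x \<mapsto> D m (x + \<eta>) - D m x\<close>, so induction on
  \<open>k\<close> and the mean value theorem suffice.\<close>
lemma difference_mean_value:
  fixes D :: "nat \<Rightarrow> real \<Rightarrow> real"
  assumes "\<And>m x. (D m has_real_derivative D (Suc m) x) (at x)" and \<eta>: "0 \<le> \<eta>"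
  shows "\<exists>\<xi>\<in>{y..y + real k * \<eta>}. (\<Sum>i=0..k. real (k choose i) * (-1) ^ (k - i) * D m (y + real i * \<eta>)) = \<eta> ^ k * D (k + m) \<xi>"
  using assms(1)
proof (induction k arbitrary: D)
  case (Suc k)
  define D' where "D' m x = D m (x + \<eta>) - D m x" for m x
  have "(D' m has_real_derivative D' (Suc m) x) (at x)" for m x
    unfolding D'_def by (intro DERIV_diff Suc.prems DERIV_shift[THEN iffD1])
  then have D'_deriv: "\<And>m x. (D' m has_real_derivative D' (Suc m) x) (at x)" by blast
  obtain \<xi>' where \<xi>': "\<xi>' \<in> {y..y + real k * \<eta>}"
    "(\<Sum>i=0..k. real (k choose i) * (-1) ^ (k - i) * D' m (y + real i * \<eta>)) = \<eta> ^ k * D' (k + m) \<xi>'"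
    using Suc.IH[of D', OF D'_deriv] by blast
  have "\<exists>\<xi>\<in>{\<xi>'..\<xi>' + \<eta>}. D' (k + m) \<xi>' = \<eta> * D (Suc (k + m)) \<xi>"
  proof (cases "\<eta> = 0")
    case False
    then have "\<xi>' < \<xi>' + \<eta>" using \<eta> by simp
    from MVT2[OF this, of "D (k + m)" "D (Suc (k + m))"] Suc.prems
    obtain z where "\<xi>' < z" "z < \<xi>' + \<eta>" "D (k + m) (\<xi>' + \<eta>) - D (k + m) \<xi>' = (\<xi>' + \<eta> - \<xi>') * D (Suc (k + m)) z" by blast
    then show ?thesis by (intro bexI[of _ z]) (auto simp: D'_def)
  qed (auto simp: D'_def)
  then obtain \<xi> where \<xi>: "\<xi> \<in> {\<xi>'..\<xi>' + \<eta>}" "D' (k + m) \<xi>' = \<eta> * D (Suc (k + m)) \<xi>" by blast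
  have "(\<Sum>i=0..Suc k. real (Suc k choose i) * (-1) ^ (Suc k - i) * D m (y + real i * \<eta>))
    = (\<Sum>i=0..k. real (k choose i) * (-1) ^ (k - i) * D' m (y + real i * \<eta>))"
    unfolding alternating_sum_Suc D'_def by (simp add: algebra_simps)
  also have "\<dots> = \<eta> ^ Suc k * D (Suc k + m) \<xi>" by (simp add: \<xi>' \<xi>)
  finally show ?case using \<xi> \<xi>' by (intro bexI[of _ \<xi>]) (auto simp: algebra_simps)
qed auto

lemma sym_diff_mean_value:
  assumes "0 \<le> \<eta>" "{x - real k * \<eta> / 2..x + real k * \<eta> / 2} \<subseteq> S"
  shows "\<exists>\<xi>\<in>{x - real k * \<eta> / 2..x + real k * \<eta> / 2}. sym_diff k \<eta> (poly_deriv r P) x S = \<eta> ^ k * poly_deriv (k + r) P \<xi>"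
proof -
  have "(poly_deriv m P has_real_derivative poly_deriv (Suc m) P x) (at x)" for m x
    by (simp add: poly_DERIV)
  from difference_mean_value[of "\<lambda>m. poly_deriv m P", OF this assms(1), of "x - real k * \<eta> / 2" k r]
  obtain \<xi> where \<xi>: "\<xi> \<in> {x - real k * \<eta> / 2..x - real k * \<eta> / 2 + real k * \<eta>}"
    "(\<Sum>i=0..k. real (k choose i) * (-1) ^ (k - i) * poly_deriv r P (x - real k * \<eta> / 2 + real i * \<eta>)) = \<eta> ^ k * poly_deriv (k + r) P \<xi>"
    by blast
  show ?thesis
  proof (rule bexI[of _ \<xi>])
    show "sym_diff k \<eta> (poly_deriv r P) x S = \<eta> ^ k * poly_deriv (k + r) P \<xi>"
      using assms(2) \<xi>(2) by (simp add: sym_diff_def)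
  qed (use \<xi>(1) in \<open>unfold atLeastAtMost_iff, linarith\<close>)
qed

lemma sym_diff_outside: "\<not> {x - real k * \<eta> / 2..x + real k * \<eta> / 2} \<subseteq> S \<Longrightarrow> sym_diff k \<eta> g x S = 0"
  by (simp add: sym_diff_def)

lemma phi_angle: "x \<in> {-1..1} \<Longrightarrow> \<phi> x = sin (angle x)"
proof -
  assume x: "x \<in> {-1..1}"
  have "x\<^sup>2 = (cos (angle x))\<^sup>2" by (subst cos_angle[OF x, symmetric]) simp
  then have "\<phi> x = sqrt ((sin (angle x))\<^sup>2)" by (simp add: \<phi>_def sin_squared_eq)
  moreover have "0 \<le> sin (angle x)" using angle_bounds[of x] by (intro sin_ge_zero) auto
  ultimately show ?thesis by simp
qed

lemma phi_nonneg: "x \<in> {-1..1} \<Longrightarrow> 0 \<le> \<phi> x"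
  unfolding \<phi>_def by (intro real_sqrt_ge_zero) (auto simp: abs_square_le_1 abs_le_iff)

lemma phi_sq: "x \<in> {-1..1} \<Longrightarrow> (\<phi> x)\<^sup>2 = (1 - x) * (1 + x)"
  using phi_nonneg[of x] unfolding \<phi>_def
  by (subst real_sqrt_pow2) (auto simp: abs_square_le_1 abs_le_iff power2_eq_square algebra_simps)

lemma measurable_phi[measurable]: "\<phi> \<in> borel_measurable borel"
  unfolding \<phi>_def by measurable

text \<open>With \<open>x = - cos \<theta>\<close> and \<open>y = - cos \<tau>\<close>, \<open>\<bar>y - x\<bar>\<close> is twice the product of the sines of the half difference and
  the half sum, and \<open>\<phi> x = sin \<theta>\<close> is at most twice the sine of the half sum.\<close>
lemma angle_close:
  assumes x: "x \<in> {-1..1}" and y: "y \<in> {-1..1}" and close: "\<bar>y - x\<bar> \<le> \<kappa> * \<phi> x" and \<kappa>: "0 \<le> \<kappa>"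
  shows "\<bar>angle x - angle y\<bar> \<le> 4 * \<kappa>"
proof -
  define \<theta> where "\<theta> = angle x"
  define \<tau> where "\<tau> = angle y"
  have \<theta>: "0 \<le> \<theta>" "\<theta> \<le> pi" and \<tau>: "0 \<le> \<tau>" "\<tau> \<le> pi" using angle_bounds by (auto simp: \<theta>_def \<tau>_def)
  define m where "m = sin ((\<theta> + \<tau>) / 2)"
  define d where "d = sin ((\<theta> - \<tau>) / 2)"
  have "y - x = cos \<theta> - cos \<tau>" using cos_angle[OF x] cos_angle[OF y] by (simp add: \<theta>_def \<tau>_def)
  also have "\<dots> = - 2 * m * d"
    unfolding cos_diff_cos m_def d_def using sin_minus[of "(\<theta> - \<tau>) / 2"] by (simp add: minus_divide_left)
  finally have "\<bar>y - x\<bar> = 2 * \<bar>m\<bar> * \<bar>d\<bar>" by (simp add: abs_mult)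
  moreover have m0: "0 \<le> m" unfolding m_def using \<theta> \<tau> by (intro sin_ge_zero) auto
  ultimately have 1: "2 * m * \<bar>d\<bar> \<le> \<kappa> * sin \<theta>" using close phi_angle[OF x] by (simp add: \<theta>_def)
  have "sin \<theta> + sin \<tau> = 2 * m * cos ((\<theta> - \<tau>) / 2)" by (simp add: sin_plus_sin m_def)
  also have "\<dots> \<le> 2 * m * 1" by (intro mult_left_mono) (use m0 in auto)
  finally have 2: "sin \<theta> \<le> 2 * m" using sin_ge_zero[OF \<tau>] by linarith
  have small: "\<bar>d\<bar> \<le> \<kappa>" if "m > 0"
  proof -
    have "2 * m * \<bar>d\<bar> \<le> 2 * m * \<kappa>" using 1 mult_left_mono[OF 2 \<kappa>] by (simp add: mult_ac)
    then show ?thesis using that by simp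
  qed
  show ?thesis
  proof (cases "m = 0")
    case True
    then have "sin \<theta> \<le> 0" using 2 by simp
    then have "\<kappa> * sin \<theta> \<le> 0" using \<kappa> by (simp add: mult_nonneg_nonpos)
    then have "x = y" using close phi_angle[OF x] by (simp add: \<theta>_def)
    then show ?thesis using \<kappa> by simp
  next
    case False
    then have "\<bar>d\<bar> \<le> \<kappa>" using m0 small by simp
    moreover have "\<bar>\<theta> - \<tau>\<bar> / 4 \<le> \<bar>d\<bar>" unfolding d_def using \<theta> \<tau> by (intro abs_sin_half_ge) auto
    ultimately show ?thesis by (simp add: \<theta>_def \<tau>_def)
  qed
qed

text \<open>At \<open>x = 1\<close> and \<open>x = -1\<close> both sides vanish for \<open>m > 0\<close> because \<open>0 powr y = 0\<close> for every \<open>y\<close>.\<close>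
lemma jacobi_w_phi_power:
  assumes x: "x \<in> {-1..1}"
  shows "jacobi_w \<alpha> \<beta> x * \<phi> x ^ m = jacobi_w (\<alpha> + real m / 2) (\<beta> + real m / 2) x"
proof (cases "m = 0")
  case False
  have 1: "\<phi> x = sqrt ((1 - x) * (1 + x))" using phi_sq[OF x] phi_nonneg[OF x] by (metis real_sqrt_abs abs_of_nonneg)
  show ?thesis
  proof (cases "x = 1 \<or> x = -1")
    case True
    then show ?thesis using False by (auto simp: jacobi_w_def \<phi>_def)
  next
    case inside: False
    have pos: "0 < 1 - x" "0 < 1 + x" using inside x by auto
    have "\<phi> x = (1 - x) powr (1/2) * (1 + x) powr (1/2)"
      using pos by (simp add: 1 powr_half_sqrt real_sqrt_mult)
    then have "\<phi> x ^ m = (1 - x) powr (real m / 2) * (1 + x) powr (real m / 2)"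
      using pos by (simp add: power_mult_distrib powr_powr flip: powr_realpow)
    then show ?thesis by (simp add: jacobi_w_def powr_add)
  qed
qed simp

lemma measurable_sym_diff:
  fixes h :: real
  assumes [measurable]: "g \<in> borel_measurable borel"
  shows "(\<lambda>x. sym_diff k (h * \<phi> x) g x {l..u}) \<in> borel_measurable borel"
  unfolding sym_diff_def atLeastatMost_subset_iff by measurable

lemma measurable_poly[measurable]: "poly (Q :: real poly) \<in> borel_measurable borel"
  by (intro borel_measurable_continuous_onI continuous_intros)

lemma measurable_W[measurable]: "\<W> \<delta> \<xi> \<zeta> \<in> borel_measurable borel"
  unfolding \<W>_def by measurable

text \<open>The majorant belongs to the derivative of order \<open>k + r\<close>, in the angle; the lemmas here state its properties
  in terms of points of \<open>{-1..1}\<close>.\<close>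
locale majorized_derivative =
  slow_majorant n C "\<lambda>\<tau>. poly ((pderiv ^^ (k + r)) P) (- cos \<tau>)" B
  for n k r :: nat and C :: real and P :: "real poly" and B :: "real \<Rightarrow> real"
begin

abbreviation Q :: "real poly" where "Q \<equiv> (pderiv ^^ (k + r)) P"

lemma Q_le: "x \<in> {-1..1} \<Longrightarrow> \<bar>poly Q x\<bar> \<le> B (angle x)"
  using T_le[OF angle_bounds, of x] by (simp add: cos_angle)

lemma Q_lipschitz:
  "\<lbrakk>x \<in> {-1..1}; y \<in> {-1..1}; \<bar>angle x - angle y\<bar> \<le> 1 / real n\<rbrakk>
    \<Longrightarrow> \<bar>poly Q x - poly Q y\<bar> \<le> real n * \<bar>angle x - angle y\<bar> * B (angle x)"
  using T_lipschitz[OF angle_bounds angle_bounds, of x y] by (simp add: cos_angle)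

lemma B_angle_slow: "\<bar>angle x - angle y\<bar> \<le> 1 / real n \<Longrightarrow> B (angle x) \<le> C * B (angle y)"
  using B_slow[OF angle_bounds angle_bounds] .

text \<open>The intermediate point of the mean value theorem is at angular distance at most \<open>2 * k * h\<close>, which is in
  reach of the majorant. The first estimate serves the upper bounds, the second the lower ones, where \<open>k * h *
  n\<close> is small.\<close>
lemma sym_diff_estimates:
  assumes h: "0 \<le> h" "2 * real k * h \<le> 1 / real n" and x: "x \<in> {-1..1}" and S: "S \<subseteq> {-1..1}"
    and sub: "{x - real k * (h * \<phi> x) / 2..x + real k * (h * \<phi> x) / 2} \<subseteq> S"
  shows "\<bar>sym_diff k (h * \<phi> x) (poly_deriv r P) x S\<bar> \<le> C * h ^ k * \<phi> x ^ k * B (angle x)"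
    "\<bar>sym_diff k (h * \<phi> x) (poly_deriv r P) x S - h ^ k * \<phi> x ^ k * poly Q x\<bar> \<le> h ^ k * \<phi> x ^ k * (2 * real k * h * real n * B (angle x))"
proof -
  have \<phi>0: "0 \<le> \<phi> x" by (rule phi_nonneg[OF x])
  obtain \<xi> where \<xi>: "\<xi> \<in> {x - real k * (h * \<phi> x) / 2..x + real k * (h * \<phi> x) / 2}"
    and eq: "sym_diff k (h * \<phi> x) (poly_deriv r P) x S = (h * \<phi> x) ^ k * poly Q \<xi>"
    using sym_diff_mean_value[OF _ sub, of r P] h \<phi>0 by auto
  have \<xi>1: "\<xi> \<in> {-1..1}" using \<xi> sub S by blast
  define z where "z = real k * (h * \<phi> x) / 2"
  have "\<bar>\<xi> - x\<bar> \<le> z" using \<xi> unfolding z_def[symmetric] by auto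
  also have "z = (real k * h / 2) * \<phi> x" by (simp add: z_def)
  finally have "\<bar>angle x - angle \<xi>\<bar> \<le> 4 * (real k * h / 2)" using h by (intro angle_close x \<xi>1) auto
  also have "4 * (real k * h / 2) = 2 * real k * h" by simp
  finally have cl: "\<bar>angle x - angle \<xi>\<bar> \<le> 2 * real k * h" .
  then have cl': "\<bar>angle x - angle \<xi>\<bar> \<le> 1 / real n" using h by linarith
  then have cl'': "\<bar>angle \<xi> - angle x\<bar> \<le> 1 / real n" by (simp add: abs_minus_commute)
  have p0: "0 \<le> h ^ k * \<phi> x ^ k" using h \<phi>0 by simp
  have "\<bar>poly Q \<xi>\<bar> \<le> C * B (angle x)" using Q_le[OF \<xi>1] B_angle_slow[OF cl''] by linarith
  then have "h ^ k * \<phi> x ^ k * \<bar>poly Q \<xi>\<bar> \<le> h ^ k * \<phi> x ^ k * (C * B (angle x))" using p0 by (rule mult_left_mono)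
  then show "\<bar>sym_diff k (h * \<phi> x) (poly_deriv r P) x S\<bar> \<le> C * h ^ k * \<phi> x ^ k * B (angle x)"
    using p0 h \<phi>0 by (simp add: eq power_mult_distrib abs_mult mult_ac)
  have "\<bar>poly Q \<xi> - poly Q x\<bar> \<le> real n * \<bar>angle x - angle \<xi>\<bar> * B (angle x)" using Q_lipschitz[OF x \<xi>1 cl'] by (simp add: abs_minus_commute)
  also have "\<dots> \<le> real n * (2 * real k * h) * B (angle x)" by (intro mult_right_mono mult_left_mono cl B_nonneg) auto
  finally have "\<bar>poly Q \<xi> - poly Q x\<bar> \<le> 2 * real k * h * real n * B (angle x)" by (simp add: mult_ac)
  then have "h ^ k * \<phi> x ^ k * \<bar>poly Q \<xi> - poly Q x\<bar> \<le> h ^ k * \<phi> x ^ k * (2 * real k * h * real n * B (angle x))"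
    using p0 by (rule mult_left_mono)
  moreover have "\<bar>sym_diff k (h * \<phi> x) (poly_deriv r P) x S - h ^ k * \<phi> x ^ k * poly Q x\<bar> = h ^ k * \<phi> x ^ k * \<bar>poly Q \<xi> - poly Q x\<bar>"
  proof -
    have "sym_diff k (h * \<phi> x) (poly_deriv r P) x S - h ^ k * \<phi> x ^ k * poly Q x = h ^ k * \<phi> x ^ k * (poly Q \<xi> - poly Q x)"
      by (simp add: eq power_mult_distrib algebra_simps)
    then show ?thesis using abs_mult[of "h ^ k * \<phi> x ^ k" "poly Q \<xi> - poly Q x"] abs_of_nonneg[OF p0] by simp
  qed
  ultimately show "\<bar>sym_diff k (h * \<phi> x) (poly_deriv r P) x S - h ^ k * \<phi> x ^ k * poly Q x\<bar> \<le> h ^ k * \<phi> x ^ k * (2 * real k * h * real n * B (angle x))"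
    by simp
qed

end

text \<open>At angular distance \<open>\<epsilon> / n\<close> or more from the ends, \<open>1 - \<bar>x\<bar>\<close> is at least \<open>(\<epsilon> / n)\<^sup>2 / 8\<close>. A step that is
  small against \<open>\<epsilon> / n\<close> therefore stays inside the domain of each of the three differences and does not change
  the weights essentially.\<close>
lemma inner_geometry:
  assumes n: "1 \<le> n" and \<epsilon>: "0 < \<epsilon>" "\<epsilon> \<le> 1/2" and x: "x \<in> {- cos (\<epsilon> / real n)..cos (\<epsilon> / real n)}"
    and h: "0 \<le> h" "8 * real k * h \<le> \<epsilon> / real n" and A: "0 \<le> A" "32 * A * h\<^sup>2 \<le> (\<epsilon> / real n)\<^sup>2"
  shows "x \<in> {-1..1}" "real k * h * \<phi> x / 2 \<le> (1 - \<bar>x\<bar>) / 4" "A * h\<^sup>2 \<le> (1 - \<bar>x\<bar>) / 4" "0 < 1 - \<bar>x\<bar>"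
proof -
  define s where "s = \<epsilon> / real n"
  define D where "D = 1 - \<bar>x\<bar>"
  have "\<epsilon> / real n \<le> \<epsilon> / 1" using \<epsilon>(1) n by (intro divide_left_mono) simp_all
  then have "s \<le> \<epsilon>" unfolding s_def by (simp only: div_by_1)
  moreover have "0 < s" unfolding s_def using n by (intro divide_pos_pos \<epsilon>(1)) (simp only: of_nat_0_less_iff)
  ultimately have s: "0 < s" "s \<le> 1/2" using \<epsilon>(2) by linarith+
  have s2: "0 < s\<^sup>2" using s by simp
  have "s\<^sup>2 / 8 \<le> 1 - cos s" using s pi_gt3 by (intro one_minus_cos_bounds) auto
  moreover have "\<bar>x\<bar> \<le> cos s" using x unfolding s_def[symmetric] atLeastAtMost_iff by linarith
  ultimately have D: "s\<^sup>2 / 8 \<le> D" unfolding D_def by linarith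
  then show D0: "0 < 1 - \<bar>x\<bar>" using s2 unfolding D_def by linarith
  then show x1: "x \<in> {-1..1}" unfolding atLeastAtMost_iff by linarith
  show "A * h\<^sup>2 \<le> (1 - \<bar>x\<bar>) / 4" using A D unfolding s_def[symmetric] D_def[symmetric] by linarith
  have "(1 - x) * (1 + x) \<le> 2 * D"
  proof -
    have "(1 - x) * (1 + x) = (1 - \<bar>x\<bar>) * (1 + \<bar>x\<bar>)" by (simp add: abs_if)
    also have "\<dots> \<le> (1 - \<bar>x\<bar>) * 2" using D0 by (intro mult_left_mono) auto
    finally show ?thesis by (simp add: D_def)
  qed
  then have ph: "(\<phi> x)\<^sup>2 \<le> 2 * D" using phi_sq[OF x1] by simp
  have "(8 * real k * h)\<^sup>2 \<le> s\<^sup>2" using h(2)[folded s_def] h(1) by (intro power_mono mult_nonneg_nonneg) simp_all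
  then have kh: "8 * (real k * h)\<^sup>2 \<le> D" using D by (simp add: power_mult_distrib)
  have "(real k * h * \<phi> x / 2)\<^sup>2 = (real k * h)\<^sup>2 * (\<phi> x)\<^sup>2 / 4" by (simp add: power_mult_distrib power_divide)
  also have "\<dots> \<le> (D / 8) * (2 * D) / 4" using kh ph D0[folded D_def] by (intro divide_right_mono mult_mono) simp_all
  also have "\<dots> = (D / 4)\<^sup>2" by (simp add: power2_eq_square)
  finally show "real k * h * \<phi> x / 2 \<le> (1 - \<bar>x\<bar>) / 4"
    unfolding D_def[symmetric] by (rule power2_le_imp_le) (use D0[folded D_def] in simp)
qed

lemma Lp_norm_bounded_finite:
  assumes p: "0 < p" and [measurable]: "f \<in> borel_measurable borel" and m: "\<And>x. x \<in> {l..u} \<Longrightarrow> \<bar>f x\<bar> \<le> m"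
  shows "Lp_norm p {l..u::real} f \<noteq> \<infinity>"
proof (cases "p = \<infinity>")
  case True
  have "esssup (lebesgue_on {l..u}) (\<lambda>x. ennreal \<bar>f x\<bar>) \<le> ennreal m"
    by (rule esssup_I) (use m in \<open>auto intro!: measurable_lebesgue_on AE_I2 ennreal_leI\<close>)
  then show ?thesis using True ennreal_less_top[of m] by (auto simp: Lp_norm_def top_unique)
next
  case False
  have "power_integral (enn2real p) {l..u} (\<lambda>x. \<bar>f x\<bar>) \<le> power_integral (enn2real p) {l..u} (\<lambda>x. \<bar>m\<bar>)"
    by (intro set_nn_integral_le ennreal_leI powr_mono2) (use m in \<open>fastforce+\<close>)
  also have "\<dots> < \<infinity>" by (simp add: nn_integral_cmult emeasure_lborel_Icc_eq ennreal_mult_less_top)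
  finally show ?thesis unfolding Lp_norm_finite[OF False, of "{l..u}", simplified] by auto
qed

text \<open>On \<open>{-s..s}\<close> the weighted \<open>Q\<close> is at most a multiple of \<open>F\<close> plus \<open>\<sigma>\<close> times the weighted majorant. The norm of
  the latter is at most \<open>C\<close> times the norm of the weighted \<open>Q\<close> over the same set, so it is absorbed for small
  \<open>\<sigma>\<close>.\<close>
lemma (in majorized_derivative) lower_bound_from_difference:
  fixes F d :: "real \<Rightarrow> real"
  assumes p: "min 1 p = ennreal q" and q: "0 < q" "q \<le> 1"
    and [measurable]: "F \<in> borel_measurable borel" "d \<in> borel_measurable borel" "S \<in> sets borel"
    and s: "0 \<le> s" "s < 1" and sub: "{-s..s} \<subseteq> S"
    and maj: "Lp_norm p {-1..1} (\<lambda>x. jacobi_w a b x * B (angle x)) \<le> ennreal C * Lp_norm p {-s..s} (\<lambda>x. jacobi_w a b x * poly Q x)"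
    and w: "a = \<alpha> + real (k + r) / 2" "b = \<beta> + real (k + r) / 2"
    and h: "0 < h" and \<kappa>: "0 < \<kappa>" and \<sigma>: "0 < \<sigma>" "4 powr (1/q) * 2 * (\<sigma> * C) \<le> 1 / 2"
    and F: "\<And>x. x \<in> {-s..s} \<Longrightarrow> \<kappa> * (jacobi_w \<alpha> \<beta> x * \<phi> x ^ r) * \<bar>d x\<bar> \<le> \<bar>F x\<bar>"
    and d: "\<And>x. x \<in> {-s..s} \<Longrightarrow> \<bar>d x - h ^ k * \<phi> x ^ k * poly Q x\<bar> \<le> h ^ k * \<phi> x ^ k * (\<sigma> * B (angle x))"
  shows "Lp_norm p {-1..1} (\<lambda>x. jacobi_w a b x * poly Q x) \<le> ennreal (C * (2 * (4 powr (1/q) * 2)) * (1 / (\<kappa> * h ^ k))) * Lp_norm p S F"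
proof -
  define K where "K = 4 powr (1/q) * 2"
  have K: "0 < K" by (simp add: K_def)
  define e where "e = 1 / (\<kappa> * h ^ k)"
  have e: "0 < e" using \<kappa> h by (simp add: e_def)
  have p0: "0 < p" using p q by (cases "p = 0") (auto simp: zero_less_iff_neq_zero min_def)
  have qp: "ennreal q \<le> p" using p min.cobounded2[of 1 p] by simp
  let ?wQ = "\<lambda>x. jacobi_w a b x * poly Q x"
  let ?wB = "\<lambda>x. jacobi_w a b x * B (angle x)"
  define X where "X = Lp_norm p {-s..s} ?wQ"
  have sub1: "{-s..s} \<subseteq> {-1..1}" using s by auto
  have pt: "\<bar>?wQ x\<bar> \<le> \<bar>(1 / (\<kappa> * h ^ k)) * F x\<bar> + \<bar>\<sigma> * ?wB x\<bar>" if x: "x \<in> {-s..s}" for x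
  proof -
    have x1: "x \<in> {-1..1}" using x sub1 by blast
    define v where "v = jacobi_w \<alpha> \<beta> x * \<phi> x ^ r"
    have v: "0 \<le> v" using jacobi_w_nonneg phi_nonneg[OF x1] by (simp add: v_def)
    have wab: "jacobi_w a b x = v * \<phi> x ^ k"
      unfolding v_def w using jacobi_w_phi_power[OF x1, of \<alpha> \<beta> "k + r"] by (simp add: power_add mult_ac)
    have hk: "0 < h ^ k" using h by simp
    have "h ^ k * \<phi> x ^ k * \<bar>poly Q x\<bar> \<le> \<bar>d x\<bar> + h ^ k * \<phi> x ^ k * (\<sigma> * B (angle x))"
    proof -
      have p0: "0 \<le> h ^ k * \<phi> x ^ k" using h phi_nonneg[OF x1] by simp
      have "\<bar>h ^ k * \<phi> x ^ k * poly Q x\<bar> \<le> \<bar>d x\<bar> + h ^ k * \<phi> x ^ k * (\<sigma> * B (angle x))"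
        using d[OF x] by linarith
      then show ?thesis using p0 by (simp only: abs_mult[of _ "poly Q x"] abs_of_nonneg[OF p0])
    qed
    then have "\<kappa> * v * (h ^ k * \<phi> x ^ k * \<bar>poly Q x\<bar>) \<le> \<kappa> * v * (\<bar>d x\<bar> + h ^ k * \<phi> x ^ k * (\<sigma> * B (angle x)))"
      using v \<kappa> by (intro mult_left_mono) auto
    also have "\<dots> = \<kappa> * v * \<bar>d x\<bar> + \<kappa> * h ^ k * (\<sigma> * ?wB x)" by (simp add: wab algebra_simps)
    also have "\<dots> \<le> \<bar>F x\<bar> + \<kappa> * h ^ k * (\<sigma> * ?wB x)" using F[OF x] by (simp add: v_def)
    finally have "\<kappa> * h ^ k * \<bar>?wQ x\<bar> \<le> \<bar>F x\<bar> + \<kappa> * h ^ k * (\<sigma> * ?wB x)"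
      using v phi_nonneg[OF x1] by (simp add: wab abs_mult mult_ac)
    then have "\<bar>?wQ x\<bar> \<le> (\<bar>F x\<bar> + \<kappa> * h ^ k * (\<sigma> * ?wB x)) / (\<kappa> * h ^ k)"
      using \<kappa> hk by (simp add: pos_le_divide_eq mult_ac)
    also have "\<dots> = \<bar>F x\<bar> / (\<kappa> * h ^ k) + \<sigma> * ?wB x"
      using \<kappa> hk h by (simp add: add_divide_distrib)
    also have "\<dots> = \<bar>(1 / (\<kappa> * h ^ k)) * F x\<bar> + \<bar>\<sigma> * ?wB x\<bar>"
      using \<kappa> hk \<sigma> B_nonneg[of "angle x"] jacobi_w_nonneg[of a b x] by (simp add: abs_mult)
    finally show ?thesis .
  qed
  have "X \<le> ennreal K * (Lp_norm p {-s..s} (\<lambda>x. (1 / (\<kappa> * h ^ k)) * F x) + Lp_norm p {-s..s} (\<lambda>x. \<sigma> * ?wB x))"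
    unfolding X_def K_def by (rule Lp_norm_triangle[OF p0 q(1) qp _ _ _ _ pt]) auto
  also have "Lp_norm p {-s..s} (\<lambda>x. (1 / (\<kappa> * h ^ k)) * F x) \<le> ennreal (1 / (\<kappa> * h ^ k)) * Lp_norm p S F"
    using h \<kappa> by (intro Lp_norm_mono p0 sub) (auto simp: abs_mult)
  also have "Lp_norm p {-s..s} (\<lambda>x. \<sigma> * ?wB x) \<le> ennreal \<sigma> * Lp_norm p {-1..1} ?wB"
    using \<sigma> by (intro Lp_norm_mono p0 sub1) (auto simp: abs_mult)
  also have "\<dots> \<le> ennreal \<sigma> * (ennreal C * X)" unfolding X_def by (intro mult_left_mono maj) auto
  finally have "X \<le> ennreal K * (ennreal (1 / (\<kappa> * h ^ k)) * Lp_norm p S F + ennreal \<sigma> * (ennreal C * X))"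
    by (simp add: add_mono mult_left_mono)
  also have "\<dots> = ennreal (K * (1 / (\<kappa> * h ^ k))) * Lp_norm p S F + ennreal (K * (\<sigma> * C)) * X"
    using K e \<sigma> C_ge unfolding e_def[symmetric] by (simp add: distrib_left ennreal_mult mult.assoc)
  finally have "X \<le> 2 * (ennreal (K * (1 / (\<kappa> * h ^ k))) * Lp_norm p S F)"
  proof (rule ennreal_absorb)
    have "bounded (?wQ ` {-s..s})"
      unfolding jacobi_w_def using s
      by (intro compact_imp_bounded compact_continuous_image continuous_intros) auto
    then obtain m where "\<forall>x\<in>{-s..s}. \<bar>?wQ x\<bar> \<le> m" by (auto simp: bounded_iff)
    then have "\<And>x. x \<in> {-s..s} \<Longrightarrow> \<bar>?wQ x\<bar> \<le> m" by blast
    then show "X \<noteq> \<infinity>" unfolding X_def by (intro Lp_norm_bounded_finite[where m = m] p0) auto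
  qed (use K \<sigma> C_ge in \<open>auto simp: K_def\<close>)
  also have "\<dots> = ennreal (2 * K * (1 / (\<kappa> * h ^ k))) * Lp_norm p S F"
    using K e unfolding e_def[symmetric] by (simp add: ennreal_mult mult.assoc)
  finally have X: "X \<le> ennreal (2 * K * (1 / (\<kappa> * h ^ k))) * Lp_norm p S F" .
  have "Lp_norm p {-1..1} ?wQ \<le> ennreal 1 * Lp_norm p {-1..1} ?wB"
  proof (intro Lp_norm_mono p0)
    fix x :: real assume "x \<in> {-1..1}"
    then show "\<bar>?wQ x\<bar> \<le> 1 * \<bar>?wB x\<bar>" using Q_le[of x] B_nonneg[of "angle x"] jacobi_w_nonneg[of a b x]
      by (simp add: abs_mult mult_left_mono)
  qed auto
  also have "\<dots> \<le> ennreal C * X" using maj by (simp add: X_def)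
  also have "\<dots> \<le> ennreal C * (ennreal (2 * K * (1 / (\<kappa> * h ^ k))) * Lp_norm p S F)" by (intro mult_left_mono X) auto
  finally show ?thesis using C_ge K e unfolding e_def[symmetric] K_def[symmetric] by (simp add: ennreal_mult mult.assoc)
qed

section \<open>The singular weight at the ends of the interval\<close>

text \<open>The weight \<open>\<W> \<delta> \<xi> \<zeta>\<close> cut off to the points where the difference is defined; there both bases are
  nonnegative.\<close>
definition cut_W :: "real \<Rightarrow> real \<Rightarrow> real \<Rightarrow> real \<Rightarrow> real" where
  "cut_W \<delta> \<xi> \<zeta> x = (if \<delta> * \<phi> x / 2 \<le> 1 - x \<and> \<delta> * \<phi> x / 2 \<le> 1 + x then \<W> \<delta> \<xi> \<zeta> x else 0)"

lemma measurable_cut_W[measurable]: "cut_W \<delta> \<xi> \<zeta> \<in> borel_measurable borel"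
  unfolding cut_W_def by measurable

lemma cut_W_nonneg: "0 \<le> cut_W \<delta> \<xi> \<zeta> x"
  by (simp add: cut_W_def \<W>_def)

lemma phi_minus: "\<phi> (- x) = \<phi> x"
  by (simp add: \<phi>_def)

lemma cut_W_minus: "cut_W \<delta> \<xi> \<zeta> (- x) = cut_W \<delta> \<zeta> \<xi> x"
  by (auto simp: cut_W_def \<W>_def phi_minus)

lemma jacobi_w_minus: "jacobi_w a b (- x) = jacobi_w b a x"
  by (simp add: jacobi_w_def)

lemma half_step_sq: "x \<in> {-1..1} \<Longrightarrow> (\<delta> * \<phi> x / 2)\<^sup>2 = (\<delta>\<^sup>2 / 4) * (1 - x) * (1 + x)"
  using phi_sq[of x] by (simp add: power_mult_distrib power_divide)

lemma half_step_le:
  assumes x: "x \<in> {-1..1}" and u: "2 * \<delta>\<^sup>2 \<le> 1 - x"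
  shows "\<delta> * \<phi> x / 2 \<le> (1 - x) / 2"
proof (rule power2_le_imp_le)
  have "(\<delta> * \<phi> x / 2)\<^sup>2 = (\<delta>\<^sup>2 / 4) * (1 - x) * (1 + x)" by (rule half_step_sq[OF x])
  also have "\<dots> \<le> ((1 - x) / 8) * (1 - x) * 2"
    using x u by (intro mult_mono) auto
  also have "\<dots> = ((1 - x) / 2)\<^sup>2" by (simp add: power2_eq_square)
  finally show "(\<delta> * \<phi> x / 2)\<^sup>2 \<le> ((1 - x) / 2)\<^sup>2" .
  show "0 \<le> (1 - x) / 2" using x by simp
qed

text \<open>At distance \<open>2 * \<delta>\<^sup>2\<close> or more from the ends, \<open>\<delta> * \<phi> x / 2\<close> is at most half of that distance.\<close>
lemma W_le_jacobi_w:
  assumes x: "x \<in> {-1..1}" and \<delta>: "0 \<le> \<delta>" and u: "2 * \<delta>\<^sup>2 \<le> 1 - x" "2 * \<delta>\<^sup>2 \<le> 1 + x"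
  shows "\<W> \<delta> \<xi> \<zeta> x \<le> 2 powr (\<bar>\<xi>\<bar> + \<bar>\<zeta>\<bar>) * jacobi_w \<xi> \<zeta> x"
proof (cases "\<delta> = 0")
  case True
  have "1 * jacobi_w \<xi> \<zeta> x \<le> 2 powr (\<bar>\<xi>\<bar> + \<bar>\<zeta>\<bar>) * jacobi_w \<xi> \<zeta> x"
    by (intro mult_right_mono ge_one_powr_ge_zero jacobi_w_nonneg) auto
  then show ?thesis using True by (simp add: \<W>_def jacobi_w_def)
next
  case False
  then have d: "0 < \<delta>\<^sup>2" by simp
  define z where "z = \<delta> * \<phi> x / 2"
  have z0: "0 \<le> z" using \<delta> phi_nonneg[OF x] by (simp add: z_def)
  have z1: "2 * z \<le> 1 - x" using half_step_le[OF x u(1)] by (simp add: z_def)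
  have x': "- x \<in> {-1..1}" using x by auto
  have z2: "2 * z \<le> 1 + x" using half_step_le[OF x', of \<delta>] u by (simp add: z_def phi_minus)
  have pos: "0 < 1 - x" "0 < 1 + x" using u d by linarith+
  have 1: "(1 - x - z) powr \<xi> \<le> 2 powr \<bar>\<xi>\<bar> * (1 - x) powr \<xi>"
    using pos z0 z1 by (intro powr_ratio_le) (auto simp: algebra_simps)
  have 2: "(1 + x - z) powr \<zeta> \<le> 2 powr \<bar>\<zeta>\<bar> * (1 + x) powr \<zeta>"
    using pos z0 z2 by (intro powr_ratio_le) (auto simp: algebra_simps)
  have "(1 - x - z) powr \<xi> * (1 + x - z) powr \<zeta> \<le> (2 powr \<bar>\<xi>\<bar> * (1 - x) powr \<xi>) * (2 powr \<bar>\<zeta>\<bar> * (1 + x) powr \<zeta>)"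
    by (intro mult_mono 1 2) auto
  then show ?thesis by (simp add: \<W>_def jacobi_w_def z_def powr_add mult_ac)
qed

text \<open>The inequality of the arithmetic and geometric means for \<open>1 - x\<close> and \<open>\<delta>\<^sup>2 / 4 * (1 + x)\<close>, whose geometric
  mean is \<open>\<delta> * \<phi> x / 2\<close>.\<close>
lemma end_distance_lower:
  assumes x: "x \<in> {-1..1}"
  shows "((1 - x) - \<delta>\<^sup>2 / 4 * (1 + x)) / 2 \<le> 1 - x - \<delta> * \<phi> x / 2"
proof -
  have "\<delta> * \<phi> x / 2 \<le> ((1 - x) + \<delta>\<^sup>2 / 4 * (1 + x)) / 2"
  proof (rule power2_le_imp_le)
    have "0 \<le> (((1 - x) - \<delta>\<^sup>2 / 4 * (1 + x)) / 2)\<^sup>2" by simp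
    also have "\<dots> = (((1 - x) + \<delta>\<^sup>2 / 4 * (1 + x)) / 2)\<^sup>2 - (\<delta>\<^sup>2 / 4) * (1 - x) * (1 + x)"
      by (simp add: power2_eq_square field_simps)
    finally show "(\<delta> * \<phi> x / 2)\<^sup>2 \<le> (((1 - x) + \<delta>\<^sup>2 / 4 * (1 + x)) / 2)\<^sup>2"
      unfolding half_step_sq[OF x] by linarith
    show "0 \<le> ((1 - x) + \<delta>\<^sup>2 / 4 * (1 + x)) / 2" using x by simp
  qed
  then show ?thesis by (simp add: field_simps)
qed

text \<open>For \<open>\<xi> < 0\<close> the integrand is singular at the zero \<open>xh\<close> of \<open>1 - x - \<delta> * \<phi> x / 2\<close>. By \<open>end_distance_lower\<close> the
  base is at least \<open>(xh - x) / 2\<close>, and \<open>\<xi> * P > -1\<close> makes the power integrable. Beyond \<open>xh\<close> the difference is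
  not defined.\<close>
lemma end_singularity_integral:
  fixes \<delta> \<xi> P :: real
  assumes \<delta>: "0 < \<delta>" "\<delta> \<le> 1 / 4" and P: "0 < P" "-1 < \<xi> * P"
  shows "power_integral P {1 - 2 * \<delta>\<^sup>2..1} (\<lambda>x. if \<delta> * \<phi> x / 2 \<le> 1 - x then (1 - x - \<delta> * \<phi> x / 2) powr \<xi> else 0)
    \<le> ennreal ((1 + 2 powr (\<bar>\<xi>\<bar> * P) / (\<xi> * P + 1)) * (2 * \<delta>\<^sup>2) powr (\<xi> * P + 1))"
proof -
  define R where "R = {1 - 2 * \<delta>\<^sup>2..1}"
  define L where "L = 2 * \<delta>\<^sup>2"
  have L: "0 < L" using \<delta> by (simp add: L_def)
  have L1: "L \<le> 1"
  proof -
    have "\<delta> * \<delta> \<le> (1/4) * (1/4)" using \<delta> by (intro mult_mono) auto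
    then show ?thesis by (simp add: L_def power2_eq_square)
  qed
  have R1: "x \<in> {-1..1}" if "x \<in> R" for x using that L1 unfolding R_def L_def[symmetric] by auto
  have e1: "0 \<le> 2 powr (\<bar>\<xi>\<bar> * P) / (\<xi> * P + 1)" using P by simp
  define g where "g x = (if \<delta> * \<phi> x / 2 \<le> 1 - x then (1 - x - \<delta> * \<phi> x / 2) powr \<xi> else 0) powr P" for x
  show ?thesis
  proof (cases "0 \<le> \<xi>")
    case True
    have "(\<integral>\<^sup>+x\<in>R. ennreal (g x) \<partial>lborel) \<le> power_integral (\<xi> * P) R (\<lambda>x. L)"
    proof (intro set_nn_integral_le ennreal_leI)
      fix x assume x: "x \<in> R"
      have ph: "0 \<le> \<delta> * \<phi> x / 2" using \<delta> phi_nonneg[OF R1[OF x]] by simp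
      have xl: "1 - x \<le> L" using x by (simp add: R_def L_def)
      show "g x \<le> L powr (\<xi> * P)"
      proof (cases "\<delta> * \<phi> x / 2 \<le> 1 - x")
        case v: True
        have "g x = (1 - x - \<delta> * \<phi> x / 2) powr (\<xi> * P)" using v by (simp add: g_def powr_powr)
        also have "\<dots> \<le> L powr (\<xi> * P)"
          using v ph xl True P by (intro powr_mono2 mult_nonneg_nonneg) linarith+
        finally show ?thesis .
      qed (simp add: g_def)
    qed
    also have "\<dots> = ennreal (L powr (\<xi> * P)) * ennreal L"
      using L unfolding R_def L_def[symmetric] by (subst nn_integral_cmult) auto
    also have "\<dots> = ennreal (1 * L powr (\<xi> * P + 1))" using L by (simp add: ennreal_mult powr_add)
    also have "\<dots> \<le> ennreal ((1 + 2 powr (\<bar>\<xi>\<bar> * P) / (\<xi> * P + 1)) * L powr (\<xi> * P + 1))"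
      using e1 by (intro ennreal_leI mult_right_mono) auto
    finally show ?thesis by (simp add: g_def R_def L_def)
  next
    case False
    define e where "e = \<delta>\<^sup>2 / 4"
    have e: "0 < e" using \<delta> by (simp add: e_def)
    \<comment> \<open>The zero of \<open>1 - x - \<delta> * \<phi> x / 2\<close> in the interior of the interval.\<close>
    define xh where "xh = (1 - e) / (1 + e)"
    have xh: "(1 - x) - e * (1 + x) = (1 + e) * (xh - x)" for x
      using e by (simp add: xh_def field_simps)
    have "1 - xh = 2 * e / (1 + e)" using e by (simp add: xh_def field_simps)
    also have "\<dots> \<le> 2 * e / 1" using e by (intro divide_left_mono) auto
    finally have "1 - xh \<le> \<delta>\<^sup>2 / 2" by (simp add: e_def)
    also have "\<delta>\<^sup>2 / 2 \<le> L" by (simp add: L_def)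
    finally have xh1: "1 - xh \<le> L" .
    have "1 - e \<le> 1 + e" using e by simp
    then have xh2: "xh \<le> 1" using e by (simp add: xh_def)
    have gb: "g x \<le> (if x < xh then 2 powr (\<bar>\<xi>\<bar> * P) * (xh - x) powr (\<xi> * P) else 0)" if x: "x \<in> R" for x
    proof -
      note x1 = R1[OF x]
      define y where "y = 1 - x - \<delta> * \<phi> x / 2"
      have ph: "0 \<le> \<delta> * \<phi> x / 2" using \<delta> phi_nonneg[OF x1] by simp
      have g: "g x = (if 0 \<le> y then y powr \<xi> else 0) powr P" by (simp add: g_def y_def)
      show ?thesis
      proof (cases "x < xh")
        case True
        have "1 * (xh - x) \<le> (1 + e) * (xh - x)" using e True by (intro mult_right_mono) auto
        moreover have "((1 - x) - e * (1 + x)) / 2 \<le> y"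
          unfolding y_def e_def by (rule end_distance_lower[OF x1])
        then have "((1 + e) * (xh - x)) / 2 \<le> y" unfolding xh .
        ultimately have y: "(xh - x) / 2 \<le> y" by simp
        then have "0 < y" using True by simp
        then have "g x = y powr (\<xi> * P)" by (simp add: g powr_powr)
        also have "\<dots> \<le> ((xh - x) / 2) powr (\<xi> * P)"
          using y True False P by (intro powr_mono2') (auto simp: mult_nonpos_nonneg)
        also have "\<dots> = 2 powr (\<bar>\<xi>\<bar> * P) * (xh - x) powr (\<xi> * P)"
          using True False by (simp add: powr_divide powr_minus field_simps abs_if)
        finally show ?thesis using True by simp
      next
        case far: False
        have "(1 + e) * (xh - x) \<le> 0" using far e by (simp add: mult_nonneg_nonpos)
        then have "1 - x \<le> e * (1 + x)" unfolding xh[symmetric] by simp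
        then have "(1 - x) * (1 - x) \<le> (1 - x) * (e * (1 + x))" using x1 by (intro mult_left_mono) auto
        also have "\<dots> = (\<delta> * \<phi> x / 2)\<^sup>2" unfolding half_step_sq[OF x1] by (simp add: e_def)
        finally have "(1 - x)\<^sup>2 \<le> (\<delta> * \<phi> x / 2)\<^sup>2" by (simp add: power2_eq_square)
        then have "1 - x \<le> \<delta> * \<phi> x / 2" using ph by (rule power2_le_imp_le)
        then have "y \<le> 0" by (simp add: y_def)
        then have "g x = 0" by (cases "y = 0") (auto simp: g)
        then show ?thesis using far by simp
      qed
    qed
    have m: "(\<lambda>x. ennreal ((xh - x) powr (\<xi> * P))) \<in> borel_measurable borel" by measurable
    have "(\<integral>\<^sup>+x\<in>R. ennreal (g x) \<partial>lborel) \<le> (\<integral>\<^sup>+x\<in>{1 - L..xh}. ennreal (2 powr (\<bar>\<xi>\<bar> * P)) * ennreal ((xh - x) powr (\<xi> * P)) \<partial>lborel)"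
    proof (rule nn_integral_mono)
      fix x
      show "ennreal (g x) * indicator R x \<le> ennreal (2 powr (\<bar>\<xi>\<bar> * P)) * ennreal ((xh - x) powr (\<xi> * P)) * indicator {1 - L..xh} x"
      proof (cases "x \<in> R")
        case True
        then have xR: "1 - L \<le> x" by (simp add: R_def L_def)
        show ?thesis
        proof (cases "x < xh")
          case far: True
          then show ?thesis using gb[OF True] True xR by (simp add: ennreal_mult[symmetric] ennreal_leI)
        next
          case far: False
          then have "ennreal (g x) = 0" using gb[OF True] by (simp add: ennreal_eq_0_iff)
          then show ?thesis by simp
        qed
      qed simp
    qed
    also have "\<dots> = ennreal (2 powr (\<bar>\<xi>\<bar> * P)) * power_integral (\<xi> * P) {1 - L..xh} (\<lambda>x. xh - x)"
      by (rule set_nn_integral_cmult) (use m in auto)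
    also have "power_integral (\<xi> * P) {1 - L..xh} (\<lambda>x. xh - x) = power_integral (\<xi> * P) {0..xh - (1 - L)} (\<lambda>x. x)"
      using set_nn_integral_flip[OF m, of "1 - L" xh xh] by simp
    also have "\<dots> = ennreal ((xh - (1 - L)) powr (\<xi> * P + 1) / (\<xi> * P + 1))"
      using P xh1 by (intro nn_integral_has_integral_lebesgue' has_integral_powr_from_0) auto
    also have "\<dots> \<le> ennreal (L powr (\<xi> * P + 1) / (\<xi> * P + 1))"
      using P xh1 xh2 by (intro ennreal_leI divide_right_mono powr_mono2) auto
    also have "ennreal (2 powr (\<bar>\<xi>\<bar> * P)) * \<dots> = ennreal ((2 powr (\<bar>\<xi>\<bar> * P) / (\<xi> * P + 1)) * L powr (\<xi> * P + 1))"
      using P by (simp add: ennreal_mult[symmetric])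
    also have "\<dots> \<le> ennreal ((1 + 2 powr (\<bar>\<xi>\<bar> * P) / (\<xi> * P + 1)) * L powr (\<xi> * P + 1))"
      by (intro ennreal_leI mult_right_mono) auto
    finally show ?thesis by (simp add: g_def R_def L_def mult_left_mono)
  qed
qed

definition end_const :: "real \<Rightarrow> real \<Rightarrow> nat \<Rightarrow> real \<Rightarrow> real" where
  "end_const \<xi> \<zeta> k P = 2 powr (\<bar>\<zeta>\<bar> * P) * (1 + 2 powr (\<bar>\<xi>\<bar> * P) / (\<xi> * P + 1)) * 2 powr (real k / 2 * P)
     * 2 powr ((\<bar>\<xi> + real k / 2\<bar> + \<bar>\<zeta> + real k / 2\<bar>) * P)"

text \<open>The end piece \<open>R\<close> of length \<open>L = 2 * \<delta>\<^sup>2\<close> is compared with the adjacent interval \<open>R'\<close> of the same length. On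
  \<open>R'\<close> the weight \<open>jacobi_w a b\<close> is of the size \<open>L powr a\<close>, which is also the average size of the singular
  weight on \<open>R\<close>.\<close>
lemma cut_W_end_bound:
  fixes B :: "real \<Rightarrow> real" and \<delta> \<xi> \<zeta> P D :: real and k :: nat
  assumes [measurable]: "B \<in> borel_measurable borel" and B0: "\<And>x. 0 \<le> B x" and D: "0 \<le> D"
    and \<delta>: "0 < \<delta>" "\<delta> \<le> 1 / 4" and P: "0 < P" "-1 < \<xi> * P"
    and slow: "\<And>x y. x \<in> {1 - 4 * \<delta>\<^sup>2..1} \<Longrightarrow> y \<in> {1 - 4 * \<delta>\<^sup>2..1} \<Longrightarrow> B x \<le> D * B y"
  defines "a \<equiv> \<xi> + real k / 2" and "b \<equiv> \<zeta> + real k / 2"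
  shows "power_integral P {1 - 2 * \<delta>\<^sup>2..1} (\<lambda>x. cut_W \<delta> \<xi> \<zeta> x * \<phi> x ^ k * B x)
    \<le> ennreal (end_const \<xi> \<zeta> k P * D powr P) * power_integral P {-1..1} (\<lambda>x. jacobi_w a b x * B x)"
proof -
  define L where "L = 2 * \<delta>\<^sup>2"
  have L: "0 < L" using \<delta> by (simp add: L_def)
  have L1: "L \<le> 1 / 8"
  proof -
    have "\<delta> * \<delta> \<le> (1/4) * (1/4)" using \<delta> by (intro mult_mono) auto
    then show ?thesis by (simp add: L_def power2_eq_square)
  qed
  define R where "R = {1 - L..1}"
  define R' where "R' = {1 - 2 * L..1 - L}"
  define w1 where "w1 x = ennreal ((cut_W \<delta> \<xi> \<zeta> x * \<phi> x ^ k) powr P)" for x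
  define w2 where "w2 x = ennreal (jacobi_w a b x powr P)" for x
  define G where "G x = ennreal (B x powr P)" for x
  have [measurable]: "w1 \<in> borel_measurable borel" "w2 \<in> borel_measurable borel" "G \<in> borel_measurable borel"
    unfolding w1_def w2_def G_def by measurable
  have [measurable]: "R \<in> sets borel" "R' \<in> sets borel" by (auto simp: R_def R'_def)
  have R1: "x \<in> {-1..1}" if "x \<in> R" for x using that L1 unfolding R_def by auto
  have R1': "x \<in> {-1..1}" if "x \<in> R'" for x using that L1 L unfolding R'_def by auto
  define c3 where "c3 = 1 + 2 powr (\<bar>\<xi>\<bar> * P) / (\<xi> * P + 1)"
  have c3: "0 < c3" using P by (simp add: c3_def add_pos_nonneg)
  define g where "g x = (if \<delta> * \<phi> x / 2 \<le> 1 - x then (1 - x - \<delta> * \<phi> x / 2) powr \<xi> else 0)" for x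
  have [measurable]: "g \<in> borel_measurable borel" unfolding g_def by measurable
  have w1b: "w1 x \<le> ennreal (2 powr (\<bar>\<zeta>\<bar> * P) * (2 * L) powr (real k / 2 * P)) * ennreal (g x powr P)" if x: "x \<in> R" for x
  proof -
    note x1 = R1[OF x]
    have ph: "0 \<le> \<phi> x" by (rule phi_nonneg[OF x1])
    have z: "0 \<le> \<delta> * \<phi> x / 2" using \<delta> ph by simp
    have xl: "1 - x \<le> L" using x by (simp add: R_def)
    have "(\<phi> x)\<^sup>2 \<le> L * 2" unfolding phi_sq[OF x1] using x1 xl by (intro mult_mono) auto
    then have "sqrt ((\<phi> x)\<^sup>2) \<le> sqrt (2 * L)" by (intro real_sqrt_le_mono) (simp add: mult.commute)
    then have "\<phi> x \<le> sqrt (2 * L)" using ph by simp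
    then have "\<phi> x ^ k \<le> sqrt (2 * L) ^ k" using ph by (intro power_mono)
    also have "\<dots> = (2 * L) powr (real k / 2)" using L by (simp add: powr_half_sqrt[symmetric] powr_powr flip: powr_realpow)
    finally have phk: "\<phi> x ^ k \<le> (2 * L) powr (real k / 2)" .
    have cW: "cut_W \<delta> \<xi> \<zeta> x \<le> g x * 2 powr \<bar>\<zeta>\<bar>"
    proof (cases "\<delta> * \<phi> x / 2 \<le> 1 - x \<and> \<delta> * \<phi> x / 2 \<le> 1 + x")
      case True
      define y where "y = 1 + x - \<delta> * \<phi> x / 2"
      have y: "1 \<le> y" "y \<le> 2" using True xl L1 z x1 by (auto simp: y_def)
      have "y powr \<zeta> \<le> 2 powr \<bar>\<zeta>\<bar> * 1 powr \<zeta>" using y by (intro powr_ratio_le) auto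
      then have "g x * y powr \<zeta> \<le> g x * 2 powr \<bar>\<zeta>\<bar>" using True by (intro mult_left_mono) (auto simp: g_def)
      then show ?thesis using True by (simp add: cut_W_def \<W>_def g_def y_def)
    qed (auto simp: cut_W_def g_def)
    have "cut_W \<delta> \<xi> \<zeta> x * \<phi> x ^ k \<le> (g x * 2 powr \<bar>\<zeta>\<bar>) * (2 * L) powr (real k / 2)"
      using ph by (intro mult_mono cW phk) (auto simp: g_def)
    then have "(cut_W \<delta> \<xi> \<zeta> x * \<phi> x ^ k) powr P \<le> ((g x * 2 powr \<bar>\<zeta>\<bar>) * (2 * L) powr (real k / 2)) powr P"
      using P ph cut_W_nonneg by (intro powr_mono2) auto
    also have "\<dots> = (2 powr (\<bar>\<zeta>\<bar> * P) * (2 * L) powr (real k / 2 * P)) * g x powr P"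
    proof -
      have "0 \<le> g x" by (simp add: g_def)
      then show ?thesis by (simp add: powr_mult powr_powr mult_ac)
    qed
    finally show ?thesis unfolding w1_def by (simp add: ennreal_mult[symmetric] ennreal_leI)
  qed
  have "(\<integral>\<^sup>+x\<in>R. w1 x \<partial>lborel) \<le> (\<integral>\<^sup>+x\<in>R. ennreal (2 powr (\<bar>\<zeta>\<bar> * P) * (2 * L) powr (real k / 2 * P)) * ennreal (g x powr P) \<partial>lborel)"
    by (intro set_nn_integral_le w1b)
  also have "\<dots> = ennreal (2 powr (\<bar>\<zeta>\<bar> * P) * (2 * L) powr (real k / 2 * P)) * power_integral P R (\<lambda>x. g x)"
    by (rule set_nn_integral_cmult) measurable
  also have "power_integral P R (\<lambda>x. g x) \<le> ennreal (c3 * L powr (\<xi> * P + 1))"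
    unfolding g_def R_def L_def c3_def by (rule end_singularity_integral[OF \<delta> P])
  also have "ennreal (2 powr (\<bar>\<zeta>\<bar> * P) * (2 * L) powr (real k / 2 * P)) * \<dots>
      = ennreal (2 powr (\<bar>\<zeta>\<bar> * P) * (2 * L) powr (real k / 2 * P) * (c3 * L powr (\<xi> * P + 1)))"
    using c3 by (intro ennreal_mult[symmetric]) auto
  finally have I1: "(\<integral>\<^sup>+x\<in>R. w1 x \<partial>lborel) \<le> ennreal (2 powr (\<bar>\<zeta>\<bar> * P) * (2 * L) powr (real k / 2 * P) * (c3 * L powr (\<xi> * P + 1)))"
    by (simp add: mult_left_mono)
  define c2 where "c2 = 2 powr ((\<bar>a\<bar> + \<bar>b\<bar>) * P)"
  have c2: "0 < c2" by (simp add: c2_def)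
  have w2b: "L powr (a * P) \<le> c2 * jacobi_w a b x powr P" "jacobi_w a b x powr P \<le> c2 * L powr (a * P)" if x: "x \<in> R'" for x
  proof -
    have y: "L \<le> 1 - x" "1 - x \<le> 2 * L" "1 \<le> 1 + x" "1 + x \<le> 2" using x L1 L by (auto simp: R'_def)
    have r: "L powr a \<le> 2 powr \<bar>a\<bar> * (1 - x) powr a" "(1 - x) powr a \<le> 2 powr \<bar>a\<bar> * L powr a"
      using y L by (auto intro!: powr_ratio_le)
    have r': "1 powr b \<le> 2 powr \<bar>b\<bar> * (1 + x) powr b" "(1 + x) powr b \<le> 2 powr \<bar>b\<bar> * 1 powr b"
      using y powr_ratio_le[of 1 "1 + x" 2 b] powr_ratio_le[of "1 + x" 1 2 b] by auto
    have "L powr a * 1 powr b \<le> (2 powr \<bar>a\<bar> * (1 - x) powr a) * (2 powr \<bar>b\<bar> * (1 + x) powr b)"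
      by (intro mult_mono r r') auto
    then have "L powr a \<le> 2 powr (\<bar>a\<bar> + \<bar>b\<bar>) * jacobi_w a b x" by (simp add: jacobi_w_def powr_add mult_ac)
    then have "(L powr a) powr P \<le> (2 powr (\<bar>a\<bar> + \<bar>b\<bar>) * jacobi_w a b x) powr P" using P by (intro powr_mono2) auto
    then show "L powr (a * P) \<le> c2 * jacobi_w a b x powr P" using jacobi_w_nonneg by (simp add: c2_def powr_mult powr_powr)
    have "(1 - x) powr a * (1 + x) powr b \<le> (2 powr \<bar>a\<bar> * L powr a) * (2 powr \<bar>b\<bar> * 1 powr b)"
      by (intro mult_mono r r') auto
    then have "jacobi_w a b x \<le> 2 powr (\<bar>a\<bar> + \<bar>b\<bar>) * L powr a" by (simp add: jacobi_w_def powr_add mult_ac)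
    then have "jacobi_w a b x powr P \<le> (2 powr (\<bar>a\<bar> + \<bar>b\<bar>) * L powr a) powr P" using P jacobi_w_nonneg by (intro powr_mono2) auto
    then show "jacobi_w a b x powr P \<le> c2 * L powr (a * P)" by (simp add: c2_def powr_mult powr_powr)
  qed
  have mR': "(\<integral>\<^sup>+x\<in>R'. c \<partial>lborel) = c * ennreal L" for c
    using L unfolding R'_def by (subst nn_integral_cmult) auto
  have lowR': "ennreal (L powr (a * P) * L) \<le> ennreal c2 * (\<integral>\<^sup>+x\<in>R'. w2 x \<partial>lborel)"
  proof -
    have "ennreal (L powr (a * P) * L) = power_integral (a * P) R' (\<lambda>x. L)" using L by (simp add: mR' ennreal_mult)
    also have "\<dots> \<le> (\<integral>\<^sup>+x\<in>R'. ennreal c2 * w2 x \<partial>lborel)"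
      using c2 w2b by (intro set_nn_integral_le) (auto simp: w2_def ennreal_mult[symmetric] intro!: ennreal_leI)
    also have "\<dots> = ennreal c2 * (\<integral>\<^sup>+x\<in>R'. w2 x \<partial>lborel)" by (rule set_nn_integral_cmult) measurable
    finally show ?thesis .
  qed
  have upR': "(\<integral>\<^sup>+x\<in>R'. w2 x \<partial>lborel) \<le> ennreal (c2 * L powr (a * P)) * ennreal L"
    unfolding mR'[symmetric] w2_def by (intro set_nn_integral_le ennreal_leI w2b)
  have ne0: "(\<integral>\<^sup>+x\<in>R'. w2 x \<partial>lborel) \<noteq> 0"
  proof
    assume 0: "(\<integral>\<^sup>+x\<in>R'. w2 x \<partial>lborel) = 0"
    have "0 < L powr (a * P) * L" using L by simp
    then show False using lowR' unfolding 0 by (simp add: ennreal_eq_0_iff)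
  qed
  have nei: "(\<integral>\<^sup>+x\<in>R'. w2 x \<partial>lborel) \<noteq> \<infinity>"
  proof -
    have "ennreal (c2 * L powr (a * P)) * ennreal L < \<infinity>" by (simp add: ennreal_mult_less_top)
    then show ?thesis using le_less_trans[OF upR'] by auto
  qed
  define C where "C = end_const \<xi> \<zeta> k P"
  \<comment> \<open>Here \<open>a * P + 1 = k / 2 * P + \<xi> * P + 1\<close>: both sides of the comparison scale alike in \<open>L\<close>.\<close>
  have Ceq: "2 powr (\<bar>\<zeta>\<bar> * P) * (2 * L) powr (real k / 2 * P) * (c3 * L powr (\<xi> * P + 1)) = (2 powr (\<bar>\<zeta>\<bar> * P) * c3 * 2 powr (real k / 2 * P)) * (L powr (a * P) * L)"
  proof -
    have "L powr (a * P) * L = L powr (real k / 2 * P) * L powr (\<xi> * P + 1)"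
      using L by (simp add: a_def powr_add[symmetric] algebra_simps) (simp add: powr_add)
    moreover have "(2 * L) powr (real k / 2 * P) = 2 powr (real k / 2 * P) * L powr (real k / 2 * P)" using L by (simp add: powr_mult)
    ultimately show ?thesis by (simp only: mult_ac)
  qed
  have I12: "(\<integral>\<^sup>+x\<in>R. w1 x \<partial>lborel) \<le> ennreal C * (\<integral>\<^sup>+x\<in>R'. w2 x \<partial>lborel)"
  proof -
    define c1 where "c1 = 2 powr (\<bar>\<zeta>\<bar> * P) * c3 * 2 powr (real k / 2 * P)"
    have c1: "0 \<le> c1" using c3 by (simp add: c1_def)
    have "(\<integral>\<^sup>+x\<in>R. w1 x \<partial>lborel) \<le> ennreal (c1 * (L powr (a * P) * L))" using I1 unfolding Ceq c1_def .
    also have "\<dots> = ennreal c1 * ennreal (L powr (a * P) * L)" using c1 L by (intro ennreal_mult) auto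
    also have "\<dots> \<le> ennreal c1 * (ennreal c2 * (\<integral>\<^sup>+x\<in>R'. w2 x \<partial>lborel))" by (intro mult_left_mono lowR') auto
    also have "\<dots> = ennreal (c1 * c2) * (\<integral>\<^sup>+x\<in>R'. w2 x \<partial>lborel)" using c1 c2 by (simp add: ennreal_mult mult.assoc)
    also have "c1 * c2 = C" by (simp add: C_def end_const_def c1_def c2_def c3_def a_def b_def)
    finally show ?thesis .
  qed
  have slowG: "G x \<le> ennreal (D powr P) * G y" if "x \<in> R" "y \<in> R'" for x y
  proof -
    have "B x \<le> D * B y" using that L by (intro slow) (auto simp: R_def R'_def L_def)
    then have "B x powr P \<le> (D * B y) powr P" using P B0 by (intro powr_mono2) auto
    then show ?thesis using D B0[of y] by (simp add: G_def powr_mult ennreal_mult[symmetric] ennreal_leI)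
  qed
  have "power_integral P R (\<lambda>x. cut_W \<delta> \<xi> \<zeta> x * \<phi> x ^ k * B x) = (\<integral>\<^sup>+x\<in>R. w1 x * G x \<partial>lborel)"
  proof (intro nn_integral_cong)
    fix x
    show "ennreal ((cut_W \<delta> \<xi> \<zeta> x * \<phi> x ^ k * B x) powr P) * indicator R x = w1 x * G x * indicator R x"
    proof (cases "x \<in> R")
      case True
      then have "0 \<le> cut_W \<delta> \<xi> \<zeta> x * \<phi> x ^ k" using cut_W_nonneg phi_nonneg[OF R1] by simp
      then show ?thesis using B0[of x] by (simp add: w1_def G_def powr_mult ennreal_mult)
    qed simp
  qed
  also have "\<dots> \<le> ennreal C * ennreal (D powr P) * (\<integral>\<^sup>+x\<in>R'. w2 x * G x \<partial>lborel)"
    by (intro slow_variation_transfer slowG I12 ne0 nei) measurable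
  also have "(\<integral>\<^sup>+x\<in>R'. w2 x * G x \<partial>lborel) \<le> (\<integral>\<^sup>+x\<in>{-1..1}. w2 x * G x \<partial>lborel)"
    using R1' by (intro set_nn_integral_subset subsetI)
  also have "(\<integral>\<^sup>+x\<in>{-1..1}. w2 x * G x \<partial>lborel) = power_integral P {-1..1} (\<lambda>x. jacobi_w a b x * B x)"
    by (intro nn_integral_cong) (simp add: w2_def G_def powr_mult ennreal_mult jacobi_w_nonneg B0)
  also have "ennreal C * ennreal (D powr P) = ennreal (C * D powr P)"
    using c3 by (intro ennreal_mult[symmetric]) (auto simp: C_def end_const_def c3_def)
  finally show ?thesis unfolding C_def R_def L_def by (simp add: mult_left_mono)
qed

definition cut_const :: "real \<Rightarrow> real \<Rightarrow> nat \<Rightarrow> real \<Rightarrow> real \<Rightarrow> real" where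
  "cut_const \<xi> \<zeta> k D P = (2 powr (\<bar>\<xi>\<bar> + \<bar>\<zeta>\<bar>)) powr P + end_const \<xi> \<zeta> k P * D powr P + end_const \<zeta> \<xi> k P * D powr P"

text \<open>The left end follows from the right one by the reflection \<open>x \<mapsto> - x\<close>, which exchanges \<open>\<xi>\<close> and \<open>\<zeta>\<close>.\<close>
lemma cut_W_integral_bound:
  fixes B :: "real \<Rightarrow> real" and \<delta> \<xi> \<zeta> P D :: real and k :: nat
  assumes [measurable]: "B \<in> borel_measurable borel" and B0: "\<And>x. 0 \<le> B x" and D: "0 \<le> D"
    and \<delta>: "0 \<le> \<delta>" "\<delta> \<le> 1 / 4" and P: "0 < P" "-1 < \<xi> * P" "-1 < \<zeta> * P"
    and slow: "\<And>x y. x \<in> {1 - 4 * \<delta>\<^sup>2..1} \<Longrightarrow> y \<in> {1 - 4 * \<delta>\<^sup>2..1} \<Longrightarrow> B x \<le> D * B y"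
    and slow': "\<And>x y. x \<in> {1 - 4 * \<delta>\<^sup>2..1} \<Longrightarrow> y \<in> {1 - 4 * \<delta>\<^sup>2..1} \<Longrightarrow> B (- x) \<le> D * B (- y)"
  defines "a \<equiv> \<xi> + real k / 2" and "b \<equiv> \<zeta> + real k / 2"
  shows "power_integral P {-1..1} (\<lambda>x. cut_W \<delta> \<xi> \<zeta> x * \<phi> x ^ k * B x)
    \<le> ennreal (cut_const \<xi> \<zeta> k D P) *
      power_integral P {-1..1} (\<lambda>x. jacobi_w a b x * B x)"
proof -
  define F where "F x = ennreal ((cut_W \<delta> \<xi> \<zeta> x * \<phi> x ^ k * B x) powr P)" for x
  define I where "I = power_integral P {-1..1} (\<lambda>x. jacobi_w a b x * B x)"
  define L where "L = 2 * \<delta>\<^sup>2"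
  have [measurable]: "F \<in> borel_measurable borel" unfolding F_def by measurable
  have L0: "0 \<le> L" by (simp add: L_def)
  have e0: "0 \<le> end_const \<xi> \<zeta> k P" "0 \<le> end_const \<zeta> \<xi> k P" using P by (auto simp: end_const_def)
  have M: "(\<integral>\<^sup>+x\<in>{-1 + L..1 - L}. F x \<partial>lborel) \<le> ennreal ((2 powr (\<bar>\<xi>\<bar> + \<bar>\<zeta>\<bar>)) powr P) * I"
  proof -
    have "(\<integral>\<^sup>+x\<in>{-1 + L..1 - L}. F x \<partial>lborel) \<le> ennreal ((2 powr (\<bar>\<xi>\<bar> + \<bar>\<zeta>\<bar>)) powr P) * power_integral P {-1 + L..1 - L} (\<lambda>x. jacobi_w a b x * B x)"
      unfolding F_def
    proof (rule set_nn_integral_powr_le)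
      fix x assume x: "x \<in> {-1 + L..1 - L}"
      then have x1: "x \<in> {-1..1}" using L0 by auto
      have ph: "0 \<le> \<phi> x ^ k" using phi_nonneg[OF x1] by simp
      have "cut_W \<delta> \<xi> \<zeta> x \<le> 2 powr (\<bar>\<xi>\<bar> + \<bar>\<zeta>\<bar>) * jacobi_w \<xi> \<zeta> x"
        using W_le_jacobi_w[OF x1 \<delta>(1), of \<xi> \<zeta>] x jacobi_w_nonneg[of \<xi> \<zeta> x] by (auto simp: cut_W_def L_def)
      then have "cut_W \<delta> \<xi> \<zeta> x * (\<phi> x ^ k * B x) \<le> (2 powr (\<bar>\<xi>\<bar> + \<bar>\<zeta>\<bar>) * jacobi_w \<xi> \<zeta> x) * (\<phi> x ^ k * B x)"
        using ph B0 by (intro mult_right_mono) auto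
      also have "\<dots> = 2 powr (\<bar>\<xi>\<bar> + \<bar>\<zeta>\<bar>) * ((jacobi_w \<xi> \<zeta> x * \<phi> x ^ k) * B x)" by (simp only: mult_ac)
      also have "jacobi_w \<xi> \<zeta> x * \<phi> x ^ k = jacobi_w a b x" unfolding a_def b_def by (rule jacobi_w_phi_power[OF x1])
      finally show "0 \<le> cut_W \<delta> \<xi> \<zeta> x * \<phi> x ^ k * B x \<and> cut_W \<delta> \<xi> \<zeta> x * \<phi> x ^ k * B x \<le> 2 powr (\<bar>\<xi>\<bar> + \<bar>\<zeta>\<bar>) * (jacobi_w a b x * B x)"
        using ph B0 cut_W_nonneg by (simp add: mult.assoc)
    qed (use P B0 jacobi_w_nonneg in auto)
    also have "\<dots> \<le> ennreal ((2 powr (\<bar>\<xi>\<bar> + \<bar>\<zeta>\<bar>)) powr P) * I"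
      unfolding I_def using L0 by (intro mult_left_mono set_nn_integral_subset) auto
    finally show ?thesis .
  qed
  have R: "(\<integral>\<^sup>+x\<in>{1 - L..1}. F x \<partial>lborel) \<le> ennreal (end_const \<xi> \<zeta> k P * D powr P) * I"
  proof (cases "\<delta> = 0")
    case False
    then show ?thesis unfolding F_def I_def L_def a_def b_def
      using \<delta> by (intro cut_W_end_bound B0 D P slow) auto
  qed (simp add: L_def)
  have Lf: "(\<integral>\<^sup>+x\<in>{-1..-1 + L}. F x \<partial>lborel) \<le> ennreal (end_const \<zeta> \<xi> k P * D powr P) * I"
  proof (cases "\<delta> = 0")
    case False
    have "(\<integral>\<^sup>+x\<in>{-1..-1 + L}. F x \<partial>lborel) = (\<integral>\<^sup>+x\<in>{1 - L..1}. F (- x) \<partial>lborel)"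
      using set_nn_integral_flip[of F "-1" "-1 + L" 0] by simp
    also have "\<dots> = power_integral P {1 - 2 * \<delta>\<^sup>2..1} (\<lambda>x. cut_W \<delta> \<zeta> \<xi> x * \<phi> x ^ k * B (- x))"
      by (simp add: F_def cut_W_minus phi_minus L_def)
    also have "\<dots> \<le> ennreal (end_const \<zeta> \<xi> k P * D powr P) * power_integral P {-1..1} (\<lambda>x. jacobi_w b a x * B (- x))"
      unfolding a_def b_def using \<delta> False by (intro cut_W_end_bound[where B = "\<lambda>x. B (- x)"] B0 D P slow') auto
    also have "power_integral P {-1..1} (\<lambda>x. jacobi_w b a x * B (- x)) = I"
      unfolding I_def by (subst (2) set_nn_integral_flip[where c = 0]) (auto simp: jacobi_w_minus)
    finally show ?thesis .
  qed (simp add: L_def)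
  have "(\<integral>\<^sup>+x\<in>{-1..1}. F x \<partial>lborel) \<le> (\<integral>\<^sup>+x\<in>{-1..1 - L}. F x \<partial>lborel) + (\<integral>\<^sup>+x\<in>{1 - L..1}. F x \<partial>lborel)"
    by (intro set_nn_integral_Un_le) auto
  also have "(\<integral>\<^sup>+x\<in>{-1..1 - L}. F x \<partial>lborel) \<le> (\<integral>\<^sup>+x\<in>{-1..-1 + L}. F x \<partial>lborel) + (\<integral>\<^sup>+x\<in>{-1 + L..1 - L}. F x \<partial>lborel)"
    by (intro set_nn_integral_Un_le) auto
  finally have "(\<integral>\<^sup>+x\<in>{-1..1}. F x \<partial>lborel) \<le> ((\<integral>\<^sup>+x\<in>{-1..-1 + L}. F x \<partial>lborel) + (\<integral>\<^sup>+x\<in>{-1 + L..1 - L}. F x \<partial>lborel)) + (\<integral>\<^sup>+x\<in>{1 - L..1}. F x \<partial>lborel)"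
    by (simp add: add_right_mono)
  also have "\<dots> \<le> (ennreal (end_const \<zeta> \<xi> k P * D powr P) * I + ennreal ((2 powr (\<bar>\<xi>\<bar> + \<bar>\<zeta>\<bar>)) powr P) * I) + ennreal (end_const \<xi> \<zeta> k P * D powr P) * I"
    by (intro add_mono R Lf M)
  also have "\<dots> = ennreal (cut_const \<xi> \<zeta> k D P) * I"
    using e0 by (simp add: cut_const_def distrib_right ennreal_plus add_ac)
  finally show ?thesis unfolding F_def I_def .
qed

lemma angle_near_end:
  assumes "0 \<le> \<delta>" "x \<in> {1 - 4 * \<delta>\<^sup>2..1}" "x \<in> {-1..1}"
  shows "pi - 6 * \<delta> \<le> angle x" "angle (- x) \<le> 6 * \<delta>"
proof -
  have b: "s \<le> 6 * \<delta>" if "0 \<le> s" "s \<le> pi" "1 - cos s \<le> 4 * \<delta>\<^sup>2" for s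
  proof (rule power2_le_imp_le)
    have "s\<^sup>2 / 8 \<le> 4 * \<delta>\<^sup>2" using one_minus_cos_bounds(1)[OF that(1,2)] that(3) by linarith
    then have "s\<^sup>2 \<le> 32 * \<delta>\<^sup>2" by simp
    also have "\<dots> \<le> 36 * \<delta>\<^sup>2" by (intro mult_right_mono) auto
    finally show "s\<^sup>2 \<le> (6 * \<delta>)\<^sup>2" by (simp add: power_mult_distrib)
  qed (use assms in simp)
  have an: "0 \<le> angle y" "angle y \<le> pi" for y using angle_bounds[of y] by auto
  have "- cos (angle x) = x" by (rule cos_angle[OF assms(3)])
  moreover have "- cos (angle (- x)) = - x" by (rule cos_angle) (use assms(3) in simp)
  ultimately
  show "pi - 6 * \<delta> \<le> angle x" "angle (- x) \<le> 6 * \<delta>"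
    using b[of "pi - angle x"] b[of "angle (- x)"] an[of x] an[of "- x"] assms by auto
qed

section \<open>Equivalence of the moduli\<close>

lemma degree_pderiv_funpow_le: "degree ((pderiv ^^ m) P) \<le> degree (P :: real poly)"
proof (induction m)
  case (Suc m)
  have "degree ((pderiv ^^ Suc m) P) \<le> degree ((pderiv ^^ m) P)" by (simp add: degree_pderiv)
  then show ?case using Suc by linarith
qed simp

lemma interval_subset_iff_half_step:
  assumes "x \<in> {-1..1}" "0 \<le> h"
  shows "{x - real k * (h * \<phi> x) / 2..x + real k * (h * \<phi> x) / 2} \<subseteq> {l..u} \<longleftrightarrow>
    l \<le> x - real k * h * \<phi> x / 2 \<and> x + real k * h * \<phi> x / 2 \<le> u"
proof -
  have "0 \<le> real k * (h * \<phi> x)" using assms phi_nonneg by simp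
  then show ?thesis by (auto simp: mult.assoc)
qed

text \<open>Because \<open>k \<ge> 1\<close>, the weight exponent of \<open>Q\<close> exceeds the admissible bound by at least \<open>1 / 2\<close>, for all \<open>p\<close>;
  this margin is what makes the constants uniform.\<close>
lemma exponent_condition:
  assumes "\<alpha> + real r / 2 \<in> J_set p" "1 \<le> k"
  shows "1 / 2 \<le> (\<alpha> + real (k + r) / 2) + 1 / enn2real p"
proof -
  have k: "1 / 2 \<le> real k / 2" using assms by simp
  show ?thesis
    using assms(1) k unfolding J_set_def by (auto simp: add_divide_distrib split: if_splits)
qed

lemma cos_small:
  fixes s :: real
  assumes "0 < s" "s \<le> 1 / 2"
  shows "0 \<le> cos s" "cos s < 1"
proof -
  show "0 \<le> cos s" using assms pi_gt3 by (intro cos_ge_zero) auto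
  have "0 < s\<^sup>2 / 8" using assms by simp
  also have "\<dots> \<le> 1 - cos s" using assms pi_gt3 by (intro one_minus_cos_bounds) auto
  finally show "cos s < 1" by simp
qed

lemma (in majorized_derivative) difference_norm_upper:
  assumes p: "0 < p" and h: "0 \<le> h" "h \<le> t" "2 * real k * h \<le> 1 / real n" and t: "0 < t" and S: "{l..u} \<subseteq> {-1..1}"
  shows "Lp_norm p {l..u} (\<lambda>x. jacobi_w \<alpha> \<beta> x * \<phi> x ^ r * sym_diff k (h * \<phi> x) (poly_deriv r P) x {l..u})
    \<le> ennreal (C * t ^ k) * Lp_norm p {-1..1} (\<lambda>x. jacobi_w (\<alpha> + real (k + r) / 2) (\<beta> + real (k + r) / 2) x * B (angle x))"
proof (rule Lp_norm_mono[OF p])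
  show "(\<lambda>x. jacobi_w \<alpha> \<beta> x * \<phi> x ^ r * sym_diff k (h * \<phi> x) (poly_deriv r P) x {l..u}) \<in> borel_measurable borel"
    by (intro borel_measurable_times measurable_sym_diff) measurable
  show "0 < C * t ^ k" using C_ge t by simp
  fix x assume x: "x \<in> {l..u}"
  then have x1: "x \<in> {-1..1}" using S by blast
  have ph: "0 \<le> \<phi> x" by (rule phi_nonneg[OF x1])
  have d: "\<bar>sym_diff k (h * \<phi> x) (poly_deriv r P) x {l..u}\<bar> \<le> C * t ^ k * \<phi> x ^ k * B (angle x)"
  proof (cases "{x - real k * (h * \<phi> x) / 2..x + real k * (h * \<phi> x) / 2} \<subseteq> {l..u}")
    case True
    have "\<bar>sym_diff k (h * \<phi> x) (poly_deriv r P) x {l..u}\<bar> \<le> C * h ^ k * \<phi> x ^ k * B (angle x)"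
      by (rule sym_diff_estimates(1)[OF h(1,3) x1 S True])
    also have "\<dots> \<le> C * t ^ k * \<phi> x ^ k * B (angle x)"
      using h C_ge ph B_nonneg by (intro mult_right_mono mult_left_mono power_mono) auto
    finally show ?thesis .
  qed (use C_ge t ph B_nonneg in \<open>simp add: sym_diff_outside\<close>)
  define v where "v = jacobi_w \<alpha> \<beta> x * \<phi> x ^ r"
  have v: "0 \<le> v" using jacobi_w_nonneg ph by (simp add: v_def)
  have "v * \<bar>sym_diff k (h * \<phi> x) (poly_deriv r P) x {l..u}\<bar> \<le> v * (C * t ^ k * \<phi> x ^ k * B (angle x))"
    by (intro mult_left_mono d v)
  also have "\<dots> = C * t ^ k * ((jacobi_w \<alpha> \<beta> x * \<phi> x ^ (k + r)) * B (angle x))" by (simp add: v_def power_add mult_ac)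
  also have "jacobi_w \<alpha> \<beta> x * \<phi> x ^ (k + r) = jacobi_w (\<alpha> + real (k + r) / 2) (\<beta> + real (k + r) / 2) x"
    by (rule jacobi_w_phi_power[OF x1])
  finally show "\<bar>jacobi_w \<alpha> \<beta> x * \<phi> x ^ r * sym_diff k (h * \<phi> x) (poly_deriv r P) x {l..u}\<bar>
    \<le> C * t ^ k * \<bar>jacobi_w (\<alpha> + real (k + r) / 2) (\<beta> + real (k + r) / 2) x * B (angle x)\<bar>"
    using v B_nonneg[of "angle x"] jacobi_w_nonneg[of "\<alpha> + real (k + r) / 2" "\<beta> + real (k + r) / 2" x] by (simp add: abs_mult v_def[symmetric])
qed (use S in auto)

lemma W_times_sym_diff_le:
  assumes x: "x \<in> {-1..1}" and h: "0 \<le> h" and \<xi>: "0 \<le> \<xi>" "0 \<le> \<zeta>"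
  shows "\<bar>\<W> (real k * h) \<xi> \<zeta> x * sym_diff k (h * \<phi> x) g x {-1..1}\<bar> \<le> \<bar>jacobi_w \<xi> \<zeta> x * sym_diff k (h * \<phi> x) g x {-1..1}\<bar>"
proof (cases "{x - real k * (h * \<phi> x) / 2..x + real k * (h * \<phi> x) / 2} \<subseteq> {-1..1}")
  case True
  then have b: "-1 \<le> x - real k * h * \<phi> x / 2" "x + real k * h * \<phi> x / 2 \<le> 1"
    using interval_subset_iff_half_step[OF x h] by auto
  have z: "0 \<le> real k * h * \<phi> x / 2" using h phi_nonneg[OF x] by simp
  have "\<W> (real k * h) \<xi> \<zeta> x \<le> jacobi_w \<xi> \<zeta> x"
    unfolding \<W>_def jacobi_w_def using b z \<xi> by (intro mult_mono powr_mono2) auto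
  then show ?thesis using jacobi_w_nonneg[of \<xi> \<zeta> x]
    unfolding abs_mult by (intro mult_right_mono) (auto simp: \<W>_def)
qed (simp add: sym_diff_outside)

text \<open>The ends \<open>{x. 1 - \<bar>x\<bar> \<le> 4 * \<delta>\<^sup>2}\<close> have angular size at most \<open>6 * \<delta> = 6 * k * h\<close>, so the majorant is almost
  constant there.\<close>
lemma (in majorized_derivative) omega_norm_upper:
  assumes p: "0 < p" "p \<noteq> \<infinity>" and h: "0 \<le> h" "h \<le> t" "8 * real k * h \<le> 1 / real n" and t: "0 < t"
    and \<xi>: "-1 < \<xi> * enn2real p" "-1 < \<zeta> * enn2real p"
  shows "Lp_norm p {-1..1} (\<lambda>x. \<W> (real k * h) \<xi> \<zeta> x * sym_diff k (h * \<phi> x) (poly_deriv r P) x {-1..1})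
    \<le> ennreal (C * t ^ k * cut_const \<xi> \<zeta> k C (enn2real p) powr (1 / enn2real p))
      * Lp_norm p {-1..1} (\<lambda>x. jacobi_w (\<xi> + real k / 2) (\<zeta> + real k / 2) x * B (angle x))"
proof -
  define E where "E = enn2real p"
  have E: "0 < E" using p by (simp add: E_def enn2real_positive_iff less_top)
  define c where "c = cut_const \<xi> \<zeta> k C E"
  have "0 \<le> end_const \<xi> \<zeta> k E" "0 \<le> end_const \<zeta> \<xi> k E" using \<xi> by (auto simp: end_const_def E_def)
  then have c: "0 < c" unfolding c_def cut_const_def by (intro add_pos_nonneg mult_nonneg_nonneg) auto
  define \<delta> where "\<delta> = real k * h"
  have "1 / real n \<le> 1" using n_ge by simp
  then have \<delta>: "0 \<le> \<delta>" "8 * \<delta> \<le> 1 / real n" "\<delta> \<le> 1 / 8" using h by (auto simp: \<delta>_def)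
  have d2: "4 * \<delta>\<^sup>2 \<le> 1"
  proof -
    have "\<delta>\<^sup>2 \<le> (1/8)\<^sup>2" using \<delta> by (intro power_mono) auto
    then show ?thesis by (simp add: power2_eq_square)
  qed
  have ends: "x \<in> {-1..1}" "- x \<in> {-1..1}" if "x \<in> {1 - 4 * \<delta>\<^sup>2..1}" for x using that d2 by auto
  have near: "\<bar>angle x - angle y\<bar> \<le> 1 / real n" "\<bar>angle (- x) - angle (- y)\<bar> \<le> 1 / real n"
    if "x \<in> {1 - 4 * \<delta>\<^sup>2..1}" "y \<in> {1 - 4 * \<delta>\<^sup>2..1}" for x y
    using angle_near_end[OF \<delta>(1) that(1) ends(1)[OF that(1)]] angle_near_end[OF \<delta>(1) that(2) ends(1)[OF that(2)]]
      angle_bounds[of x] angle_bounds[of y] angle_bounds[of "- x"] angle_bounds[of "- y"] \<delta>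
    unfolding atLeastAtMost_iff by linarith+
  let ?F = "\<lambda>x. \<W> (real k * h) \<xi> \<zeta> x * sym_diff k (h * \<phi> x) (poly_deriv r P) x {-1..1}"
  let ?G = "\<lambda>x. cut_W \<delta> \<xi> \<zeta> x * \<phi> x ^ k * B (angle x)"
  have "Lp_norm p {-1..1} ?F \<le> ennreal (C * t ^ k) * Lp_norm p {-1..1} ?G"
  proof (rule Lp_norm_mono[OF p(1)])
    show "?F \<in> borel_measurable borel" by (intro borel_measurable_times measurable_sym_diff) measurable
    show "0 < C * t ^ k" using C_ge t by simp
    fix x :: real assume x: "x \<in> {-1..1}"
    have ph: "0 \<le> \<phi> x" by (rule phi_nonneg[OF x])
    have W0: "0 \<le> \<W> (real k * h) \<xi> \<zeta> x" by (simp add: \<W>_def)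
    show "\<bar>?F x\<bar> \<le> C * t ^ k * \<bar>?G x\<bar>"
    proof (cases "{x - real k * (h * \<phi> x) / 2..x + real k * (h * \<phi> x) / 2} \<subseteq> {-1..1}")
      case True
      then have "-1 \<le> x - real k * h * \<phi> x / 2" "x + real k * h * \<phi> x / 2 \<le> 1"
        using interval_subset_iff_half_step[OF x h(1)] by auto
      then have cut: "cut_W \<delta> \<xi> \<zeta> x = \<W> (real k * h) \<xi> \<zeta> x" by (simp add: cut_W_def \<delta>_def)
      have "2 * real k * h \<le> 1 / real n" using \<delta> by (simp add: \<delta>_def)
      then have "\<bar>sym_diff k (h * \<phi> x) (poly_deriv r P) x {-1..1}\<bar> \<le> C * h ^ k * \<phi> x ^ k * B (angle x)"
        by (intro sym_diff_estimates(1)[OF h(1) _ x _ True]) auto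
      also have "\<dots> \<le> C * t ^ k * \<phi> x ^ k * B (angle x)"
        using h C_ge ph B_nonneg by (intro mult_right_mono mult_left_mono power_mono) auto
      finally have "\<W> (real k * h) \<xi> \<zeta> x * \<bar>sym_diff k (h * \<phi> x) (poly_deriv r P) x {-1..1}\<bar> \<le> \<W> (real k * h) \<xi> \<zeta> x * (C * t ^ k * \<phi> x ^ k * B (angle x))"
        using W0 by (rule mult_left_mono)
      then show ?thesis using W0 ph B_nonneg[of "angle x"] by (simp add: abs_mult cut mult_ac)
    qed (use C_ge t in \<open>simp add: sym_diff_outside\<close>)
  qed auto
  also have "Lp_norm p {-1..1} ?G \<le> ennreal (c powr (1 / E)) * Lp_norm p {-1..1} (\<lambda>x. jacobi_w (\<xi> + real k / 2) (\<zeta> + real k / 2) x * B (angle x))"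
  proof (rule Lp_norm_le_of_integral_le[OF p(2,1)])
    have "(\<integral>\<^sup>+x\<in>{-1..1}. ennreal (\<bar>?G x\<bar> powr E) \<partial>lborel) = (\<integral>\<^sup>+x\<in>{-1..1}. ennreal ((?G x) powr E) \<partial>lborel)"
      by (intro nn_integral_cong) (auto split: split_indicator simp: abs_mult cut_W_nonneg B_nonneg phi_nonneg)
    also have "\<dots> \<le> ennreal c * (\<integral>\<^sup>+x\<in>{-1..1}. ennreal ((jacobi_w (\<xi> + real k / 2) (\<zeta> + real k / 2) x * B (angle x)) powr E) \<partial>lborel)"
      unfolding c_def
    proof (rule cut_W_integral_bound)
      fix x y assume xy: "x \<in> {1 - 4 * \<delta>\<^sup>2..1}" "y \<in> {1 - 4 * \<delta>\<^sup>2..1}"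
      show "B (angle x) \<le> C * B (angle y)" by (rule B_angle_slow[OF near(1)[OF xy]])
      show "B (angle (- x)) \<le> C * B (angle (- y))" by (rule B_angle_slow[OF near(2)[OF xy]])
    qed (use B_nonneg C_ge \<delta> E \<xi> in \<open>auto simp: E_def\<close>)
    also have "(\<integral>\<^sup>+x\<in>{-1..1}. ennreal ((jacobi_w (\<xi> + real k / 2) (\<zeta> + real k / 2) x * B (angle x)) powr E) \<partial>lborel)
      = (\<integral>\<^sup>+x\<in>{-1..1}. ennreal (\<bar>jacobi_w (\<xi> + real k / 2) (\<zeta> + real k / 2) x * B (angle x)\<bar> powr E) \<partial>lborel)"
      by (simp add: abs_mult jacobi_w_nonneg B_nonneg)
    also have "c = (c powr (1 / E)) powr E" using c E by (simp add: powr_powr)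
    finally show "(\<integral>\<^sup>+x\<in>{-1..1}. ennreal (\<bar>?G x\<bar> powr enn2real p) \<partial>lborel) \<le> ennreal ((c powr (1 / E)) powr enn2real p) *
       (\<integral>\<^sup>+x\<in>{-1..1}. ennreal (\<bar>jacobi_w (\<xi> + real k / 2) (\<zeta> + real k / 2) x * B (angle x)\<bar> powr enn2real p) \<partial>lborel)"
      unfolding E_def .
  qed (use c in auto)
  finally have "Lp_norm p {-1..1} ?F \<le> ennreal (C * t ^ k) * (ennreal (c powr (1 / E)) * Lp_norm p {-1..1} (\<lambda>x. jacobi_w (\<xi> + real k / 2) (\<zeta> + real k / 2) x * B (angle x)))"
    by (simp add: mult_left_mono)
  also have "\<dots> = ennreal (C * t ^ k * c powr (1 / E)) * Lp_norm p {-1..1} (\<lambda>x. jacobi_w (\<xi> + real k / 2) (\<zeta> + real k / 2) x * B (angle x))"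
    using C_ge t by (simp add: ennreal_mult mult.assoc)
  finally show ?thesis unfolding c_def E_def .
qed

lemma inverse_mult_le:
  fixes X Y :: ennreal
  assumes "X \<le> ennreal c * Y" "0 < c"
  shows "ennreal (1 / c) * X \<le> Y"
proof -
  have "ennreal (1 / c) * X \<le> ennreal (1 / c) * (ennreal c * Y)" by (intro mult_left_mono assms) simp
  also have "\<dots> = Y" using assms(2) by (simp add: mult.assoc[symmetric] ennreal_mult[symmetric])
  finally show ?thesis .
qed

lemma ennreal_le_trans_mult:
  fixes X Y Z :: ennreal
  assumes "X \<le> ennreal u * Y" "Y \<le> ennreal v * Z" "u * v \<le> c" "0 \<le> u" "0 \<le> v"
  shows "X \<le> ennreal c * Z"
proof -
  have "X \<le> ennreal u * (ennreal v * Z)" by (rule order.trans[OF assms(1)]) (intro mult_left_mono assms, simp)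
  also have "\<dots> = ennreal (u * v) * Z" using assms by (simp add: ennreal_mult mult.assoc)
  also have "\<dots> \<le> ennreal c * Z" by (intro mult_right_mono ennreal_leI assms) simp
  finally show ?thesis .
qed

text \<open>A polynomial with its majorant, an exponent, and a number \<open>t\<close> within reach of the majorant. The constants
  \<open>C\<close> and \<open>\<epsilon>\<close> come from \<open>jacobi_majorant\<close>.\<close>
locale moduli_setting = majorized_derivative n k r C P B
  for n k r :: nat and C :: real and P :: "real poly" and B +
  fixes \<alpha> \<beta> q \<epsilon> t :: real and p :: ennreal
  assumes k: "1 \<le> k" and q: "0 < q" "q \<le> 1" and p: "0 < p" "min 1 p = ennreal q"
    and \<epsilon>: "0 < \<epsilon>" "\<epsilon> \<le> 1 / 2" and t: "0 < t" "8 * real k * t \<le> 1 / real n"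
    and norm_B_inner: "Lp_norm p {-1..1} (\<lambda>x. jacobi_w (\<alpha> + real (k + r) / 2) (\<beta> + real (k + r) / 2) x * B (angle x))
      \<le> ennreal C * Lp_norm p {- cos (\<epsilon> / real n)..cos (\<epsilon> / real n)} (\<lambda>x. jacobi_w (\<alpha> + real (k + r) / 2) (\<beta> + real (k + r) / 2) x * poly Q x)"
begin

abbreviation a where "a \<equiv> \<alpha> + real (k + r) / 2"
abbreviation b where "b \<equiv> \<beta> + real (k + r) / 2"
abbreviation \<xi> where "\<xi> \<equiv> real r / 2 + \<alpha>"
abbreviation \<zeta> where "\<zeta> \<equiv> real r / 2 + \<beta>"
abbreviation s where "s \<equiv> cos (\<epsilon> / real n)"
abbreviation g where "g \<equiv> poly_deriv r P"
abbreviation N where "N \<equiv> Lp_norm p {-1..1} (\<lambda>x. jacobi_w a b x * poly Q x)"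

lemma s_bounds: "0 \<le> s" "s < 1" "{-s..s} \<subseteq> {-1..1}"
proof -
  have "\<epsilon> / real n \<le> \<epsilon> / 1" using \<epsilon>(1) n_ge by (intro divide_left_mono) simp_all
  then have "\<epsilon> / real n \<le> 1 / 2" using \<epsilon>(2) by (simp only: div_by_1)
  moreover have "0 < \<epsilon> / real n" using \<epsilon> n_ge by simp
  ultimately show s: "0 \<le> s" "s < 1" using cos_small by blast+
  then show "{-s..s} \<subseteq> {-1..1}" by auto
qed

lemma target_norm_eq: "Lp_norm p {-1..1} (\<lambda>x. jacobi_w \<alpha> \<beta> x * \<phi> x ^ (k + r) * poly_deriv (k + r) P x) = N"
proof -
  have eq: "jacobi_w \<alpha> \<beta> x * \<phi> x ^ (k + r) * poly_deriv (k + r) P x = jacobi_w a b x * poly Q x" if "x \<in> {-1..1}" for x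
    by (simp only: jacobi_w_phi_power[OF that])
  have "Lp_norm p {-1..1} (\<lambda>x. jacobi_w \<alpha> \<beta> x * \<phi> x ^ (k + r) * poly_deriv (k + r) P x) \<le> ennreal 1 * N"
    by (intro Lp_norm_mono p) (auto simp: eq)
  moreover have "N \<le> ennreal 1 * Lp_norm p {-1..1} (\<lambda>x. jacobi_w \<alpha> \<beta> x * \<phi> x ^ (k + r) * poly_deriv (k + r) P x)"
    by (intro Lp_norm_mono p) (auto simp: eq)
  ultimately show ?thesis by simp
qed

lemma norm_B_le: "Lp_norm p {-1..1} (\<lambda>x. jacobi_w a b x * B (angle x)) \<le> ennreal C * N"
proof -
  have "Lp_norm p {-s..s} (\<lambda>x. jacobi_w a b x * poly Q x) \<le> ennreal 1 * N"
    by (intro Lp_norm_mono p s_bounds(3)) auto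
  then have "Lp_norm p {-s..s} (\<lambda>x. jacobi_w a b x * poly Q x) \<le> N" by simp
  then show ?thesis using order.trans[OF norm_B_inner mult_left_mono[of _ N "ennreal C"]] by simp
qed

lemma step_bounds: "h \<le> t \<Longrightarrow> 8 * real k * h \<le> 1 / real n" "0 \<le> h \<Longrightarrow> h \<le> t \<Longrightarrow> 2 * real k * h \<le> 1 / real n"
proof -
  show *: "8 * real k * h \<le> 1 / real n" if "h \<le> t"
    using mult_left_mono[OF that, of "8 * real k"] t by simp
  assume h: "0 \<le> h" "h \<le> t"
  have "2 * real k * h \<le> 8 * real k * h" using h by (intro mult_right_mono) auto
  then show "2 * real k * h \<le> 1 / real n" using *[OF h(2)] by linarith
qed

lemma weighted_difference_le:
  assumes "0 \<le> h" "h \<le> t" "{l..u} \<subseteq> {-1..1}"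
  shows "Lp_norm p {l..u} (\<lambda>x. jacobi_w \<alpha> \<beta> x * \<phi> x ^ r * sym_diff k (h * \<phi> x) g x {l..u}) \<le> ennreal (C * C) * (ennreal (t ^ k) * N)"
proof -
  have "Lp_norm p {l..u} (\<lambda>x. jacobi_w \<alpha> \<beta> x * \<phi> x ^ r * sym_diff k (h * \<phi> x) g x {l..u})
     \<le> ennreal (C * t ^ k) * Lp_norm p {-1..1} (\<lambda>x. jacobi_w a b x * B (angle x))"
    by (rule difference_norm_upper[OF p(1) assms(1,2) step_bounds(2)[OF assms(1,2)] t(1) assms(3)])
  also have "\<dots> \<le> ennreal (C * t ^ k) * (ennreal C * N)" by (intro mult_left_mono norm_B_le) simp
  also have "\<dots> = ennreal (C * C) * (ennreal (t ^ k) * N)" using C_ge t by (simp add: ennreal_mult mult_ac)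
  finally show ?thesis .
qed

lemma Psi_upper: "\<Psi>_modulus k r g t \<alpha> \<beta> p \<le> ennreal (C * C) * (ennreal (t ^ k) * N)"
  unfolding \<Psi>_modulus_def by (intro SUP_least weighted_difference_le) auto

lemma Omega_upper: "0 < A \<Longrightarrow> \<Omega>_modulus k r g A t \<alpha> \<beta> p \<le> ennreal (C * C) * (ennreal (t ^ k) * N)"
  unfolding \<Omega>_modulus_def \<I>_def by (intro SUP_least weighted_difference_le) auto

lemma weight_split: "x \<in> {-1..1} \<Longrightarrow> jacobi_w \<alpha> \<beta> x * \<phi> x ^ r = jacobi_w \<xi> \<zeta> x"
  using jacobi_w_phi_power[of x \<alpha> \<beta> r] by (simp add: add.commute)

lemma omega_le_Psi:
  assumes "0 \<le> \<xi>" "0 \<le> \<zeta>"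
  shows "\<omega>_modulus k r g t \<alpha> \<beta> p \<le> \<Psi>_modulus k r g t \<alpha> \<beta> p"
  unfolding \<omega>_modulus_def \<Psi>_modulus_def
proof (rule SUP_mono)
  fix h assume h: "h \<in> {0..t}"
  have "Lp_norm p {-1..1} (\<lambda>x. \<W> (real k * h) \<xi> \<zeta> x * sym_diff k (h * \<phi> x) g x {-1..1})
     \<le> ennreal 1 * Lp_norm p {-1..1} (\<lambda>x. jacobi_w \<alpha> \<beta> x * \<phi> x ^ r * sym_diff k (h * \<phi> x) g x {-1..1})"
  proof (rule Lp_norm_mono[OF p(1)])
    fix x :: real assume x: "x \<in> {-1..1}"
    have "\<bar>\<W> (real k * h) \<xi> \<zeta> x * sym_diff k (h * \<phi> x) g x {-1..1}\<bar> \<le> \<bar>jacobi_w \<xi> \<zeta> x * sym_diff k (h * \<phi> x) g x {-1..1}\<bar>"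
      using h by (intro W_times_sym_diff_le x assms) auto
    then show "\<bar>\<W> (real k * h) \<xi> \<zeta> x * sym_diff k (h * \<phi> x) g x {-1..1}\<bar>
       \<le> 1 * \<bar>jacobi_w \<alpha> \<beta> x * \<phi> x ^ r * sym_diff k (h * \<phi> x) g x {-1..1}\<bar>"
      by (simp only: weight_split[OF x] mult_1)
  qed (auto intro!: borel_measurable_times measurable_sym_diff borel_measurable_power)
  then show "\<exists>m\<in>{0..t}. Lp_norm p {-1..1} (\<lambda>x. \<W> (real k * h) \<xi> \<zeta> x * sym_diff k (h * \<phi> x) g x {-1..1})
     \<le> Lp_norm p {-1..1} (\<lambda>x. jacobi_w \<alpha> \<beta> x * \<phi> x ^ r * sym_diff k (m * \<phi> x) g x {-1..1})"
    using h by (intro bexI[of _ h]) auto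
qed

lemma omega_upper:
  assumes "p \<noteq> \<infinity>" "-1 < \<xi> * enn2real p" "-1 < \<zeta> * enn2real p"
  shows "\<omega>_modulus k r g t \<alpha> \<beta> p \<le> ennreal (C * cut_const \<xi> \<zeta> k C (enn2real p) powr (1 / enn2real p) * C) * (ennreal (t ^ k) * N)"
  unfolding \<omega>_modulus_def
proof (rule SUP_least)
  fix h assume h: "h \<in> {0..t}"
  define v where "v = cut_const \<xi> \<zeta> k C (enn2real p) powr (1 / enn2real p)"
  have ab: "\<xi> + real k / 2 = a" "\<zeta> + real k / 2 = b" by (auto simp: add_divide_distrib)
  have "Lp_norm p {-1..1} (\<lambda>x. \<W> (real k * h) \<xi> \<zeta> x * sym_diff k (h * \<phi> x) g x {-1..1})
    \<le> ennreal (C * t ^ k * v) * Lp_norm p {-1..1} (\<lambda>x. jacobi_w a b x * B (angle x))"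
    unfolding v_def ab[symmetric] using h assms
    by (intro omega_norm_upper[OF p(1) assms(1) _ _ _ t(1)] step_bounds) auto
  also have "\<dots> \<le> ennreal (C * t ^ k * v) * (ennreal C * N)" by (intro mult_left_mono norm_B_le) simp
  also have "\<dots> = ennreal (C * v * C) * (ennreal (t ^ k) * N)" using C_ge t by (simp add: v_def ennreal_mult mult_ac)
  finally show "Lp_norm p {-1..1} (\<lambda>x. \<W> (real k * h) \<xi> \<zeta> x * sym_diff k (h * \<phi> x) g x {-1..1})
    \<le> ennreal (C * cut_const \<xi> \<zeta> k C (enn2real p) powr (1 / enn2real p) * C) * (ennreal (t ^ k) * N)" by (simp only: v_def)
qed

end

text \<open>The maximum with \<open>1\<close> only serves to multiply constants freely later.\<close>
definition lower_const :: "real \<Rightarrow> real \<Rightarrow> nat \<Rightarrow> real \<Rightarrow> real \<Rightarrow> real" where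
  "lower_const q C k \<eta> \<theta> = max 1 (C * (2 * (4 powr (1/q) * 2)) * (1 / (2 powr (- \<eta>) * \<theta> ^ k)))"

text \<open>The single step \<open>h = \<theta> * t\<close> of the lower estimates. The third condition on \<open>\<theta>\<close> makes the error term
  absorbable, the fourth keeps the inner interval inside the domain \<open>\<I> A h\<close>.\<close>
locale small_step = moduli_setting n k r C P B \<alpha> \<beta> q \<epsilon> t p
  for n k r :: nat and C :: real and P :: "real poly" and B and \<alpha> \<beta> q \<epsilon> t :: real and p :: ennreal +
  fixes A \<theta> :: real
  assumes A: "0 < A" and \<theta>: "0 < \<theta>" "\<theta> \<le> \<epsilon>" "\<theta> \<le> 1 / (2 * (4 powr (1/q) * 2) * C)" "32 * A * \<theta>\<^sup>2 \<le> \<epsilon>\<^sup>2"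
begin

abbreviation K where "K \<equiv> 4 powr (1/q) * 2"
abbreviation \<sigma> where "\<sigma> \<equiv> 1 / (2 * K * C)"
abbreviation h where "h \<equiv> \<theta> * t"
abbreviation \<kappa> where "\<kappa> \<equiv> 2 powr (- (\<bar>\<xi>\<bar> + \<bar>\<zeta>\<bar>))"
abbreviation M where "M \<equiv> lower_const q C k (\<bar>\<xi>\<bar> + \<bar>\<zeta>\<bar>) \<theta>"

lemma \<kappa>_bounds: "0 < \<kappa>" "\<kappa> \<le> 1"
  by (simp, subst powr_minus_divide, simp add: ge_one_powr_ge_zero)

lemma h_bounds: "0 < h" "h \<le> t" "h \<in> {0..t}"
proof -
  have "\<theta> \<le> 1" using \<theta> \<epsilon> by linarith
  then show "0 < h" "h \<le> t" using \<theta> t mult_right_mono[of \<theta> 1 t] by auto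
  then show "h \<in> {0..t}" by auto
qed

lemma h_small: "8 * real k * h \<le> \<epsilon> / real n" "32 * A * h\<^sup>2 \<le> (\<epsilon> / real n)\<^sup>2" "2 * real k * h * real n \<le> \<sigma>"
proof -
  have "8 * real k * h = \<theta> * (8 * real k * t)" by simp
  also have "\<dots> \<le> \<epsilon> * (1 / real n)" using \<theta> \<epsilon> t by (intro mult_mono) auto
  finally show "8 * real k * h \<le> \<epsilon> / real n" by simp
  have "1 * t \<le> 8 * real k * t" using k t by (intro mult_right_mono) auto
  then have "t \<le> 1 / real n" using t by linarith
  then have "t\<^sup>2 \<le> (1 / real n)\<^sup>2" using t by (intro power_mono) auto
  then have "32 * A * \<theta>\<^sup>2 * t\<^sup>2 \<le> \<epsilon>\<^sup>2 * (1 / real n)\<^sup>2" using \<theta> A by (intro mult_mono) auto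
  then show "32 * A * h\<^sup>2 \<le> (\<epsilon> / real n)\<^sup>2" by (simp add: power_mult_distrib power_divide mult_ac)
  have "8 * real k * t * real n \<le> 1" using t n_ge by (simp add: field_simps)
  then have "\<theta> * (8 * real k * t * real n) \<le> \<theta> * 1" using \<theta> by (intro mult_left_mono) auto
  then have "8 * real k * h * real n \<le> \<theta>" by (simp add: mult_ac)
  moreover have "2 * real k * h * real n \<le> 8 * real k * h * real n" using h_bounds by (intro mult_right_mono) auto
  ultimately show "2 * real k * h * real n \<le> \<sigma>" using \<theta> by linarith
qed

lemma geometry:
  assumes x: "x \<in> {-s..s}"
  shows "x \<in> {-1..1}" "real k * h * \<phi> x / 2 \<le> (1 - \<bar>x\<bar>) / 4" "A * h\<^sup>2 \<le> (1 - \<bar>x\<bar>) / 4" "0 < 1 - \<bar>x\<bar>" "0 \<le> real k * h * \<phi> x / 2"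
proof -
  note ig = inner_geometry[OF n_ge \<epsilon> x less_imp_le[OF h_bounds(1)] h_small(1) less_imp_le[OF A] h_small(2)]
  show "x \<in> {-1..1}" "real k * h * \<phi> x / 2 \<le> (1 - \<bar>x\<bar>) / 4" "A * h\<^sup>2 \<le> (1 - \<bar>x\<bar>) / 4" "0 < 1 - \<bar>x\<bar>" by (rule ig)+
  show "0 \<le> real k * h * \<phi> x / 2" using h_bounds phi_nonneg[OF ig(1)] by simp
qed

lemma lower_estimate:
  assumes S: "{l..u} \<subseteq> {-1..1}" "l \<le> -1 + A * h\<^sup>2" "1 - A * h\<^sup>2 \<le> u" and [measurable]: "F \<in> borel_measurable borel"
    and F: "\<And>x. x \<in> {-s..s} \<Longrightarrow> \<kappa> * (jacobi_w \<alpha> \<beta> x * \<phi> x ^ r) * \<bar>sym_diff k (h * \<phi> x) g x {l..u}\<bar> \<le> \<bar>F x\<bar>"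
  shows "ennreal (t ^ k) * N \<le> ennreal M * Lp_norm p {l..u} F"
proof -
  have h0: "0 \<le> h" using h_bounds by simp
  have inside: "{x - real k * (h * \<phi> x) / 2..x + real k * (h * \<phi> x) / 2} \<subseteq> {l..u}" if x: "x \<in> {-s..s}" for x
    unfolding interval_subset_iff_half_step[OF geometry(1)[OF x] h0]
  proof -
    define z where "z = real k * h * \<phi> x / 2"
    have "4 * z \<le> 1 - \<bar>x\<bar>" "4 * (A * h\<^sup>2) \<le> 1 - \<bar>x\<bar>" "0 \<le> z"
      using geometry(2,3,5)[OF x] by (auto simp: z_def)
    then show "l \<le> x - real k * h * \<phi> x / 2 \<and> x + real k * h * \<phi> x / 2 \<le> u"
      using S(2,3) abs_ge_self[of x] abs_ge_minus_self[of x] unfolding z_def[symmetric] by linarith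
  qed
  have dm: "(\<lambda>x. sym_diff k (h * \<phi> x) g x {l..u}) \<in> borel_measurable borel"
    by (intro measurable_sym_diff) measurable
  have \<sigma>: "0 < \<sigma>" "K * (\<sigma> * C) \<le> 1 / 2" using C_ge by auto
  have "N \<le> ennreal (C * (2 * K) * (1 / (\<kappa> * h ^ k))) * Lp_norm p {l..u} F"
  proof (rule lower_bound_from_difference[OF p(2) q _ dm _ s_bounds(1,2) _ norm_B_inner refl refl h_bounds(1) \<kappa>_bounds(1) \<sigma> F])
    show "{-s..s} \<subseteq> {l..u}"
    proof
      fix x assume x: "x \<in> {-s..s}"
      show "x \<in> {l..u}" using geometry(3,4)[OF x] S by auto
    qed
    fix x assume x: "x \<in> {-s..s}"
    have "\<bar>sym_diff k (h * \<phi> x) g x {l..u} - h ^ k * \<phi> x ^ k * poly Q x\<bar> \<le> h ^ k * \<phi> x ^ k * (2 * real k * h * real n * B (angle x))"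
      by (rule sym_diff_estimates(2)[OF h0 step_bounds(2)[OF h0 h_bounds(2)] geometry(1)[OF x] S(1) inside[OF x]])
    also have "\<dots> \<le> h ^ k * \<phi> x ^ k * (\<sigma> * B (angle x))"
      using h0 phi_nonneg[OF geometry(1)[OF x]] B_nonneg h_small(3) by (intro mult_left_mono mult_right_mono) auto
    finally show "\<bar>sym_diff k (h * \<phi> x) g x {l..u} - h ^ k * \<phi> x ^ k * poly Q x\<bar> \<le> h ^ k * \<phi> x ^ k * (\<sigma> * B (angle x))" .
  qed auto
  then have "ennreal (t ^ k) * N \<le> ennreal (t ^ k) * (ennreal (C * (2 * K) * (1 / (\<kappa> * h ^ k))) * Lp_norm p {l..u} F)"
    by (intro mult_left_mono) auto
  also have "\<dots> = ennreal (t ^ k * (C * (2 * K) * (1 / (\<kappa> * h ^ k)))) * Lp_norm p {l..u} F"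
    using t C_ge \<theta> by (simp add: ennreal_mult'[symmetric] mult.assoc[symmetric])
  also have "t ^ k * (C * (2 * K) * (1 / (\<kappa> * h ^ k))) = C * (2 * K) * (1 / (\<kappa> * \<theta> ^ k))"
    using t by (simp add: power_mult_distrib)
  also have "ennreal (C * (2 * K) * (1 / (\<kappa> * \<theta> ^ k))) * Lp_norm p {l..u} F \<le> ennreal M * Lp_norm p {l..u} F"
    by (intro mult_right_mono ennreal_leI) (auto simp: lower_const_def)
  finally show ?thesis .
qed

lemma weighted_lower_estimate:
  assumes S: "{l..u} \<subseteq> {-1..1}" "l \<le> -1 + A * h\<^sup>2" "1 - A * h\<^sup>2 \<le> u"
  shows "ennreal (t ^ k) * N \<le> ennreal M * Lp_norm p {l..u} (\<lambda>x. jacobi_w \<alpha> \<beta> x * \<phi> x ^ r * sym_diff k (h * \<phi> x) g x {l..u})"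
proof (rule lower_estimate[OF S])
  show "(\<lambda>x. jacobi_w \<alpha> \<beta> x * \<phi> x ^ r * sym_diff k (h * \<phi> x) g x {l..u}) \<in> borel_measurable borel"
    by (intro borel_measurable_times measurable_sym_diff) measurable
  fix x assume x: "x \<in> {-s..s}"
  define v where "v = jacobi_w \<alpha> \<beta> x * \<phi> x ^ r"
  have v: "0 \<le> v" using jacobi_w_nonneg phi_nonneg[OF geometry(1)[OF x]] by (simp add: v_def)
  have "\<kappa> * (v * \<bar>sym_diff k (h * \<phi> x) g x {l..u}\<bar>) \<le> 1 * (v * \<bar>sym_diff k (h * \<phi> x) g x {l..u}\<bar>)"
    using v \<kappa>_bounds by (intro mult_right_mono) auto
  then show "\<kappa> * (jacobi_w \<alpha> \<beta> x * \<phi> x ^ r) * \<bar>sym_diff k (h * \<phi> x) g x {l..u}\<bar> \<le> \<bar>jacobi_w \<alpha> \<beta> x * \<phi> x ^ r * sym_diff k (h * \<phi> x) g x {l..u}\<bar>"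
    using v unfolding v_def[symmetric] by (simp add: abs_mult mult.assoc)
qed

lemma Psi_lower: "ennreal (t ^ k) * N \<le> ennreal M * \<Psi>_modulus k r g t \<alpha> \<beta> p"
proof -
  have "ennreal (t ^ k) * N \<le> ennreal M * Lp_norm p {-1..1} (\<lambda>x. jacobi_w \<alpha> \<beta> x * \<phi> x ^ r * sym_diff k (h * \<phi> x) g x {-1..1})"
    using A by (intro weighted_lower_estimate) auto
  also have "\<dots> \<le> ennreal M * \<Psi>_modulus k r g t \<alpha> \<beta> p"
    unfolding \<Psi>_modulus_def by (intro mult_left_mono SUP_upper[OF h_bounds(3)]) simp
  finally show ?thesis .
qed

lemma Omega_lower: "ennreal (t ^ k) * N \<le> ennreal M * \<Omega>_modulus k r g A t \<alpha> \<beta> p"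
proof -
  have "ennreal (t ^ k) * N \<le> ennreal M * Lp_norm p {-1 + A * h\<^sup>2..1 - A * h\<^sup>2}
      (\<lambda>x. jacobi_w \<alpha> \<beta> x * \<phi> x ^ r * sym_diff k (h * \<phi> x) g x {-1 + A * h\<^sup>2..1 - A * h\<^sup>2})"
    using A by (intro weighted_lower_estimate) auto
  also have "\<dots> \<le> ennreal M * \<Omega>_modulus k r g A t \<alpha> \<beta> p"
    unfolding \<Omega>_modulus_def \<I>_def by (intro mult_left_mono SUP_upper[OF h_bounds(3)]) simp
  finally show ?thesis .
qed

lemma omega_lower: "ennreal (t ^ k) * N \<le> ennreal M * \<omega>_modulus k r g t \<alpha> \<beta> p"
proof -
  have "ennreal (t ^ k) * N \<le> ennreal M * Lp_norm p {-1..1} (\<lambda>x. \<W> (real k * h) \<xi> \<zeta> x * sym_diff k (h * \<phi> x) g x {-1..1})"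
  proof (rule lower_estimate)
    show "(\<lambda>x. \<W> (real k * h) \<xi> \<zeta> x * sym_diff k (h * \<phi> x) g x {-1..1}) \<in> borel_measurable borel"
      by (intro borel_measurable_times measurable_sym_diff) measurable
    fix x assume x: "x \<in> {-s..s}"
    define z where "z = real k * h * \<phi> x / 2"
    have z: "0 \<le> z" "4 * z \<le> 1 - \<bar>x\<bar>" using geometry(2,5)[OF x] by (auto simp: z_def)
    have 1: "(1 - x) powr \<xi> \<le> 2 powr \<bar>\<xi>\<bar> * (1 - x - z) powr \<xi>"
      using z geometry(4)[OF x] by (intro powr_ratio_le) (auto simp: abs_if split: if_splits)
    have 2: "(1 + x) powr \<zeta> \<le> 2 powr \<bar>\<zeta>\<bar> * (1 + x - z) powr \<zeta>"
      using z geometry(4)[OF x] by (intro powr_ratio_le) (auto simp: abs_if split: if_splits)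
    have "jacobi_w \<xi> \<zeta> x \<le> (2 powr \<bar>\<xi>\<bar> * (1 - x - z) powr \<xi>) * (2 powr \<bar>\<zeta>\<bar> * (1 + x - z) powr \<zeta>)"
      unfolding jacobi_w_def by (intro mult_mono 1 2) auto
    also have "\<dots> = 2 powr (\<bar>\<xi>\<bar> + \<bar>\<zeta>\<bar>) * \<W> (real k * h) \<xi> \<zeta> x" by (simp add: \<W>_def z_def powr_add mult_ac)
    finally have "\<kappa> * jacobi_w \<xi> \<zeta> x \<le> \<kappa> * (2 powr (\<bar>\<xi>\<bar> + \<bar>\<zeta>\<bar>) * \<W> (real k * h) \<xi> \<zeta> x)"
      by (intro mult_left_mono) auto
    also have "\<dots> = \<W> (real k * h) \<xi> \<zeta> x" by (simp add: mult.assoc[symmetric] flip: powr_add)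
    finally have "\<kappa> * jacobi_w \<xi> \<zeta> x * \<bar>sym_diff k (h * \<phi> x) g x {-1..1}\<bar> \<le> \<W> (real k * h) \<xi> \<zeta> x * \<bar>sym_diff k (h * \<phi> x) g x {-1..1}\<bar>"
      by (intro mult_right_mono) auto
    then show "\<kappa> * (jacobi_w \<alpha> \<beta> x * \<phi> x ^ r) * \<bar>sym_diff k (h * \<phi> x) g x {-1..1}\<bar> \<le> \<bar>\<W> (real k * h) \<xi> \<zeta> x * sym_diff k (h * \<phi> x) g x {-1..1}\<bar>"
      unfolding weight_split[OF geometry(1)[OF x]] by (simp add: abs_mult \<W>_def)
  qed (use A in auto)
  also have "\<dots> \<le> ennreal M * \<omega>_modulus k r g t \<alpha> \<beta> p"
    unfolding \<omega>_modulus_def by (intro mult_left_mono SUP_upper[OF h_bounds(3)]) simp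
  finally show ?thesis .
qed

end

text \<open>All quantities are compared through \<open>T\<close>, except \<open>\<omega>\<close> from above: there the constant \<open>D\<close> is kept apart because
  it may depend on \<open>p\<close>.\<close>
lemma sim_from_estimates:
  fixes Om Ps OM T :: ennreal
  assumes up: "Ps \<le> ennreal U * T" "OM \<le> ennreal U * T"
    and low: "T \<le> ennreal M * Om" "T \<le> ennreal M * Ps" "T \<le> ennreal M * OM"
    and "1 \<le> U" "1 \<le> M" and Om: "Om \<le> ennreal D * Ps"
  shows "sim (U * M) D Om Ps" "sim (U * M) (U * M) Ps OM" "sim (U * M) (U * M) OM T"
proof -
  have "1 * M \<le> U * M" "U * 1 \<le> U * M" using assms by (intro mult_right_mono mult_left_mono; simp)+
  then have c: "M \<le> U * M" "U \<le> U * M" "U * M \<le> U * M" "0 \<le> U" "0 \<le> M" "0 < U * M" using assms by auto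
  have "Ps \<le> ennreal (U * M) * Om" by (rule ennreal_le_trans_mult[OF up(1) low(1) c(3-5)])
  then show "sim (U * M) D Om Ps" unfolding sim_def using Om c by (auto intro: inverse_mult_le)
  have "OM \<le> ennreal (U * M) * Ps" by (rule ennreal_le_trans_mult[OF up(2) low(2) c(3-5)])
  moreover have "Ps \<le> ennreal (U * M) * OM" by (rule ennreal_le_trans_mult[OF up(1) low(3) c(3-5)])
  ultimately show "sim (U * M) (U * M) Ps OM" unfolding sim_def using c by (auto intro: inverse_mult_le)
  have "T \<le> ennreal (U * M) * OM" using low(3) c(1) by (meson ennreal_leI mult_right_mono order.trans zero_le)
  moreover have "OM \<le> ennreal (U * M) * T" using up(2) c(2) by (meson ennreal_leI mult_right_mono order.trans zero_le)
  ultimately show "sim (U * M) (U * M) OM T" unfolding sim_def using c by (auto intro: inverse_mult_le)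
qed

text \<open>The equivalences for all \<open>n\<close>, \<open>t\<close> and \<open>P\<close>, as a predicate of the constants.\<close>
definition moduli_sim :: "real \<Rightarrow> nat \<Rightarrow> nat \<Rightarrow> real \<Rightarrow> real \<Rightarrow> real \<Rightarrow> ennreal \<Rightarrow> real \<Rightarrow> real \<Rightarrow> bool" where
  "moduli_sim \<rho> k r A \<alpha> \<beta> p c C \<longleftrightarrow> (\<forall>(n::nat) (t::real) (P::real poly).
      n \<ge> 1 \<and> 0 < t \<and> t \<le> \<rho> / real n \<and> degree P \<le> n - 1 \<longrightarrow>
    sim c C (\<omega>_modulus k r (poly_deriv r P) t \<alpha> \<beta> p)
            (\<Psi>_modulus k r (poly_deriv r P) t \<alpha> \<beta> p) \<and>
    sim c c (\<Psi>_modulus k r (poly_deriv r P) t \<alpha> \<beta> p)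
            (\<Omega>_modulus k r (poly_deriv r P) A t \<alpha> \<beta> p) \<and>
    sim c c (\<Omega>_modulus k r (poly_deriv r P) A t \<alpha> \<beta> p)
            (ennreal (t ^ k) * Lp_norm p {-1..1}
              (\<lambda>x. jacobi_w \<alpha> \<beta> x * \<phi> x ^ (k + r) * poly_deriv (k + r) P x)))"

text \<open>The radius \<open>1 / (8 * k)\<close> guarantees \<open>8 * k * t \<le> 1 / n\<close>, which keeps the nodes of the differences and the
  ends of size \<open>6 * k * h\<close> within the angular scale \<open>1 / n\<close>. The constants \<open>C0\<close>, \<open>\<epsilon>\<close>, \<open>\<theta>\<close> and hence \<open>U * M\<close>
  are chosen before \<open>p\<close>; only \<open>V\<close>, which enters for negative exponents, depends on it.\<close>
lemma moduli_sim_exists: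
  fixes k r :: nat and \<alpha> \<beta> q A :: real
  assumes k: "k \<ge> 1" and q: "0 < q" "q \<le> 1" and A: "A > 0"
  shows "\<exists>c\<ge>1. \<forall>p. 0 < p \<and> min 1 p = ennreal q \<and> \<alpha> + real r / 2 \<in> J_set p \<and> \<beta> + real r / 2 \<in> J_set p \<longrightarrow>
    (\<exists>C\<ge>c. (0 \<le> \<alpha> + real r / 2 \<and> 0 \<le> \<beta> + real r / 2 \<longrightarrow> C = c) \<and> moduli_sim (1 / (8 * real k)) k r A \<alpha> \<beta> p c C)"
proof -
  let ?a = "\<alpha> + real (k + r) / 2" and ?b = "\<beta> + real (k + r) / 2"
  let ?\<xi> = "real r / 2 + \<alpha>" and ?\<zeta> = "real r / 2 + \<beta>"
  obtain C0 \<epsilon> where \<epsilon>: "0 < \<epsilon>" "\<epsilon> \<le> 1 / 2" and maj: "\<And>n Q. 1 \<le> n \<Longrightarrow> degree Q \<le> n \<Longrightarrow>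
    \<exists>B. slow_majorant n C0 (\<lambda>\<tau>. poly Q (- cos \<tau>)) B \<and>
      (\<forall>p. min 1 p = ennreal q \<longrightarrow> 1 / 2 \<le> ?a + 1 / enn2real p \<longrightarrow> 1 / 2 \<le> ?b + 1 / enn2real p \<longrightarrow>
        Lp_norm p {-1..1} (\<lambda>x. jacobi_w ?a ?b x * B (angle x))
         \<le> ennreal C0 * Lp_norm p {- cos (\<epsilon> / real n)..cos (\<epsilon> / real n)} (\<lambda>x. jacobi_w ?a ?b x * poly Q x))"
    using jacobi_majorant[OF q, of ?a ?b] by (elim exE conjE) (rule that; blast)
  \<comment> \<open>Any instance of the majorant, such as that of the zero polynomial, shows that \<open>C0 \<ge> 1\<close>.\<close>
  obtain B0 where "slow_majorant 1 C0 (\<lambda>\<tau>. poly 0 (- cos \<tau>)) B0" using maj[of 1 0] by auto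
  then have C0: "1 \<le> C0" by (rule slow_majorant.C_ge)
  \<comment> \<open>The last term ensures \<open>32 * A * \<theta>\<^sup>2 \<le> \<epsilon>\<^sup>2\<close>.\<close>
  define \<theta> where "\<theta> = min (min \<epsilon> (1 / (2 * (4 powr (1/q) * 2) * C0))) (\<epsilon> / (32 * (1 + A)))"
  have \<theta>: "0 < \<theta>" "\<theta> \<le> \<epsilon>" "\<theta> \<le> 1 / (2 * (4 powr (1/q) * 2) * C0)" "\<theta> \<le> \<epsilon> / (32 * (1 + A))"
    using \<epsilon> C0 A by (auto simp: \<theta>_def)
  have \<theta>A: "32 * A * \<theta>\<^sup>2 \<le> \<epsilon>\<^sup>2"
  proof -
    have 1: "32 * (1 + A) * \<theta> \<le> \<epsilon>" using \<theta>(4) A by (simp add: field_simps)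
    have "32 * A * \<theta> \<le> 32 * (1 + A) * \<theta>" using \<theta> A by (intro mult_right_mono) auto
    then have "32 * A * \<theta> \<le> \<epsilon>" using 1 by linarith
    then have "(32 * A * \<theta>) * \<theta> \<le> \<epsilon> * \<epsilon>" using \<theta> A \<epsilon> by (intro mult_mono) auto
    then show ?thesis by (simp add: power2_eq_square)
  qed
  define M where "M = lower_const q C0 k (\<bar>?\<xi>\<bar> + \<bar>?\<zeta>\<bar>) \<theta>"
  define U where "U = C0 * C0"
  have M: "1 \<le> M" by (simp add: M_def lower_const_def)
  have U: "1 \<le> U" using mult_mono[OF C0 C0] C0 by (simp add: U_def)
  have UM: "1 \<le> U * M" using mult_mono[OF U M] U by simp
  have "\<exists>C\<ge>U * M. (0 \<le> \<alpha> + real r / 2 \<and> 0 \<le> \<beta> + real r / 2 \<longrightarrow> C = U * M) \<and>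
      moduli_sim (1 / (8 * real k)) k r A \<alpha> \<beta> p (U * M) C"
    if p: "0 < p" "min 1 p = ennreal q" and J: "\<alpha> + real r / 2 \<in> J_set p" "\<beta> + real r / 2 \<in> J_set p" for p
  proof -
    have cond: "1 / 2 \<le> ?a + 1 / enn2real p" "1 / 2 \<le> ?b + 1 / enn2real p"
      by (intro exponent_condition J k)+
    define V where "V = C0 * cut_const ?\<xi> ?\<zeta> k C0 (enn2real p) powr (1 / enn2real p) * C0"
    have V: "0 \<le> V" using C0 by (simp add: V_def)
    define nonneg where "nonneg \<longleftrightarrow> 0 \<le> \<alpha> + real r / 2 \<and> 0 \<le> \<beta> + real r / 2"
    define D where "D = (if nonneg then U * M else max (U * M) (V * M))"
    have "moduli_sim (1 / (8 * real k)) k r A \<alpha> \<beta> p (U * M) D"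
      unfolding moduli_sim_def
    proof (intro allI impI)
      fix n :: nat and t :: real and P :: "real poly"
      assume "n \<ge> 1 \<and> 0 < t \<and> t \<le> 1 / (8 * real k) / real n \<and> degree P \<le> n - 1"
      then have n: "1 \<le> n" and t: "0 < t" "t \<le> 1 / (8 * real k) / real n" and deg: "degree P \<le> n - 1" by auto
      have t8: "8 * real k * t \<le> 1 / real n"
        using mult_left_mono[OF t(2), of "8 * real k"] k by simp
      have "degree ((pderiv ^^ (k + r)) P) \<le> n" using degree_pderiv_funpow_le[of "k + r" P] deg by simp
      then obtain B where B: "slow_majorant n C0 (\<lambda>\<tau>. poly ((pderiv ^^ (k + r)) P) (- cos \<tau>)) B"
        and BN: "Lp_norm p {-1..1} (\<lambda>x. jacobi_w ?a ?b x * B (angle x))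
         \<le> ennreal C0 * Lp_norm p {- cos (\<epsilon> / real n)..cos (\<epsilon> / real n)} (\<lambda>x. jacobi_w ?a ?b x * poly ((pderiv ^^ (k + r)) P) x)"
        using maj[OF n] p(2) cond by blast
      interpret small_step n k r C0 P B \<alpha> \<beta> q \<epsilon> t p A \<theta>
        by (intro small_step.intro moduli_setting.intro majorized_derivative.intro B
            moduli_setting_axioms.intro small_step_axioms.intro k q p \<epsilon> t(1) t8 BN A \<theta>(1-3) \<theta>A)
      have "\<omega>_modulus k r g t \<alpha> \<beta> p \<le> ennreal D * \<Psi>_modulus k r g t \<alpha> \<beta> p"
      proof (cases nonneg)
        case True
        then have "\<omega>_modulus k r g t \<alpha> \<beta> p \<le> \<Psi>_modulus k r g t \<alpha> \<beta> p"
          by (intro omega_le_Psi) (auto simp: nonneg_def)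
        also have "\<dots> \<le> ennreal D * \<Psi>_modulus k r g t \<alpha> \<beta> p"
          using True UM mult_right_mono[of 1 "ennreal D" "\<Psi>_modulus k r g t \<alpha> \<beta> p"] by (simp add: D_def)
        finally show ?thesis .
      next
        case False
        have fin: "p \<noteq> \<infinity>" using J False by (auto simp: J_set_def nonneg_def)
        define E where "E = enn2real p"
        have E: "0 < E" using p fin by (simp add: E_def enn2real_positive_iff less_top)
        have "- 1 / E < \<xi>" "- 1 / E < \<zeta>" using J fin by (auto simp: J_set_def E_def add.commute)
        then have "- 1 / E * E < \<xi> * E" "- 1 / E * E < \<zeta> * E" using E by (intro mult_strict_right_mono; simp)+
        then have "-1 < \<xi> * E" "-1 < \<zeta> * E" using E by auto
        then have "\<omega>_modulus k r g t \<alpha> \<beta> p \<le> ennreal V * (ennreal (t ^ k) * N)"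
          unfolding V_def E_def by (rule omega_upper[OF fin])
        then show ?thesis using Psi_lower[folded M_def]
          by (rule ennreal_le_trans_mult) (use M V False in \<open>auto simp: D_def\<close>)
      qed
      from sim_from_estimates[OF Psi_upper[folded U_def] Omega_upper[OF A, folded U_def]
          omega_lower[folded M_def] Psi_lower[folded M_def] Omega_lower[folded M_def] U M this]
      show "sim (U * M) D (\<omega>_modulus k r g t \<alpha> \<beta> p) (\<Psi>_modulus k r g t \<alpha> \<beta> p) \<and>
          sim (U * M) (U * M) (\<Psi>_modulus k r g t \<alpha> \<beta> p) (\<Omega>_modulus k r g A t \<alpha> \<beta> p) \<and>
          sim (U * M) (U * M) (\<Omega>_modulus k r g A t \<alpha> \<beta> p)
            (ennreal (t ^ k) * Lp_norm p {-1..1} (\<lambda>x. jacobi_w \<alpha> \<beta> x * \<phi> x ^ (k + r) * poly_deriv (k + r) P x))"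
        unfolding target_norm_eq by blast
    qed
    then show ?thesis by (intro exI[of _ D]) (auto simp: D_def nonneg_def)
  qed
  then show ?thesis using UM by (intro exI[of _ "U * M"]) blast
qed

theorem theorem2p1:
  fixes k :: nat and \<alpha> \<beta> q :: real
  assumes "k \<ge> 1" and "0 < q" and "q \<le> 1"
  shows "\<exists>\<rho>::real. \<rho> > 0 \<and>
    (\<forall>(r::nat) (A::real). A > 0 \<longrightarrow>
      (\<exists>c::real. c \<ge> 1 \<and>
        (\<forall>p::ennreal. 0 < p \<and> min 1 p = ennreal q \<and>
            \<alpha> + real r / 2 \<in> J_set p \<and> \<beta> + real r / 2 \<in> J_set p \<longrightarrow>
          (\<exists>C::real. C \<ge> c \<and> (0 \<le> \<alpha> + real r / 2 \<and> 0 \<le> \<beta> + real r / 2 \<longrightarrow> C = c) \<and>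
            (\<forall>(n::nat) (t::real) (P::real poly).
                n \<ge> 1 \<and> 0 < t \<and> t \<le> \<rho> / real n \<and> degree P \<le> n - 1 \<longrightarrow>
              sim c C (\<omega>_modulus k r (poly_deriv r P) t \<alpha> \<beta> p)
                      (\<Psi>_modulus k r (poly_deriv r P) t \<alpha> \<beta> p) \<and>
              sim c c (\<Psi>_modulus k r (poly_deriv r P) t \<alpha> \<beta> p)
                      (\<Omega>_modulus k r (poly_deriv r P) A t \<alpha> \<beta> p) \<and>
              sim c c (\<Omega>_modulus k r (poly_deriv r P) A t \<alpha> \<beta> p)
                      (ennreal (t ^ k) * Lp_norm p {-1..1}
                        (\<lambda>x. jacobi_w \<alpha> \<beta> x * \<phi> x ^ (k + r) * poly_deriv (k + r) P x)))))))"
  unfolding moduli_sim_def[symmetric]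
  using assms(1) by (intro exI[of _ "1 / (8 * real k)"] conjI allI impI moduli_sim_exists assms) auto

end
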